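(* Consider the system of two cubically semi-linear second-order ODEs $$y''+A_{22}y'^3+2A_{23}y'^2z'+A_{33}y'z'^2+B^2_{22}y'^2+2B^2_{23}y'z'+B^2_{33}z'^2+C^2_2y'+C^2_3z'+D^2=0,$$ $$z''+A_{22}y'^2z'+2A_{23}y'z'^2+A_{33}z'^3+B^3_{22}y'^2+2B^3_{23}y'z'+B^3_{33}z'^2+C^3_2y'+C^3_3z'+D^3=0,$$ where $'$ denotes differentiation with respect to the independent variable $x$ and the coefficients $A_{bc},B^a_{bc},C^a_b,D^a$ are functions of $(x,y,z)$. A necessary and sufficient condition for this system to be linearizable via point transformations to the simplest system of two second-order ODEs is that its coefficients satisfy the following fifteen conditions: (1) $\frac12C^3_{2x}-D^3_y+\frac14C^3_3C^3_2+\frac14C^2_2C^3_2-D^2B^3_{22}-D^3B^3_{23}=0$; (2) $B^3_{22x}-\frac12C^3_{2y}-A_{22}D^3+\frac12C^3_2B^2_{22}+\frac12C^3_3B^3_{22}-\frac12C^2_2B^3_{22}-\frac12B^3_{23}C^3_2=0$; (3) $B^3_{23x}-\frac13B^2_{22x}+\frac16C^2_{2y}-\frac43D^3A_{23}-\frac23B^3_{22}C^2_3+\frac23B^2_{23}C^3_2-\frac12C^3_{3y}=0$; (4) $\frac12C^2_{3x}-D^2_z+\frac14C^2_3C^3_3+\frac14C^2_3C^2_2-B^2_{23}D^2-B^2_{33}D^3=0$; (5) $B^2_{33x}-\frac12C^2_{3z}-D^2A_{33}+\frac12C^2_3B^3_{33}-\frac12B^2_{23}C^2_3-\frac12B^2_{33}C^3_3+\frac12B^2_{33}C^2_2=0$;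 (6) $-A_{23y}+A_{22z}-A_{22}B^2_{23}-A_{23}B^3_{23}+A_{23}B^2_{22}+A_{33}B^3_{22}=0$; (7) $-A_{33y}+A_{23z}-A_{22}B^2_{33}-A_{23}B^3_{33}+A_{23}B^2_{23}+A_{33}B^3_{23}=0$; (8) $-A_{23x}+\frac56A_{23}C^2_2+\frac13A_{33}C^3_2-\frac13B^3_{23z}+B^2_{33}B^3_{22}+\frac16C^3_3A_{23}-B^2_{23}B^3_{23}-\frac23B^2_{23y}+\frac13B^3_{33y}+\frac23B^2_{22z}-\frac13C^2_3A_{22}=0$; (9) $-A_{33x}+\frac12C^2_2A_{33}+\frac12A_{33}C^3_3-B^2_{33y}+B^2_{23z}-B^2_{22}B^2_{33}+B^2_{23}B^2_{23}-B^2_{23}B^3_{33}+B^2_{33}B^3_{23}=0$; (10) $-\frac23B^2_{22x}+\frac13C^2_{2y}-\frac12C^3_2B^3_{33}+D^2A_{22}-\frac23D^3A_{23}-\frac13C^2_3B^3_{22}+\frac56B^2_{23}C^3_2+B^3_{23x}-\frac12C^3_{2z}+\frac12C^3_3B^3_{23}-\frac12C^2_2B^3_{23}=0$; (11) $-A_{22x}+\frac12C^2_2A_{22}-B^3_{22}B^3_{33}+B^3_{23y}-B^3_{22z}+B^3_{22}B^2_{23}+B^3_{23}B^3_{23}+\frac12C^3_3A_{22}-B^3_{23}B^2_{22}=0$; (12) $D^2_y+B^2_{22}D^2+D^3B^2_{23}-D^3B^3_{33}+\frac12C^3_{3x}-\frac12C^2_{2x}-D^3_z+\frac14C^3_3C^3_3-\frac14C^2_2C^2_2-B^3_{23}D^2=0$;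 (13) $-2A_{23x}+\frac43B^3_{33y}+\frac13A_{23}C^2_2+\frac53A_{23}C^3_3+\frac23C^2_3A_{22}-\frac43B^3_{23z}-\frac23C^3_2A_{33}+2B^3_{22}B^2_{33}-2B^3_{23}B^2_{23}-\frac23B^2_{23y}+\frac23B^2_{22z}=0$; (14) $B^2_{23x}+\frac12C^2_{3y}-2D^2A_{23}+\frac12C^2_3B^3_{23}+\frac12C^2_3B^2_{22}+\frac12C^3_3B^2_{23}-\frac12B^2_{23}C^2_2-B^2_{33}C^3_2-C^2_{2z}-D^3A_{33}=0$; (15) $-B^2_{23x}+B^3_{33x}+C^2_{3y}-C^2_3B^3_{23}+C^2_3B^2_{22}+B^2_{23}C^3_3-B^2_{23}C^2_2-\frac12C^3_{3z}-\frac12C^2_{2z}-2D^3A_{33}=0$.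
   Context: The superscripts $2,3$ and subscripts $2,3$ on $A,B,C,D$ are index labels (the index $2$ refers to $y$ and $3$ to $z$), not powers; powers occur only on $y'$ and $z'$. A trailing subscript $x$, $y$ or $z$ denotes the partial derivative with respect to that variable, e.g. $C^3_{2x}=\partial C^3_2/\partial x$, $B^2_{22z}=\partial B^2_{22}/\partial z$, $A_{23y}=\partial A_{23}/\partial y$, $D^3_y=\partial D^3/\partial y$. All functions are smooth and all statements are local. A point transformation is a locally invertible change of the independent and dependent variables $u=u(x,y,z)$, $v=v(x,y,z)$, $w=w(x,y,z)$, with $u$ the new independent variable and $v,w$ the new dependent variables. The simplest system of two second-order ODEs is the free particle system $d^2v/du^2=0$, $d^2w/du^2=0$ (whose Lie point symmetry algebra is $sl(4,\mathbb{R})$). The system is linearizable via point transformations to the simplest system if some point transformation maps it to the free particle system. *)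

theory Defs
  imports "HOL-Analysis.Analysis"
begin

text \<open>Points are triples (independent variable, first and second dependent variable):
  \<open>(x, y, z)\<close> in the source space and \<open>(u, v, w)\<close> in the target space.\<close>

type_synonym point = "real \<times> real \<times> real"

definition pdx :: "(point \<Rightarrow> real) \<Rightarrow> point \<Rightarrow> real" where
  "pdx f = (\<lambda>(x, y, z). deriv (\<lambda>t. f (t, y, z)) x)"

definition pdy :: "(point \<Rightarrow> real) \<Rightarrow> point \<Rightarrow> real" where
  "pdy f = (\<lambda>(x, y, z). deriv (\<lambda>t. f (x, t, z)) y)"

definition pdz :: "(point \<Rightarrow> real) \<Rightarrow> point \<Rightarrow> real" where
  "pdz f = (\<lambda>(x, y, z). deriv (\<lambda>t. f (x, y, t)) z)"

text \<open>The two predicates below are meant for open sets only, since the derivatives are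
  taken \<open>at x\<close> rather than \<open>at x within S\<close>.\<close>

primrec Ck_on ::
  "nat \<Rightarrow> 'a::euclidean_space set \<Rightarrow> ('a \<Rightarrow> 'b::real_normed_vector) \<Rightarrow> bool" where
  "Ck_on 0 S f \<longleftrightarrow> continuous_on S f"
| "Ck_on (Suc k) S f \<longleftrightarrow>
     (\<forall>x\<in>S. f differentiable at x) \<and> (\<forall>h. Ck_on k S (\<lambda>x. frechet_derivative f (at x) h))"

definition smooth_on :: "'a::euclidean_space set \<Rightarrow> ('a \<Rightarrow> 'b::real_normed_vector) \<Rightarrow> bool" where
  "smooth_on S f \<longleftrightarrow> (\<forall>k. Ck_on k S f)"

text \<open>A pair \<open>F\<close>, \<open>G\<close> of functions of \<open>(x, y, z)\<close>, \<open>y'\<close>, \<open>z'\<close> stands for the system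
  \<open>y'' + F = 0\<close>, \<open>z'' + G = 0\<close>; the free particle system has \<open>F = G = 0\<close>.\<close>

type_synonym jet_fun = "point \<Rightarrow> real \<Rightarrow> real \<Rightarrow> real"

definition solves :: "jet_fun \<Rightarrow> jet_fun \<Rightarrow> real set \<Rightarrow> (real \<Rightarrow> real) \<Rightarrow> (real \<Rightarrow> real) \<Rightarrow> bool" where
  "solves F G I y z \<longleftrightarrow>
     (\<forall>t\<in>I. deriv (deriv y) t + F (t, y t, z t) (deriv y t) (deriv z t) = 0
          \<and> deriv (deriv z) t + G (t, y t, z t) (deriv y t) (deriv z t) = 0)"

definition curve_graph :: "real set \<Rightarrow> (real \<Rightarrow> real) \<Rightarrow> (real \<Rightarrow> real) \<Rightarrow> point set" where
  "curve_graph I y z = (\<lambda>t. (t, y t, z t)) ` I"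

definition smooth_curve :: "real set \<Rightarrow> (real \<Rightarrow> real) \<Rightarrow> (real \<Rightarrow> real) \<Rightarrow> bool" where
  "smooth_curve I y z \<longleftrightarrow> open I \<and> is_interval I \<and> smooth_on I y \<and> smooth_on I z"

definition point_transformation :: "point set \<Rightarrow> (point \<Rightarrow> point) \<Rightarrow> bool" where
  "point_transformation V \<phi> \<longleftrightarrow>
     open V \<and> open (\<phi> ` V) \<and> smooth_on V \<phi> \<and>
     (\<exists>\<psi>. smooth_on (\<phi> ` V) \<psi> \<and> (\<forall>p\<in>V. \<psi> (\<phi> p) = p))"

text \<open>A point transformation acts on functions \<open>(y, z)\<close> of \<open>x\<close> through their graphs: the new
  functions \<open>(v, w)\<close> of \<open>u\<close> are those whose graph is the image. Since \<open>\<phi>\<close> is a diffeomorphism,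
  the graph of \<open>(y, z)\<close> is locally mapped to such a graph exactly where
  \<open>u\<^sub>x + u\<^sub>y y' + u\<^sub>z z'\<close> does not vanish, so that \<open>u\<close> can serve as the new independent
  variable.\<close>

definition maps_system ::
  "point set \<Rightarrow> (point \<Rightarrow> point) \<Rightarrow> jet_fun \<Rightarrow> jet_fun \<Rightarrow> jet_fun \<Rightarrow> jet_fun \<Rightarrow> bool" where
  "maps_system V \<phi> F G F' G' \<longleftrightarrow>
     (\<forall>I y z J v w.
        smooth_curve I y z \<and> curve_graph I y z \<subseteq> V \<and>
        smooth_curve J v w \<and> \<phi> ` curve_graph I y z = curve_graph J v w \<longrightarrow>
        (solves F G I y z \<longleftrightarrow> solves F' G' J v w))"

definition linearizable :: "point set \<Rightarrow> jet_fun \<Rightarrow> jet_fun \<Rightarrow> bool" where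
  "linearizable U F G \<longleftrightarrow>
     (\<forall>p\<in>U. \<exists>V \<phi>. p \<in> V \<and> V \<subseteq> U \<and> point_transformation V \<phi> \<and>
        maps_system V \<phi> F G (\<lambda>_ _ _. 0) (\<lambda>_ _ _. 0))"

end

theory Submission
  imports Defs
begin

text \<open>A system of this cubic form is the system of unparametrised geodesics of a projective
  connection in \<open>(x, y, z)\<close>-space, and a point transformation linearizes it iff it maps these
  geodesics to straight lines. The fifteen conditions are linear combinations of the components of
  the projective Weyl tensor and conversely.

  If \<open>\<phi>\<close> linearizes the system, pulling back straight lines shows that the system is the geodesic
  system of the flat connection pulled back by \<open>\<phi>\<close>, and the conditions are linear combinations of its
  vanishing curvature components.

  Conversely, let \<open>\<Pi>\<close> be the trace-free (Thomas) connection and \<open>P\<close> half its Ricci tensor. The linear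
  system \<open>\<partial>\<^sub>i\<partial>\<^sub>j \<sigma> = \<Pi>\<^sup>k\<^sub>i\<^sub>j \<partial>\<^sub>k \<sigma> - P\<^sub>i\<^sub>j \<sigma>\<close> is completely integrable: the obstructions are the
  Weyl tensor, zero by assumption, and the Cotton tensor, which in dimension three then vanishes by
  the second Bianchi identity. Four independent solutions give the linearizing transformation
  \<open>(\<sigma>\<^sub>1/\<sigma>\<^sub>0, \<sigma>\<^sub>2/\<sigma>\<^sub>0, \<sigma>\<^sub>3/\<sigma>\<^sub>0)\<close>.\<close>

section \<open>Calculus of smooth functions\<close>

text \<open>Why the quotients straighten geodesics: along a geodesic of \<open>\<Pi>\<close> in an
  affine parameter, every solution satisfies \<sigma>'' = - P(c', c') \<sigma>, one and the same
  scalar linear equation of order two. The four restrictions thus lie in a space of dimension at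
  most two, and the quotients trace a straight line.

  The number fifteen is n^2 (n^2 - 4) / 3 at n = 3, the number of independent components of the
  projective Weyl tensor.

  The obstacle in the necessity part is that a linearizing map is known only through curves that are
  graphs both over x and over u. Lines along which u is constant are never seen, so two systems with
  the same image can be compared only at slopes with u_x + u_y y' + u_z z' \<noteq> 0. That both are
  cubic in the slope closes the gap.

  In the sufficiency part the coefficients are only smooth, so power series are out of reach. The
  linear system is integrated by estimates, and its solutions are then shown to be smooth.\<close>

lemma Ck_on_cong:
  assumes "open S" "\<And>x. x \<in> S \<Longrightarrow> f x = g x" "Ck_on k S f"
  shows "Ck_on k S g"
  using assms(2,3)
proof (induction k arbitrary: f g)
  case 0
  then show ?case by (simp cong: continuous_on_cong)
next
  case (Suc k)
  have D: "(g has_derivative frechet_derivative f (at x)) (at x)" if "x \<in> S" for x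
    using Suc.prems that assms(1)
    by (metis Ck_on.simps(2) frechet_derivative_works has_derivative_transform_within_open)
  then have E: "frechet_derivative f (at x) = frechet_derivative g (at x)" if "x \<in> S" for x
    using frechet_derivative_at that by blast
  have "Ck_on k S (\<lambda>x. frechet_derivative g (at x) h)" for h
    by (rule Suc.IH[of "\<lambda>x. frechet_derivative f (at x) h"]) (use Suc.prems E in auto)
  with D show ?case by (auto simp: differentiable_def)
qed

lemma Ck_on_SucI:
  assumes "open S" "\<And>x. x \<in> S \<Longrightarrow> (f has_derivative f' x) (at x)"
    and "\<And>h. Ck_on k S (\<lambda>x. f' x h)"
  shows "Ck_on (Suc k) S f"
proof -
  have "f' x = frechet_derivative f (at x)" if "x \<in> S" for x
    using assms(2) frechet_derivative_at that by blast
  then have "Ck_on k S (\<lambda>x. frechet_derivative f (at x) h)" for h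
    using Ck_on_cong[OF assms(1) _ assms(3)[of h]] by auto
  then show ?thesis using assms(2) by (auto simp: differentiable_def)
qed

lemma Ck_on_has_derivative:
  "Ck_on (Suc k) S f \<Longrightarrow> x \<in> S \<Longrightarrow> (f has_derivative frechet_derivative f (at x)) (at x)"
  by (simp add: frechet_derivative_works)

lemma Ck_on_Suc_imp: "Ck_on (Suc k) S f \<Longrightarrow> Ck_on k S f"
proof (induction k arbitrary: f)
  case 0
  then show ?case
    using differentiable_imp_continuous_within continuous_at_imp_continuous_on by auto blast
qed auto

lemma Ck_on_imp_continuous_on: "Ck_on k S f \<Longrightarrow> continuous_on S f"
  by (induction k) (use Ck_on_Suc_imp in auto)

lemma Ck_on_subset: "Ck_on k S f \<Longrightarrow> T \<subseteq> S \<Longrightarrow> Ck_on k T f"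
  by (induction k arbitrary: f) (auto intro: continuous_on_subset)

lemma Ck_on_const: "open S \<Longrightarrow> Ck_on k S (\<lambda>x. c)"
proof (induction k arbitrary: c)
  case (Suc k)
  then show ?case by (intro Ck_on_SucI[where f' = "\<lambda>x h. 0"]) auto
qed auto

lemma Ck_on_bounded_linear:
  assumes "bounded_linear L" "open S" "Ck_on k S f"
  shows "Ck_on k S (\<lambda>x. L (f x))"
  using assms(3)
proof (induction k arbitrary: f)
  case 0
  then show ?case using bounded_linear.continuous_on[OF assms(1)] by auto
next
  case (Suc k)
  show ?case
  proof (rule Ck_on_SucI[OF assms(2)])
    show "((\<lambda>x. L (f x)) has_derivative (\<lambda>h. L (frechet_derivative f (at x) h))) (at x)"
      if "x \<in> S" for x
      using bounded_linear.has_derivative[OF assms(1) Ck_on_has_derivative[OF Suc.prems that]] .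
    show "Ck_on k S (\<lambda>x. L (frechet_derivative f (at x) h))" for h
      using Suc by simp
  qed
qed

lemma Ck_on_ident: "open S \<Longrightarrow> Ck_on k S (\<lambda>x. x)"
  by (cases k) (auto intro!: Ck_on_SucI[where f' = "\<lambda>x h. h"] Ck_on_const)

lemma Ck_on_add:
  assumes "open S" "Ck_on k S f" "Ck_on k S g"
  shows "Ck_on k S (\<lambda>x. f x + g x)"
  using assms(2,3)
proof (induction k arbitrary: f g)
  case 0
  then show ?case by (auto intro: continuous_intros)
next
  case (Suc k)
  show ?case
  proof (rule Ck_on_SucI[OF assms(1)])
    show "((\<lambda>x. f x + g x) has_derivative
        (\<lambda>h. frechet_derivative f (at x) h + frechet_derivative g (at x) h)) (at x)" if "x \<in> S" for x
      using Suc.prems that by (intro has_derivative_add Ck_on_has_derivative)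
    show "Ck_on k S (\<lambda>x. frechet_derivative f (at x) h + frechet_derivative g (at x) h)" for h
      using Suc by simp
  qed
qed

lemma Ck_on_sum:
  assumes "open S" "\<And>i. i \<in> I \<Longrightarrow> Ck_on k S (f i)"
  shows "Ck_on k S (\<lambda>x. \<Sum>i\<in>I. f i x)"
  using assms(2)
  by (induction I rule: infinite_finite_induct) (auto intro: Ck_on_const Ck_on_add assms(1))

lemma Ck_on_bilinear:
  assumes "bounded_bilinear B" "open S" "Ck_on k S f" "Ck_on k S g"
  shows "Ck_on k S (\<lambda>x. B (f x) (g x))"
  using assms(3,4)
proof (induction k arbitrary: f g)
  case 0
  then show ?case using bounded_bilinear.continuous_on[OF assms(1)] by auto
next
  case (Suc k)
  show ?case
  proof (rule Ck_on_SucI[OF assms(2)])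
    show "((\<lambda>x. B (f x) (g x)) has_derivative
        (\<lambda>h. B (f x) (frechet_derivative g (at x) h) + B (frechet_derivative f (at x) h) (g x))) (at x)"
      if "x \<in> S" for x
      using Suc.prems that
      by (intro bounded_bilinear.FDERIV[OF assms(1)] Ck_on_has_derivative)
    show "Ck_on k S (\<lambda>x. B (f x) (frechet_derivative g (at x) h) + B (frechet_derivative f (at x) h) (g x))" for h
      using Suc.prems Suc.IH Ck_on_Suc_imp[OF Suc.prems(1)] Ck_on_Suc_imp[OF Suc.prems(2)]
      by (intro Ck_on_add assms(2)) auto
  qed
qed

text \<open>\<open>Ck_on\<close> controls derivatives in fixed directions only, whereas the chain
  rule differentiates \<open>g\<close> in a direction that moves with \<open>x\<close>. Expanding
  that direction in \<open>Basis\<close> reduces the claim to fixed directions, to which the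
  induction hypothesis applies.\<close>

lemma Ck_on_compose:
  fixes f :: "'a::euclidean_space \<Rightarrow> 'b::euclidean_space" and g :: "'b \<Rightarrow> 'c::real_normed_vector"
  assumes "open S" "open T" "f ` S \<subseteq> T" "Ck_on k S f" "Ck_on k T g"
  shows "Ck_on k S (\<lambda>x. g (f x))"
  using assms(4,5)
proof (induction k arbitrary: g)
  case 0
  then show ?case using assms(3) by (auto intro: continuous_on_compose2)
next
  case (Suc k)
  let ?Df = "\<lambda>x. frechet_derivative f (at x)" and ?Dg = "\<lambda>x. frechet_derivative g (at x)"
  have Dg: "(g has_derivative ?Dg (f x)) (at (f x))" if "x \<in> S" for x
    using Suc.prems(2) that assms(3) by (intro Ck_on_has_derivative) auto
  have expand: "?Dg (f x) (?Df x h) = (\<Sum>b\<in>Basis. (?Df x h \<bullet> b) *\<^sub>R ?Dg (f x) b)" if "x \<in> S" for x h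
  proof -
    interpret bounded_linear "?Dg (f x)" using Dg[OF that] by (rule has_derivative_bounded_linear)
    have "?Dg (f x) (?Df x h) = ?Dg (f x) (\<Sum>b\<in>Basis. (?Df x h \<bullet> b) *\<^sub>R b)"
      by (simp add: euclidean_representation)
    then show ?thesis by (simp add: sum scaleR)
  qed
  show ?case
  proof (rule Ck_on_SucI[OF assms(1)])
    show "((\<lambda>x. g (f x)) has_derivative (\<lambda>h. \<Sum>b\<in>Basis. (?Df x h \<bullet> b) *\<^sub>R ?Dg (f x) b)) (at x)"
      if "x \<in> S" for x
      using has_derivative_compose[OF Ck_on_has_derivative[OF Suc.prems(1) that] Dg[OF that]] expand[OF that]
      by simp
    have "Ck_on k S f" using Ck_on_Suc_imp[OF Suc.prems(1)] .
    then show "Ck_on k S (\<lambda>x. \<Sum>b\<in>Basis. (?Df x h \<bullet> b) *\<^sub>R ?Dg (f x) b)" for h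
      using Suc.prems Suc.IH[of "\<lambda>x. frechet_derivative g (at x) b" for b]
      by (intro Ck_on_sum Ck_on_bilinear[OF bounded_bilinear_scaleR] Ck_on_bounded_linear[OF bounded_linear_inner_left] assms(1)) auto
  qed
qed

lemma Ck_on_inverse:
  fixes f :: "'a::euclidean_space \<Rightarrow> real"
  assumes "open S" "Ck_on k S f" "\<And>x. x \<in> S \<Longrightarrow> f x \<noteq> 0"
  shows "Ck_on k S (\<lambda>x. inverse (f x))"
  using assms(2)
proof (induction k)
  case 0
  then show ?case using assms(3) by (auto intro: continuous_intros)
next
  case (Suc k)
  show ?case
  proof (rule Ck_on_SucI[OF assms(1)])
    show "((\<lambda>x. inverse (f x)) has_derivative
       (\<lambda>h. - (inverse (f x) * frechet_derivative f (at x) h * inverse (f x)))) (at x)" if "x \<in> S" for x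
      using Suc.prems that assms(3) by (intro Deriv.has_derivative_inverse Ck_on_has_derivative)
    show "Ck_on k S (\<lambda>x. - (inverse (f x) * frechet_derivative f (at x) h * inverse (f x)))" for h
      using Suc Ck_on_Suc_imp[OF Suc.prems]
      by (intro Ck_on_bounded_linear[OF bounded_linear_minus[OF bounded_linear_ident]]
          Ck_on_bilinear[OF bounded_bilinear_mult] assms(1)) auto
  qed
qed

section \<open>Closure properties of smooth maps\<close>

lemma smooth_on_cong: "smooth_on S f \<Longrightarrow> open S \<Longrightarrow> (\<And>x. x \<in> S \<Longrightarrow> f x = g x) \<Longrightarrow> smooth_on S g"
  unfolding smooth_on_def using Ck_on_cong by blast

lemma smooth_on_subset: "smooth_on S f \<Longrightarrow> T \<subseteq> S \<Longrightarrow> smooth_on T f"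
  unfolding smooth_on_def using Ck_on_subset by blast

lemma smooth_on_imp_continuous_on: "smooth_on S f \<Longrightarrow> continuous_on S f"
  unfolding smooth_on_def using Ck_on_imp_continuous_on by blast

lemma smooth_on_has_derivative:
  "smooth_on S f \<Longrightarrow> x \<in> S \<Longrightarrow> (f has_derivative frechet_derivative f (at x)) (at x)"
  unfolding smooth_on_def using Ck_on_has_derivative by blast

lemma smooth_on_frechet_derivative:
  "smooth_on S f \<Longrightarrow> smooth_on S (\<lambda>x. frechet_derivative f (at x) h)"
  unfolding smooth_on_def using Ck_on.simps(2) by blast

lemma smooth_on_const: "open S \<Longrightarrow> smooth_on S (\<lambda>x. c)"
  unfolding smooth_on_def using Ck_on_const by blast

lemma smooth_on_ident: "open S \<Longrightarrow> smooth_on S (\<lambda>x. x)"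
  unfolding smooth_on_def using Ck_on_ident by blast

lemma smooth_on_bounded_linear:
  "bounded_linear L \<Longrightarrow> open S \<Longrightarrow> smooth_on S f \<Longrightarrow> smooth_on S (\<lambda>x. L (f x))"
  unfolding smooth_on_def using Ck_on_bounded_linear by blast

lemma smooth_on_add: "open S \<Longrightarrow> smooth_on S f \<Longrightarrow> smooth_on S g \<Longrightarrow> smooth_on S (\<lambda>x. f x + g x)"
  unfolding smooth_on_def using Ck_on_add by blast

lemma smooth_on_sum:
  "open S \<Longrightarrow> (\<And>i. i \<in> I \<Longrightarrow> smooth_on S (f i)) \<Longrightarrow> smooth_on S (\<lambda>x. \<Sum>i\<in>I. f i x)"
  unfolding smooth_on_def by (simp add: Ck_on_sum)

lemma smooth_on_bilinear:
  "bounded_bilinear B \<Longrightarrow> open S \<Longrightarrow> smooth_on S f \<Longrightarrow> smooth_on S g \<Longrightarrow> smooth_on S (\<lambda>x. B (f x) (g x))"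
  unfolding smooth_on_def using Ck_on_bilinear by blast

lemma smooth_on_minus: "open S \<Longrightarrow> smooth_on S f \<Longrightarrow> smooth_on S (\<lambda>x. - f x)"
  using smooth_on_bounded_linear[OF bounded_linear_minus[OF bounded_linear_ident]] .

lemma smooth_on_diff: "open S \<Longrightarrow> smooth_on S f \<Longrightarrow> smooth_on S g \<Longrightarrow> smooth_on S (\<lambda>x. f x - g x)"
  using smooth_on_add[OF _ _ smooth_on_minus, of S f g] by simp

lemma smooth_on_mult:
  fixes f g :: "'a::euclidean_space \<Rightarrow> real"
  shows "open S \<Longrightarrow> smooth_on S f \<Longrightarrow> smooth_on S g \<Longrightarrow> smooth_on S (\<lambda>x. f x * g x)"
  using smooth_on_bilinear[OF bounded_bilinear_mult] .

lemma smooth_on_scaleR: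
  "open S \<Longrightarrow> smooth_on S f \<Longrightarrow> smooth_on S g \<Longrightarrow> smooth_on S (\<lambda>x. f x *\<^sub>R g x)"
  using smooth_on_bilinear[OF bounded_bilinear_scaleR] .

lemma smooth_on_divide:
  fixes f g :: "'a::euclidean_space \<Rightarrow> real"
  shows "open S \<Longrightarrow> smooth_on S f \<Longrightarrow> smooth_on S g \<Longrightarrow> (\<And>x. x \<in> S \<Longrightarrow> g x \<noteq> 0) \<Longrightarrow> smooth_on S (\<lambda>x. f x / g x)"
  unfolding divide_inverse
  by (intro smooth_on_mult) (auto simp: smooth_on_def Ck_on_inverse)

lemma smooth_on_fst: "open S \<Longrightarrow> smooth_on S f \<Longrightarrow> smooth_on S (\<lambda>x. fst (f x))"
  using smooth_on_bounded_linear[OF bounded_linear_fst] .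

lemma smooth_on_snd: "open S \<Longrightarrow> smooth_on S f \<Longrightarrow> smooth_on S (\<lambda>x. snd (f x))"
  using smooth_on_bounded_linear[OF bounded_linear_snd] .

lemma smooth_on_Pair:
  assumes "open S" "smooth_on S f" "smooth_on S g"
  shows "smooth_on S (\<lambda>x. (f x, g x))"
proof -
  have "bounded_linear (\<lambda>x. (x, 0))" "bounded_linear (\<lambda>x. (0, x))"
    by (simp_all add: bounded_linear_Pair bounded_linear_ident bounded_linear_zero)
  then have "smooth_on S (\<lambda>x. (f x, 0) + (0, g x))"
    by (intro smooth_on_add smooth_on_bounded_linear[of "\<lambda>x. (x, 0)"] smooth_on_bounded_linear[of "\<lambda>x. (0, x)"] assms)
  then show ?thesis by simp
qed

lemma smooth_on_compose:
  "open S \<Longrightarrow> open T \<Longrightarrow> f ` S \<subseteq> T \<Longrightarrow> smooth_on S f \<Longrightarrow> smooth_on T g \<Longrightarrow> smooth_on S (\<lambda>x. g (f x))"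
  for f :: "'a::euclidean_space \<Rightarrow> 'b::euclidean_space"
  unfolding smooth_on_def using Ck_on_compose by blast

lemmas smooth_intros = smooth_on_const smooth_on_ident smooth_on_add smooth_on_diff smooth_on_minus
  smooth_on_mult smooth_on_scaleR smooth_on_fst smooth_on_snd smooth_on_Pair

lemma has_derivative_expand:
  fixes f :: "'a::euclidean_space \<Rightarrow> 'b::real_normed_vector"
  assumes "(f has_derivative f') F"
  shows "f' h = (\<Sum>b\<in>Basis. (h \<bullet> b) *\<^sub>R f' b)"
proof -
  interpret bounded_linear f' using assms by (rule has_derivative_bounded_linear)
  have "f' h = f' (\<Sum>b\<in>Basis. (h \<bullet> b) *\<^sub>R b)"
    by (simp add: euclidean_representation)
  then show ?thesis by (simp add: sum scaleR)
qed

text \<open>A bootstrap: the derivative of \<open>g\<close> at \<open>y\<close> is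
  \<open>A (g y)\<close>, so if \<open>g\<close> is C^k then so is its derivative, and
  \<open>g\<close> is C^(k+1). Taking the inverse \<open>A\<close> of the derivative as given
  reduces its smoothness to an explicit formula in each application.\<close>

lemma smooth_on_inverse_function:
  fixes f :: "'a::euclidean_space \<Rightarrow> 'b::euclidean_space"
  assumes "open S" "open T" "g ` T \<subseteq> S" "continuous_on T g"
    and fg: "\<And>y. y \<in> T \<Longrightarrow> f (g y) = y"
    and f': "\<And>x. x \<in> S \<Longrightarrow> (f has_derivative f' x) (at x)"
    and A: "\<And>x h. x \<in> S \<Longrightarrow> A x (f' x h) = h" "\<And>x. x \<in> S \<Longrightarrow> bounded_linear (A x)"
    and "\<And>h. smooth_on S (\<lambda>x. A x h)"
  shows "smooth_on T g"
  unfolding smooth_on_def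
proof
  have D: "(g has_derivative A (g y)) (at y)" if "y \<in> T" for y
  proof (rule has_derivative_inverse_basic[of f "f' (g y)"])
    have "g y \<in> S" using that assms(3) by auto
    then show "(f has_derivative f' (g y)) (at (g y))" "bounded_linear (A (g y))" "A (g y) \<circ> f' (g y) = id"
      using f' A by (auto simp: fun_eq_iff)
    show "continuous (at y) g" using assms(2,4) that continuous_on_eq_continuous_at by blast
  qed (use assms that in auto)
  fix k show "Ck_on k T g"
  proof (induction k)
    case 0
    then show ?case using assms by simp
  next
    case (Suc k)
    show ?case
    proof (rule Ck_on_SucI[OF assms(2) D])
      show "Ck_on k T (\<lambda>y. A (g y) h)" for h
        using Suc assms unfolding smooth_on_def by (intro Ck_on_compose[of T S g k "\<lambda>x. A x h"]) auto
    qed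
  qed
qed

text \<open>The second difference is the increment over \<open>[0, s]\<close> of the difference of
  \<open>f\<close> across the side \<open>s k\<close>. Its derivative is a difference of two values
  of \<open>Df h\<close>, which differentiability of \<open>Df h\<close> at \<open>p\<close> alone
  puts within \<open>e * s\<close> of \<open>s L k\<close>. The mean value inequality multiplies
  this by \<open>s\<close>.\<close>

lemma second_difference_bound:
  fixes f :: "'a::euclidean_space \<Rightarrow> 'b::real_normed_vector"
  assumes S: "open S" "p \<in> S" and f: "\<And>x. x \<in> S \<Longrightarrow> f differentiable at x"
    and d: "((\<lambda>x. frechet_derivative f (at x) h) has_derivative L) (at p)" and "e > 0"
  shows "\<exists>d>0. \<forall>s. 0 < s \<and> s < d \<longrightarrow>
     norm (f (p + s *\<^sub>R h + s *\<^sub>R k) - f (p + s *\<^sub>R h) - f (p + s *\<^sub>R k) + f p - (s * s) *\<^sub>R L k) \<le> e * s\<^sup>2"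
proof -
  interpret L: bounded_linear L using d by (rule has_derivative_bounded_linear)
  define G where "G = (\<lambda>x. frechet_derivative f (at x) h)"
  \<comment> \<open>Two remainders of size \<open>s * (norm h + norm k)\<close> occur, whence the
    factor 2; the summand 1 makes \<open>N\<close> positive. Dividing by \<open>N\<close> below also
    keeps the whole parallelogram inside both balls.\<close>
  define N where "N = 2 * (norm h + norm k) + 1"
  have N: "N > 0" unfolding N_def by (intro add_nonneg_pos) auto
  obtain d1 where d1: "d1 > 0" "ball p d1 \<subseteq> S" using S openE by blast
  have "\<exists>d>0. \<forall>x. norm (x - p) < d \<longrightarrow> norm (G x - G p - L (x - p)) \<le> (e/N) * norm (x - p)"
    using d[folded G_def] divide_pos_pos[OF \<open>e > 0\<close> N] unfolding has_derivative_at_alt by blast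
  then obtain d2 where d2: "d2 > 0"
    "\<And>x. norm (x - p) < d2 \<Longrightarrow> norm (G x - G p - L (x - p)) \<le> (e/N) * norm (x - p)" by blast
  define d where "d = min d1 d2 / N"
  have "d > 0" using d1 d2 N by (simp add: d_def)
  have "norm (f (p + s *\<^sub>R h + s *\<^sub>R k) - f (p + s *\<^sub>R h) - f (p + s *\<^sub>R k) + f p - (s * s) *\<^sub>R L k) \<le> e * s\<^sup>2"
    if s: "0 < s" "s < d" for s
  proof -
    have sN: "s * N < min d1 d2" using s N by (simp add: d_def field_simps)
    have small: "norm (r *\<^sub>R h + q *\<^sub>R k) \<le> s * (norm h + norm k)" "norm (r *\<^sub>R h + q *\<^sub>R k) < min d1 d2"
      if "0 \<le> r" "r \<le> s" "0 \<le> q" "q \<le> s" for r q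
    proof -
      have "norm (r *\<^sub>R h + q *\<^sub>R k) \<le> r * norm h + q * norm k"
        using norm_triangle_ineq[of "r *\<^sub>R h" "q *\<^sub>R k"] that by simp
      also have "\<dots> \<le> s * norm h + s * norm k"
        using that by (intro add_mono mult_right_mono) auto
      finally show 1: "norm (r *\<^sub>R h + q *\<^sub>R k) \<le> s * (norm h + norm k)" by (simp add: algebra_simps)
      have "s * (norm h + norm k) \<le> s * N" using s by (intro mult_left_mono) (auto simp: N_def)
      then show "norm (r *\<^sub>R h + q *\<^sub>R k) < min d1 d2" using 1 sN by linarith
    qed
    define F where "F = (\<lambda>r. f (p + (r *\<^sub>R h + s *\<^sub>R k)) - f (p + (r *\<^sub>R h + 0 *\<^sub>R k)) - (r * s) *\<^sub>R L k)"
    have inS: "p + (r *\<^sub>R h + q *\<^sub>R k) \<in> S" if "0 \<le> r" "r \<le> s" "0 \<le> q" "q \<le> s" for r q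
      by (rule subsetD[OF d1(2)]) (use small(2)[OF that] norm_minus_cancel[of "r *\<^sub>R h + q *\<^sub>R k"] in \<open>simp add: dist_norm\<close>)
    have DF: "(F has_derivative (\<lambda>t. t *\<^sub>R (G (p + (r *\<^sub>R h + s *\<^sub>R k)) - G (p + (r *\<^sub>R h + 0 *\<^sub>R k)) - s *\<^sub>R L k)))
        (at r within {0..s})" if "r \<in> {0..s}" for r
    proof -
      have fq: "((\<lambda>r. f (p + (r *\<^sub>R h + q *\<^sub>R k))) has_derivative (\<lambda>t. t *\<^sub>R G (p + (r *\<^sub>R h + q *\<^sub>R k)))) (at r within {0..s})"
        if "0 \<le> q" "q \<le> s" for q
      proof -
        have fd: "(f has_derivative frechet_derivative f (at (p + (r *\<^sub>R h + q *\<^sub>R k)))) (at (p + (r *\<^sub>R h + q *\<^sub>R k)))"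
          using f inS \<open>r \<in> {0..s}\<close> that by (auto simp: frechet_derivative_works[symmetric])
        have "((\<lambda>r. p + (r *\<^sub>R h + q *\<^sub>R k)) has_derivative (\<lambda>t. t *\<^sub>R h)) (at r within {0..s})"
          by (auto intro!: derivative_eq_intros)
        from has_derivative_compose[OF this fd] show ?thesis
          using linear_cmul[OF has_derivative_linear[OF fd]] by (simp add: G_def)
      qed
      show ?thesis unfolding F_def
        by (rule derivative_eq_intros fq | use s in \<open>simp; fail\<close>)+ (auto simp: algebra_simps)
    qed
    have B: "onorm (\<lambda>t::real. t *\<^sub>R (G (p + (r *\<^sub>R h + s *\<^sub>R k)) - G (p + (r *\<^sub>R h + 0 *\<^sub>R k)) - s *\<^sub>R L k)) \<le> e * s"
      if "r \<in> {0..s}" for r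
    proof -
      let ?a = "G (p + (r *\<^sub>R h + s *\<^sub>R k)) - G p - L (r *\<^sub>R h + s *\<^sub>R k)"
      let ?b = "G (p + (r *\<^sub>R h + 0 *\<^sub>R k)) - G p - L (r *\<^sub>R h + 0 *\<^sub>R k)"
      have bd: "norm (G (p + (r *\<^sub>R h + q *\<^sub>R k)) - G p - L (r *\<^sub>R h + q *\<^sub>R k)) \<le> (e/N) * (s * (norm h + norm k))"
        if "0 \<le> q" "q \<le> s" for q
      proof -
        have "norm (G (p + (r *\<^sub>R h + q *\<^sub>R k)) - G p - L (r *\<^sub>R h + q *\<^sub>R k)) \<le> (e/N) * norm (r *\<^sub>R h + q *\<^sub>R k)"
          using d2(2)[of "p + (r *\<^sub>R h + q *\<^sub>R k)"] small(2)[of r q] that \<open>r \<in> {0..s}\<close> by simp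
        also have "\<dots> \<le> (e/N) * (s * (norm h + norm k))"
          using small(1)[of r q] that \<open>r \<in> {0..s}\<close> \<open>e > 0\<close> N by (intro mult_left_mono) auto
        finally show ?thesis .
      qed
      have "norm (G (p + (r *\<^sub>R h + s *\<^sub>R k)) - G (p + (r *\<^sub>R h + 0 *\<^sub>R k)) - s *\<^sub>R L k) = norm (?a - ?b)"
        by (simp add: L.add L.scaleR L.zero algebra_simps)
      also have "\<dots> \<le> (e/N) * (s * (norm h + norm k)) + (e/N) * (s * (norm h + norm k))"
        using bd[of s] bd[of 0] s norm_triangle_ineq4[of ?a ?b] by linarith
      also have "\<dots> = (e * s) * (2 * (norm h + norm k) / N)" by (simp add: field_simps)
      also have "\<dots> \<le> (e * s) * 1"
        using s \<open>e > 0\<close> N by (intro mult_left_mono) (auto simp: N_def field_simps)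
      finally show ?thesis by (simp add: onorm_scaleR_left onorm_id)
    qed
    have "norm (F s - F 0) \<le> (e * s) * norm (s - 0)"
      by (rule differentiable_bound[OF _ DF B]) (use s in auto)
    then show ?thesis using s by (simp add: F_def power2_eq_square algebra_simps)
  qed
  then show ?thesis using \<open>d > 0\<close> by blast
qed

text \<open>The second difference over a parallelogram is symmetric in \<open>h\<close> and
  \<open>k\<close>, and both mixed derivatives approximate it up to o(s^2).\<close>

lemma symmetric_second_derivative:
  fixes f :: "'a::euclidean_space \<Rightarrow> 'b::real_normed_vector"
  assumes S: "open S" "p \<in> S" and f: "smooth_on S f"
  shows "frechet_derivative (\<lambda>x. frechet_derivative f (at x) h) (at p) k
       = frechet_derivative (\<lambda>x. frechet_derivative f (at x) k) (at p) h" (is "?A = ?B")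
proof (rule ccontr)
  assume ne: "?A \<noteq> ?B"
  \<comment> \<open>With a third of the gap as tolerance, the two approximations together account
    for at most \<open>2 * e\<close> of a gap of \<open>3 * e\<close>.\<close>
  define e where "e = norm (?A - ?B) / 3"
  have e: "e > 0" using ne by (simp add: e_def)
  have d: "f differentiable at x" if "x \<in> S" for x
    using f that smooth_on_has_derivative differentiable_def by blast
  have D: "((\<lambda>x. frechet_derivative f (at x) h) has_derivative frechet_derivative (\<lambda>x. frechet_derivative f (at x) h) (at p)) (at p)" for h
    using smooth_on_has_derivative[OF smooth_on_frechet_derivative[OF f] S(2)] .
  obtain d1 where d1: "d1 > 0" "\<And>s. 0 < s \<and> s < d1 \<Longrightarrow>
     norm (f (p + s *\<^sub>R h + s *\<^sub>R k) - f (p + s *\<^sub>R h) - f (p + s *\<^sub>R k) + f p - (s * s) *\<^sub>R ?A) \<le> e * s\<^sup>2"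
    using second_difference_bound[OF S d D e] by blast
  obtain d2 where d2: "d2 > 0" "\<And>s. 0 < s \<and> s < d2 \<Longrightarrow>
     norm (f (p + s *\<^sub>R k + s *\<^sub>R h) - f (p + s *\<^sub>R k) - f (p + s *\<^sub>R h) + f p - (s * s) *\<^sub>R ?B) \<le> e * s\<^sup>2"
    using second_difference_bound[OF S d D e] by blast
  define s where "s = min d1 d2 / 2"
  have s: "0 < s" "s < d1" "s < d2" using d1(1) d2(1) by (auto simp: s_def)
  let ?X = "f (p + s *\<^sub>R h + s *\<^sub>R k) - f (p + s *\<^sub>R h) - f (p + s *\<^sub>R k) + f p"
  have "norm (?X - (s * s) *\<^sub>R ?A) \<le> e * s\<^sup>2" using d1(2) s by blast
  moreover have "norm (?X - (s * s) *\<^sub>R ?B) \<le> e * s\<^sup>2"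
    using d2(2)[of s] s by (simp add: algebra_simps)
  ultimately have "norm ((s * s) *\<^sub>R ?A - (s * s) *\<^sub>R ?B) \<le> 2 * e * s\<^sup>2"
    using norm_triangle_ineq4[of "?X - (s * s) *\<^sub>R ?B" "?X - (s * s) *\<^sub>R ?A"] by simp
  then have "s\<^sup>2 * (3 * e) \<le> s\<^sup>2 * (2 * e)"
    by (simp add: scaleR_diff_right[symmetric] e_def power2_eq_square algebra_simps
        del: scaleR_right_diff_distrib)
  then show False using s e by (simp add: power2_eq_square)
qed

section \<open>Integration of flat linear connections\<close>

text \<open>The bound 1/2 on the operator makes the Picard map a contraction on all of
  \<open>[0, 1]\<close> at once, so local solutions need not be continued.\<close>

lemma linear_ode_unit_interval:
  fixes A :: "real \<Rightarrow> 'b::banach \<Rightarrow>\<^sub>L 'b"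
  assumes A: "continuous_on {0..1} A" "\<And>t. t \<in> {0..1} \<Longrightarrow> norm (A t) \<le> 1/2"
  shows "\<exists>X. X 0 = x0 \<and> (\<forall>t\<in>{0..1}. (X has_vector_derivative A t (X t)) (at t within {0..1}))"
proof -
  \<comment> \<open>Clamping time to \<open>[0, 1]\<close> lets the Picard map act on bounded
    continuous functions on the whole line, a complete space, without changing it on
    \<open>[0, 1]\<close>.\<close>
  define c :: "real \<Rightarrow> real" where "c = (\<lambda>t. max 0 (min 1 t))"
  have c: "c t \<in> {0..1}" "0 \<le> c t" "c t \<le> 1" for t by (auto simp: c_def)
  define f where "f = (\<lambda>(X :: real \<Rightarrow>\<^sub>C 'b) s. A s (apply_bcontfun X s))"
  define T where "T = (\<lambda>X t. x0 + integral {0..c t} (f X))"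
  have contf: "continuous_on {0..1} (f X)" for X
    unfolding f_def by (intro continuous_intros A continuous_on_apply_bcontfun)
  have contf': "continuous_on {0..c t} (f X)" for X t
    using contf by (rule continuous_on_subset) (use c in auto)
  have bound: "norm (integral {0..c t} g) \<le> B"
    if "continuous_on {0..c t} g" "\<And>s. s \<in> {0..1} \<Longrightarrow> norm (g s) \<le> B" for t B and g :: "real \<Rightarrow> 'b"
  proof -
    have "0 \<le> B" using order_trans[OF norm_ge_zero that(2)[of 0]] by simp
    have "norm (integral {0..c t} g) \<le> B * (c t - 0)"
      by (rule integral_bound) (use that c(2,3)[of t] in auto)
    also have "\<dots> \<le> B" using c(2,3)[of t] \<open>0 \<le> B\<close> by (simp add: mult_left_le)
    finally show ?thesis .
  qed
  have T: "T X \<in> bcontfun" for X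
  proof (rule bcontfun_normI)
    have "continuous_on {0..1} (\<lambda>t. integral {0..t} (f X))"
      by (intro indefinite_integral_continuous_1 integrable_continuous_real contf)
    moreover have "continuous_on UNIV c" unfolding c_def by (intro continuous_intros)
    ultimately have "continuous_on UNIV (\<lambda>t. integral {0..c t} (f X))"
      by (rule continuous_on_compose2) (use c in blast)
    then show "continuous_on UNIV (T X)"
      unfolding T_def by (intro continuous_intros)
    show "norm (T X t) \<le> norm x0 + 1/2 * norm X" for t
    proof -
      have "norm (f X s) \<le> 1/2 * norm X" if "s \<in> {0..1}" for s
        unfolding f_def
        by (rule order_trans[OF norm_blinfun mult_mono[OF A(2)[OF that] norm_bounded]]) auto
      then have "norm (integral {0..c t} (f X)) \<le> 1/2 * norm X"
        by (intro bound contf')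
      then show ?thesis unfolding T_def by (meson add_left_mono norm_triangle_le)
    qed
  qed
  have "\<exists>!X. Bcontfun (T X) = X"
  proof (rule banach_fix_type[where c = "1/2"])
    show "\<forall>X Y. dist (Bcontfun (T X)) (Bcontfun (T Y)) \<le> 1/2 * dist X Y"
    proof (intro allI dist_bound)
      fix X Y t
      have "T X t - T Y t = integral {0..c t} (\<lambda>s. f X s - f Y s)"
        unfolding T_def by (subst Henstock_Kurzweil_Integration.integral_diff)
          (simp_all add: integrable_continuous_real[OF contf'])
      moreover have "norm (integral {0..c t} (\<lambda>s. f X s - f Y s)) \<le> 1/2 * dist X Y"
      proof (rule bound)
        show "norm (f X s - f Y s) \<le> 1/2 * dist X Y" if "s \<in> {0..1}" for s
        proof -
          have "f X s - f Y s = A s (X s - Y s)" by (simp add: f_def blinfun.diff_right)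
          also have "norm \<dots> \<le> norm (A s) * norm (X s - Y s)" by (rule norm_blinfun)
          also have "\<dots> \<le> 1/2 * dist X Y"
            using A(2)[OF that] dist_bounded[of X s Y] by (intro mult_mono) (auto simp: dist_norm)
          finally show ?thesis .
        qed
      qed (intro continuous_intros contf')
      ultimately show "dist (Bcontfun (T X) t) (Bcontfun (T Y) t) \<le> 1/2 * dist X Y"
        by (simp add: Bcontfun_inverse[OF T] dist_norm)
    qed
  qed auto
  then obtain X where "Bcontfun (T X) = X" by blast
  then have X: "apply_bcontfun X = T X" using Bcontfun_inverse[OF T] by metis
  have eq: "T X t = x0 + integral {0..t} (f X)" if "t \<in> {0..1}" for t
  proof -
    have "c t = t" using that by (auto simp: c_def)
    then show ?thesis by (simp add: T_def)
  qed
  have "(T X has_vector_derivative A t (T X t)) (at t within {0..1})" if "t \<in> {0..1}" for t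
  proof (rule has_vector_derivative_transform[OF that eq])
    have "f X t = A t (T X t)" by (simp add: f_def X)
    with integral_has_vector_derivative[OF contf that]
    show "((\<lambda>t. x0 + integral {0..t} (f X)) has_vector_derivative A t (T X t)) (at t within {0..1})"
      by (auto intro!: derivative_eq_intros)
  qed
  moreover have "T X 0 = x0" by (simp add: eq)
  ultimately show ?thesis by blast
qed

text \<open>A substitute for Gronwall's inequality: at the point where \<open>norm (X t)\<close> is
  largest, the mean value inequality bounds this maximum by half of itself plus
  \<open>norm (X 0) + r\<close>, and the half is absorbed.\<close>

lemma small_linear_growth:
  fixes X :: "real \<Rightarrow> 'b::real_normed_vector"
  assumes d: "\<And>t. t \<in> {0..1} \<Longrightarrow> (X has_vector_derivative X' t) (at t within {0..1})"
    and b: "\<And>t. t \<in> {0..1} \<Longrightarrow> norm (X' t) \<le> 1/2 * norm (X t) + r"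
    and t: "t \<in> {0..1}"
  shows "norm (X t) \<le> 2 * (norm (X 0) + r)"
proof -
  have "continuous_on {0..1} X"
    using d by (meson continuous_on_eq_continuous_within has_vector_derivative_continuous)
  then obtain m where m: "m \<in> {0..1}" "\<And>s. s \<in> {0..1} \<Longrightarrow> norm (X s) \<le> norm (X m)"
    using continuous_attains_sup[of "{0..1}" "\<lambda>s. norm (X s)"] by (force intro: continuous_intros)
  have "norm (X m - X 0) \<le> (1/2 * norm (X m) + r) * norm (m - 0)"
  proof (rule differentiable_bound[of "{0..1}"])
    show "(X has_derivative (\<lambda>h. h *\<^sub>R X' s)) (at s within {0..1})" if "s \<in> {0..1}" for s
      using d[OF that] by (simp add: has_vector_derivative_def)
    show "onorm (\<lambda>h::real. h *\<^sub>R X' s) \<le> 1/2 * norm (X m) + r" if "s \<in> {0..1}" for s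
      using b[OF that] m(2)[OF that] by (simp add: onorm_scaleR_left onorm_id)
  qed (use m in auto)
  also have "\<dots> \<le> 1/2 * norm (X m) + r"
    using m(1) order_trans[OF norm_ge_zero b[OF m(1)]] by (intro mult_left_le) auto
  finally have "norm (X m) \<le> norm (X 0) + (1/2 * norm (X m) + r)"
    using norm_triangle_sub[of "X m" "X 0"] by linarith
  then show ?thesis using m(2)[OF t] unfolding distrib_left by linarith
qed

section \<open>Uniform Lipschitz and Taylor estimates on compact convex sets\<close>

lemma smooth_on_Lipschitz:
  fixes f :: "'a::euclidean_space \<Rightarrow> 'b::real_normed_vector"
  assumes f: "smooth_on U f" and S: "compact S" "convex S" "S \<subseteq> U"
  obtains L where "L \<ge> 0" "\<And>x y. x \<in> S \<Longrightarrow> y \<in> S \<Longrightarrow> norm (f y - f x) \<le> L * norm (y - x)"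
proof -
  let ?D = "\<lambda>x. frechet_derivative f (at x)"
  have "bounded ((\<lambda>x. ?D x b) ` S)" for b
    using S smooth_on_imp_continuous_on[OF smooth_on_frechet_derivative[OF f, of b]]
    by (intro compact_imp_bounded compact_continuous_image) (auto intro: continuous_on_subset)
  then have "\<exists>B. \<forall>x\<in>S. norm (?D x b) \<le> B" for b unfolding bounded_iff by blast
  then obtain B where B: "\<And>b x. x \<in> S \<Longrightarrow> norm (?D x b) \<le> B b" by metis
  \<comment> \<open>Smoothness gives continuity of the derivative one direction at a time; summing
    the bounds over \<open>Basis\<close> turns this into a bound on its operator norm.\<close>
  define L where "L = (\<Sum>b\<in>Basis. \<bar>B b\<bar>)"
  have D: "(f has_derivative ?D x) (at x)" if "x \<in> S" for x
    using smooth_on_has_derivative[OF f] that S by auto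
  have "onorm (?D x) \<le> L" if "x \<in> S" for x
  proof (rule onorm_le)
    fix h
    have "norm (?D x h) \<le> (\<Sum>b\<in>Basis. norm ((h \<bullet> b) *\<^sub>R ?D x b))"
      using has_derivative_expand[OF D[OF that], of h] norm_sum by metis
    also have "\<dots> \<le> (\<Sum>b\<in>Basis. \<bar>B b\<bar> * norm h)"
    proof (rule sum_mono)
      fix b :: 'a assume "b \<in> Basis"
      then have "\<bar>h \<bullet> b\<bar> * norm (?D x b) \<le> norm h * \<bar>B b\<bar>"
        using B[OF that, of b] by (intro mult_mono Basis_le_norm) auto
      then show "norm ((h \<bullet> b) *\<^sub>R ?D x b) \<le> \<bar>B b\<bar> * norm h" by (simp add: mult.commute)
    qed
    finally show "norm (?D x h) \<le> L * norm h" by (simp add: L_def sum_distrib_right)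
  qed
  moreover have "L \<ge> 0" by (simp add: L_def sum_nonneg)
  ultimately show thesis
    using has_derivative_at_withinI[OF D] by (intro that[OF _ differentiable_bound[OF S(2), of f ?D]]) auto
qed

text \<open>The mean value inequality is applied on the segment to \<open>f\<close> minus its linear
  part at \<open>x\<close>. There the derivative is \<open>?D z - ?D x\<close>, which is Lipschitz
  because its components in the basis directions are.\<close>

lemma smooth_on_Taylor:
  fixes f :: "'a::euclidean_space \<Rightarrow> 'b::real_normed_vector"
  assumes f: "smooth_on U f" and S: "compact S" "convex S" "S \<subseteq> U"
  obtains L where "L \<ge> 0"
    "\<And>x y. x \<in> S \<Longrightarrow> y \<in> S \<Longrightarrow> norm (f y - f x - frechet_derivative f (at x) (y - x)) \<le> L * (norm (y - x))\<^sup>2"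
proof -
  let ?D = "\<lambda>x. frechet_derivative f (at x)"
  have "\<exists>L\<ge>0. \<forall>x\<in>S. \<forall>y\<in>S. norm (?D y b - ?D x b) \<le> L * norm (y - x)" for b
    using smooth_on_Lipschitz[OF smooth_on_frechet_derivative[OF f, of b] S] by metis
  then obtain B where B: "\<And>b. B b \<ge> 0"
    "\<And>b x y. x \<in> S \<Longrightarrow> y \<in> S \<Longrightarrow> norm (?D y b - ?D x b) \<le> B b * norm (y - x)" by metis
  define L where "L = (\<Sum>b\<in>Basis. B b)"
  have D: "(f has_derivative ?D x) (at x)" if "x \<in> S" for x
    using smooth_on_has_derivative[OF f] that S by auto
  have DL: "norm (?D y h - ?D x h) \<le> L * norm (y - x) * norm h" if "x \<in> S" "y \<in> S" for x y h
  proof -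
    have "?D y h - ?D x h = (\<Sum>b\<in>Basis. (h \<bullet> b) *\<^sub>R (?D y b - ?D x b))"
      using has_derivative_expand[OF D[OF that(1)], of h] has_derivative_expand[OF D[OF that(2)], of h]
      by (simp add: sum_subtractf scaleR_diff_right)
    also have "norm \<dots> \<le> (\<Sum>b\<in>Basis. norm ((h \<bullet> b) *\<^sub>R (?D y b - ?D x b)))" by (rule norm_sum)
    also have "\<dots> \<le> (\<Sum>b\<in>Basis. B b * norm (y - x) * norm h)"
    proof (rule sum_mono)
      fix b :: 'a assume "b \<in> Basis"
      then have "\<bar>h \<bullet> b\<bar> * norm (?D y b - ?D x b) \<le> norm h * (B b * norm (y - x))"
        using B that by (intro mult_mono Basis_le_norm) auto
      then show "norm ((h \<bullet> b) *\<^sub>R (?D y b - ?D x b)) \<le> B b * norm (y - x) * norm h"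
        by (simp add: mult_ac)
    qed
    finally show ?thesis by (simp add: L_def sum_distrib_right)
  qed
  have "L \<ge> 0" by (simp add: L_def sum_nonneg B)
  moreover have "norm (f y - f x - ?D x (y - x)) \<le> L * (norm (y - x))\<^sup>2" if "x \<in> S" "y \<in> S" for x y
  proof -
    interpret bounded_linear "?D x" using D[OF that(1)] by (rule has_derivative_bounded_linear)
    let ?g = "\<lambda>z. f z - ?D x z"
    have sub: "closed_segment x y \<subseteq> S" using that S by (simp add: closed_segment_subset)
    have "norm (?g y - ?g x) \<le> (L * norm (y - x) * norm (y - x))"
    proof (rule order_trans[OF differentiable_bound[of "closed_segment x y" ?g "\<lambda>z h. ?D z h - ?D x h" "L * norm (y - x)" y x]])
      show "(?g has_derivative (\<lambda>h. ?D z h - ?D x h)) (at z within closed_segment x y)"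
        if "z \<in> closed_segment x y" for z
        using D[of z] sub that
        by (intro has_derivative_diff has_derivative_at_withinI[OF D] bounded_linear_imp_has_derivative bounded_linear_axioms) auto
      show "onorm (\<lambda>h. ?D z h - ?D x h) \<le> L * norm (y - x)" if "z \<in> closed_segment x y" for z
      proof (rule onorm_le)
        fix h
        have "norm (?D z h - ?D x h) \<le> L * norm (z - x) * norm h"
          using DL \<open>x \<in> S\<close> sub that by blast
        also have "\<dots> \<le> L * norm (y - x) * norm h"
          using segment_bound(1)[OF that] \<open>L \<ge> 0\<close> by (intro mult_right_mono mult_left_mono) auto
        finally show "norm (?D z h - ?D x h) \<le> L * norm (y - x) * norm h" .
      qed
    qed auto
    then show ?thesis by (simp add: diff power2_eq_square algebra_simps)
  qed
  ultimately show thesis using that by blast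
qed

lemma has_derivative_quadratic_remainder:
  fixes f :: "'a::real_normed_vector \<Rightarrow> 'b::real_normed_vector"
  assumes "bounded_linear f'" "d > 0"
    and b: "\<And>k. norm k < d \<Longrightarrow> norm (f (x + k) - f x - f' k) \<le> C * (norm k)\<^sup>2"
  shows "(f has_derivative f') (at x)"
  unfolding has_derivative_at_alt
proof (intro conjI allI impI assms(1))
  fix e :: real assume "e > 0"
  define r where "r = min d (e / (\<bar>C\<bar> + 1))"
  have "r > 0" using \<open>e > 0\<close> \<open>d > 0\<close> by (simp add: r_def)
  moreover have "norm (f y - f x - f' (y - x)) \<le> e * norm (y - x)" if "norm (y - x) < r" for y
  proof -
    have "norm (f y - f x - f' (y - x)) \<le> C * (norm (y - x))\<^sup>2"
      using b[of "y - x"] that by (simp add: r_def)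
    also have "\<dots> \<le> (\<bar>C\<bar> + 1) * (norm (y - x))\<^sup>2" by (intro mult_right_mono) auto
    also have "\<dots> = ((\<bar>C\<bar> + 1) * norm (y - x)) * norm (y - x)" by (simp add: power2_eq_square)
    also have "\<dots> \<le> e * norm (y - x)"
      using that by (intro mult_right_mono) (auto simp: r_def field_simps)
    finally show ?thesis .
  qed
  ultimately show "\<exists>d>0. \<forall>y. norm (y - x) < d \<longrightarrow> norm (f y - f x - f' (y - x)) \<le> e * norm (y - x)"
    by blast
qed

text \<open>\<open>X\<close> is obtained by solving a linear ordinary differential equation along each ray from \<open>p\<close>. On
  the rays in directions \<open>h\<close> and \<open>h + k\<close>, flatness makes
  \<open>X (p + t (h + k)) - X (p + t h) - t W k (X (p + t h))\<close> satisfy the same equation up to an error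
  \<open>O(|k|\<^sup>2)\<close>, so no differentiable dependence on parameters is needed.\<close>

theorem linear_frobenius:
  fixes W :: "'a::euclidean_space \<Rightarrow> 'a \<Rightarrow>\<^sub>L 'b::banach \<Rightarrow>\<^sub>L 'b"
  assumes U: "open U" "p \<in> U" and W: "smooth_on U W"
    and flat: "\<And>q h k x. q \<in> U \<Longrightarrow>
      frechet_derivative W (at q) h k x + W q k (W q h x) = frechet_derivative W (at q) k h x + W q h (W q k x)"
  obtains r where "r > 0" "ball p r \<subseteq> U"
    "\<And>x0. \<exists>X. X p = x0 \<and> (\<forall>q\<in>ball p r. (X has_derivative (\<lambda>h. W q h (X q))) (at q))"
proof -
  let ?D = "\<lambda>q. frechet_derivative W (at q)"
  obtain r0 where r0: "r0 > 0" "cball p r0 \<subseteq> U" using U open_contains_cball by blast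
  let ?S = "cball p r0"
  have "bounded (W ` ?S)"
    using r0 smooth_on_imp_continuous_on[OF W]
    by (intro compact_imp_bounded compact_continuous_image) (auto intro: continuous_on_subset)
  then obtain K where K: "K > 0" "\<And>q. q \<in> ?S \<Longrightarrow> norm (W q) \<le> K" unfolding bounded_pos by blast
  obtain L where L: "L \<ge> 0" "\<And>x y. x \<in> ?S \<Longrightarrow> y \<in> ?S \<Longrightarrow> norm (W y - W x) \<le> L * norm (y - x)"
    using smooth_on_Lipschitz[OF W compact_cball convex_cball r0(2)] by metis
  obtain M where M: "M \<ge> 0"
    "\<And>x y. x \<in> ?S \<Longrightarrow> y \<in> ?S \<Longrightarrow> norm (W y - W x - ?D x (y - x)) \<le> M * (norm (y - x))\<^sup>2"
    using smooth_on_Taylor[OF W compact_cball convex_cball r0(2)] by metis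
  \<comment> \<open>\<open>K * r \<le> 1/2\<close> brings the equation on every ray of length below
    \<open>r\<close> within reach of \<open>linear_ode_unit_interval\<close>. The radius is fixed
    before \<open>x0\<close>, so all solutions share one ball.\<close>
  define r where "r = min r0 (1 / (2 * K))"
  have r: "r > 0" "r \<le> r0" "K * r \<le> 1/2" using r0 K(1) by (auto simp: r_def min_def field_simps)
  have seg: "p + t *\<^sub>R h \<in> ?S" if "norm h < r" "t \<in> {0..1}" for t h
  proof -
    have "t * norm h \<le> 1 * norm h" using that by (intro mult_right_mono) auto
    then show ?thesis using that r by (simp add: dist_norm)
  qed
  define A where "A = (\<lambda>h t. W (p + t *\<^sub>R h) h)"
  have A: "norm (A h t) \<le> 1/2" if "norm h < r" "t \<in> {0..1}" for h t
  proof -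
    have "norm (A h t) \<le> norm (W (p + t *\<^sub>R h)) * norm h" unfolding A_def by (rule norm_blinfun)
    also have "\<dots> \<le> K * r" using K seg[OF that] that by (intro mult_mono) auto
    finally show ?thesis using r by linarith
  qed
  have contA: "continuous_on {0..1} (A h)" if "norm h < r" for h
    unfolding A_def using seg[OF that] r0
    by (intro continuous_intros continuous_on_compose2[OF smooth_on_imp_continuous_on[OF W]]) auto
  show thesis
  proof (rule that[of r])
    show "ball p r \<subseteq> U" using r r0 by (auto simp: subset_iff)
    fix x0 :: 'b
    have "\<forall>h. norm h < r \<longrightarrow> (\<exists>X. X 0 = x0 \<and> (\<forall>t\<in>{0..1}. (X has_vector_derivative A h t (X t)) (at t within {0..1})))"
      using linear_ode_unit_interval[OF contA A] by blast
    then obtain Y where Y0: "\<And>h. norm h < r \<Longrightarrow> Y h 0 = x0"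
      and Y: "\<And>h t. norm h < r \<Longrightarrow> t \<in> {0..1} \<Longrightarrow> (Y h has_vector_derivative A h t (Y h t)) (at t within {0..1})"
      by metis
    have Yb: "norm (Y h t) \<le> 2 * norm x0" if "norm h < r" "t \<in> {0..1}" for h t
    proof -
      have "norm (A h t (Y h t)) \<le> 1/2 * norm (Y h t) + 0" if "t \<in> {0..1}" for t
        using mult_right_mono[OF A[OF \<open>norm h < r\<close> that] norm_ge_zero, of "Y h t"]
          norm_blinfun[of "A h t" "Y h t"] by linarith
      from small_linear_growth[OF Y[OF that(1)] this that(2)] show ?thesis
        using Y0[OF that(1)] by simp
    qed
    define X where "X = (\<lambda>q. Y (q - p) 1)"
    \<comment> \<open>The two summands bound the two error terms of \<open>Z'eq\<close> as multiples
      of \<open>(norm k)\<^sup>2\<close>, with \<open>2 * norm x0\<close> as the bound for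
      \<open>Y h\<close>.\<close>
    define C where "C = (M * r + L) * (2 * norm x0) + (L * r + K) * (K * (2 * norm x0))"
    have main: "norm (Y (h + k) 1 - Y h 1 - W (p + h) k (Y h 1)) \<le> 2 * C * (norm k)\<^sup>2"
      if h: "norm h < r" and hk: "norm (h + k) < r" for h k
    proof -
      define Z where "Z = (\<lambda>t. Y (h + k) t - Y h t - t *\<^sub>R W (p + t *\<^sub>R h) k (Y h t))"
      define Z' where "Z' = (\<lambda>t. A (h + k) t (Y (h + k) t) - A h t (Y h t)
          - (W (p + t *\<^sub>R h) k (Y h t) + t *\<^sub>R (W (p + t *\<^sub>R h) k (A h t (Y h t)) + ?D (p + t *\<^sub>R h) h k (Y h t))))"
      have "(Z has_vector_derivative Z' t) (at t within {0..1})" if t: "t \<in> {0..1}" for t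
      proof -
        have DW: "(W has_derivative ?D (p + t *\<^sub>R h)) (at (p + t *\<^sub>R h))"
          using smooth_on_has_derivative[OF W] seg[OF h t] r0 by blast
        have "((\<lambda>t. p + t *\<^sub>R h) has_derivative (\<lambda>s. s *\<^sub>R h)) (at t within {0..1})"
          by (auto intro!: derivative_eq_intros)
        from has_derivative_compose[OF this DW]
        have "((\<lambda>t. W (p + t *\<^sub>R h)) has_vector_derivative ?D (p + t *\<^sub>R h) h) (at t within {0..1})"
          using linear_cmul[OF has_derivative_linear[OF DW]] by (simp add: has_vector_derivative_def)
        then have "((\<lambda>t. W (p + t *\<^sub>R h) k) has_vector_derivative ?D (p + t *\<^sub>R h) h k) (at t within {0..1})"
          by (rule bounded_linear.has_vector_derivative[OF blinfun.bounded_linear_left])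
        from bounded_bilinear.has_vector_derivative[OF bounded_bilinear_blinfun_apply this Y[OF h t]]
        have 1: "((\<lambda>t. W (p + t *\<^sub>R h) k (Y h t)) has_vector_derivative
            W (p + t *\<^sub>R h) k (A h t (Y h t)) + ?D (p + t *\<^sub>R h) h k (Y h t)) (at t within {0..1})" .
        show ?thesis unfolding Z_def Z'_def
          using bounded_bilinear.has_vector_derivative[OF bounded_bilinear_scaleR has_vector_derivative_id 1]
          by (intro has_vector_derivative_diff Y h hk t) (simp add: add.commute)
      qed
      moreover have "norm (Z' t) \<le> 1/2 * norm (Z t) + C * (norm k)\<^sup>2" if t: "t \<in> {0..1}" for t
      proof -
        define q where "q = p + t *\<^sub>R h"
        define q' where "q' = p + t *\<^sub>R (h + k)"
        define y where "y = Y h t"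
        have qS: "q \<in> ?S" "q' \<in> ?S" using seg[OF h t] seg[OF hk t] by (auto simp: q_def q'_def)
        have qU: "q \<in> U" using qS r0 by blast
        have qq: "q' - q = t *\<^sub>R k" by (simp add: q_def q'_def algebra_simps)
        have tk: "norm (t *\<^sub>R k) \<le> norm k" using t by (simp add: mult_left_le_one_le)
        have lin: "?D q (t *\<^sub>R k) = t *\<^sub>R ?D q k"
          using linear_cmul[OF has_derivative_linear[OF smooth_on_has_derivative[OF W qU]]] .
        \<comment> \<open>Flatness exchanges \<open>h\<close> and \<open>k\<close> in the derivative
          of \<open>W\<close>, after which all terms linear in \<open>k\<close> combine into
          \<open>A (h + k) t (Z t)\<close>. What remains is quadratic in \<open>k\<close>: a Taylor
          remainder of \<open>W\<close>, or a product of two factors each of order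
          \<open>norm k\<close>.\<close>
        have Z'eq: "Z' t = A (h + k) t (Z t)
            + ((W q' - W q - ?D q (t *\<^sub>R k)) h + (W q' - W q) k) y
            + t *\<^sub>R ((W q' - W q) h + W q' k) (W q k y)"
        proof -
          have A': "A (h + k) t = W q' (h + k)" "A h t = W q h" by (simp_all add: A_def q_def q'_def)
          have "?D q h k y = ?D q k h y + W q h (W q k y) - W q k (W q h y)"
            using flat[OF qU, of h k y] by (simp add: eq_diff_eq)
          then show ?thesis
            unfolding Z'_def Z_def A' q_def[symmetric] y_def[symmetric]
            by (simp add: blinfun.bilinear_simps lin algebra_simps)
        qed
        have ny: "norm y \<le> 2 * norm x0" using Yb[OF h t] by (simp add: y_def)
        have n1: "norm (W q' - W q) \<le> L * norm k"
          using L(2)[OF qS] L(1) tk qq by (metis mult_left_mono order_trans)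
        have "norm (W q' - W q - ?D q (t *\<^sub>R k)) \<le> M * (norm (t *\<^sub>R k))\<^sup>2"
          using M(2)[OF qS] qq by simp
        also have "\<dots> \<le> M * (norm k)\<^sup>2" using M(1) tk by (intro mult_left_mono power_mono) auto
        finally have n2: "norm (W q' - W q - ?D q (t *\<^sub>R k)) \<le> M * (norm k)\<^sup>2" .
        have n3: "norm ((W q' - W q - ?D q (t *\<^sub>R k)) h) \<le> M * (norm k)\<^sup>2 * r"
          by (rule order_trans[OF norm_blinfun]) (use n2 h M(1) in \<open>intro mult_mono, auto\<close>)
        have n4: "norm ((W q' - W q) k) \<le> L * norm k * norm k"
          by (rule order_trans[OF norm_blinfun]) (use n1 in \<open>intro mult_right_mono, auto\<close>)
        have n5: "norm (((W q' - W q - ?D q (t *\<^sub>R k)) h + (W q' - W q) k) y) \<le> ((M * r + L) * (2 * norm x0)) * (norm k)\<^sup>2"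
        proof -
          have "norm ((W q' - W q - ?D q (t *\<^sub>R k)) h + (W q' - W q) k) \<le> (M * r + L) * (norm k)\<^sup>2"
            by (rule order_trans[OF norm_triangle_ineq]) (use n3 n4 in \<open>simp add: algebra_simps power2_eq_square\<close>)
          then have "norm (((W q' - W q - ?D q (t *\<^sub>R k)) h + (W q' - W q) k) y) \<le> ((M * r + L) * (norm k)\<^sup>2) * (2 * norm x0)"
            by (intro order_trans[OF norm_blinfun] mult_mono) (use ny M L r in auto)
          then show ?thesis by (simp only: mult_ac)
        qed
        have n6: "norm (W q k y) \<le> K * norm k * (2 * norm x0)"
        proof -
          have "norm (W q k) \<le> K * norm k"
            by (intro order_trans[OF norm_blinfun] mult_right_mono K qS) auto
          then show ?thesis
            by (rule order_trans[OF norm_blinfun mult_mono[OF _ ny]]) (use K in auto)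
        qed
        have n7: "norm ((W q' - W q) h + W q' k) \<le> (L * r + K) * norm k"
        proof -
          have "norm ((W q' - W q) h) \<le> (L * norm k) * r"
            by (rule order_trans[OF norm_blinfun]) (use n1 h L(1) in \<open>intro mult_mono, auto\<close>)
          moreover have "norm (W q' k) \<le> K * norm k"
            by (intro order_trans[OF norm_blinfun] mult_right_mono K qS) auto
          ultimately show ?thesis
            using norm_triangle_ineq[of "(W q' - W q) h" "W q' k"] by (simp add: algebra_simps)
        qed
        have "norm (((W q' - W q) h + W q' k) (W q k y)) \<le> ((L * r + K) * norm k) * (K * norm k * (2 * norm x0))"
          by (rule order_trans[OF norm_blinfun mult_mono[OF n7 n6]]) (use L K r in auto)
        then have n8: "norm (t *\<^sub>R ((W q' - W q) h + W q' k) (W q k y)) \<le> ((L * r + K) * (K * (2 * norm x0))) * (norm k)\<^sup>2"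
          using t mult_left_le_one_le[of "norm (((W q' - W q) h + W q' k) (W q k y))" t]
          by (simp add: power2_eq_square mult_ac)
        have n9: "norm (A (h + k) t (Z t)) \<le> 1/2 * norm (Z t)"
          using A[OF hk t] by (intro order_trans[OF norm_blinfun] mult_right_mono) auto
        have "norm (Z' t) \<le> 1/2 * norm (Z t) + ((M * r + L) * (2 * norm x0)) * (norm k)\<^sup>2
            + ((L * r + K) * (K * (2 * norm x0))) * (norm k)\<^sup>2"
          unfolding Z'eq by (intro norm_triangle_le add_mono n5 n8 n9)
        then show ?thesis unfolding C_def by (simp add: distrib_right)
      qed
      ultimately have "norm (Z 1) \<le> 2 * (norm (Z 0) + C * (norm k)\<^sup>2)"
        by (rule small_linear_growth) auto
      moreover have "Z 0 = 0" using Y0[OF h] Y0[OF hk] by (simp add: Z_def)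
      ultimately show ?thesis by (simp add: Z_def)
    qed
    show "\<exists>X. X p = x0 \<and> (\<forall>q\<in>ball p r. (X has_derivative (\<lambda>h. W q h (X q))) (at q))"
    proof (intro exI conjI ballI)
      have "norm (Y 0 t - x0) = 0" if "t \<in> {0..1}" for t
      proof -
        have "norm (Y 0 t - Y 0 0) \<le> 0 * norm (t - 0)"
        proof (rule differentiable_bound[of "{0..1}"])
          show "(Y 0 has_derivative (\<lambda>h. 0)) (at s within {0..1})" if "s \<in> {0..1}" for s
            using Y[of 0 s] that r by (simp add: A_def has_vector_derivative_def blinfun.bilinear_simps)
        qed (use that in \<open>auto simp: onorm_zero\<close>)
        then show ?thesis using Y0[of 0] r by simp
      qed
      from this[of 1] show "X p = x0" by (simp add: X_def)
      fix q assume q: "q \<in> ball p r"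
      show "(X has_derivative (\<lambda>h. W q h (X q))) (at q)"
      proof (rule has_derivative_quadratic_remainder[where d = "r - norm (q - p)" and C = "2 * C"])
        have nq: "norm (q - p) < r" using q by (simp add: dist_norm norm_minus_commute)
        then show "r - norm (q - p) > 0" by simp
        show "bounded_linear (\<lambda>h. W q h (X q))"
          by (intro bounded_linear_compose[OF blinfun.bounded_linear_left] blinfun.bounded_linear_right)
        fix k :: 'a assume k: "norm k < r - norm (q - p)"
        have "norm (q - p + k) < r" using norm_triangle_ineq[of "q - p" k] k by linarith
        from main[OF nq this] show "norm (X (q + k) - X q - W q k (X q)) \<le> 2 * C * (norm k)\<^sup>2"
          by (simp add: X_def algebra_simps)
      qed
    qed
  qed (rule r)
qed

section \<open>Point transformations and geodesics\<close>

lemma smooth_on_real_deriv: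
  fixes v :: "real \<Rightarrow> real"
  assumes "open J" "smooth_on J v"
  shows "s \<in> J \<Longrightarrow> (v has_real_derivative deriv v s) (at s)" "smooth_on J (deriv v)"
proof -
  have *: "(v has_real_derivative frechet_derivative v (at s) 1) (at s)" if "s \<in> J" for s
  proof -
    have d: "(v has_derivative frechet_derivative v (at s)) (at s)"
      using smooth_on_has_derivative assms(2) that by blast
    have "frechet_derivative v (at s) = (*) (frechet_derivative v (at s) 1)"
    proof
      show "frechet_derivative v (at s) h = frechet_derivative v (at s) 1 * h" for h
        using linear_cmul[OF has_derivative_linear[OF d], of h 1] by simp
    qed
    then show ?thesis unfolding has_field_derivative_def using d by argo
  qed
  then have eq: "frechet_derivative v (at s) 1 = deriv v s" if "s \<in> J" for s
    using that DERIV_imp_deriv by metis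
  with * show "s \<in> J \<Longrightarrow> (v has_real_derivative deriv v s) (at s)" by metis
  show "smooth_on J (deriv v)"
    using smooth_on_cong[OF smooth_on_frechet_derivative[OF assms(2)] assms(1) eq] .
qed

lemma second_derivative_expand:
  fixes g :: "'a::euclidean_space \<Rightarrow> 'b::real_normed_vector"
  assumes "open S" "p \<in> S" "smooth_on S g"
  shows "frechet_derivative (\<lambda>q. frechet_derivative g (at q) k) (at p) h
    = (\<Sum>b\<in>Basis. (k \<bullet> b) *\<^sub>R frechet_derivative (\<lambda>q. frechet_derivative g (at q) b) (at p) h)"
proof -
  have "((\<lambda>q. \<Sum>b\<in>Basis. (k \<bullet> b) *\<^sub>R frechet_derivative g (at q) b) has_derivative
    (\<lambda>h. \<Sum>b\<in>Basis. (k \<bullet> b) *\<^sub>R frechet_derivative (\<lambda>q. frechet_derivative g (at q) b) (at p) h)) (at p)"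
    using smooth_on_has_derivative[OF smooth_on_frechet_derivative[OF assms(3)] assms(2)]
    by (intro has_derivative_sum has_derivative_scaleR_right)
  then have "((\<lambda>q. frechet_derivative g (at q) k) has_derivative
    (\<lambda>h. \<Sum>b\<in>Basis. (k \<bullet> b) *\<^sub>R frechet_derivative (\<lambda>q. frechet_derivative g (at q) b) (at p) h)) (at p)"
    by (rule has_derivative_transform_within_open[OF _ assms(1,2)])
      (rule has_derivative_expand[OF smooth_on_has_derivative[OF assms(3)], symmetric])
  from fun_cong[OF frechet_derivative_at[OF this], of h] show ?thesis by simp
qed

lemma derivative_along_curve:
  fixes g :: "'a::euclidean_space \<Rightarrow> 'b::real_normed_vector"
  assumes S: "open S" and g: "smooth_on S g" and I: "open I" "t \<in> I" and c: "\<And>s. s \<in> I \<Longrightarrow> c s \<in> S"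
    and c1: "(c has_vector_derivative c' t) (at t)"
  shows "((\<lambda>s. g (c s)) has_vector_derivative frechet_derivative g (at (c t)) (c' t)) (at t)"
    and "(c' has_vector_derivative c'') (at t) \<Longrightarrow>
      ((\<lambda>s. frechet_derivative g (at (c s)) (c' s)) has_vector_derivative
        frechet_derivative (\<lambda>q. frechet_derivative g (at q) (c' t)) (at (c t)) (c' t)
          + frechet_derivative g (at (c t)) c'') (at t)"
proof -
  have chain: "((\<lambda>s. f (c s)) has_vector_derivative frechet_derivative f (at (c t)) (c' t)) (at t)"
    if "smooth_on S f" for f :: "'a \<Rightarrow> 'b"
  proof -
    have d: "(f has_derivative frechet_derivative f (at (c t))) (at (c t))"
      using smooth_on_has_derivative[OF that] c I by blast
    from has_derivative_compose[OF c1[unfolded has_vector_derivative_def] d] show ?thesis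
      using linear_cmul[OF has_derivative_linear[OF d]] by (simp add: has_vector_derivative_def)
  qed
  from chain[OF g] show "((\<lambda>s. g (c s)) has_vector_derivative frechet_derivative g (at (c t)) (c' t)) (at t)" .
  let ?D = "\<lambda>b q. frechet_derivative g (at q) b"
  assume c2: "(c' has_vector_derivative c'') (at t)"
  have "((\<lambda>s. \<Sum>b\<in>Basis. (c' s \<bullet> b) *\<^sub>R ?D b (c s)) has_vector_derivative
      (\<Sum>b\<in>Basis. (c' t \<bullet> b) *\<^sub>R frechet_derivative (?D b) (at (c t)) (c' t) + (c'' \<bullet> b) *\<^sub>R ?D b (c t))) (at t)"
    by (intro has_vector_derivative_sum bounded_bilinear.has_vector_derivative[OF bounded_bilinear_scaleR]
        chain smooth_on_frechet_derivative g bounded_linear.has_vector_derivative[OF bounded_linear_inner_left c2])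
  moreover have "(\<Sum>b\<in>Basis. (c' t \<bullet> b) *\<^sub>R frechet_derivative (?D b) (at (c t)) (c' t) + (c'' \<bullet> b) *\<^sub>R ?D b (c t))
      = frechet_derivative (?D (c' t)) (at (c t)) (c' t) + ?D c'' (c t)"
    using second_derivative_expand[OF S c[OF I(2)] g, of "c' t" "c' t"]
      has_derivative_expand[OF smooth_on_has_derivative[OF g c[OF I(2)]], of c'']
    by (simp add: sum.distrib)
  ultimately have "((\<lambda>s. \<Sum>b\<in>Basis. (c' s \<bullet> b) *\<^sub>R ?D b (c s)) has_vector_derivative
        frechet_derivative (?D (c' t)) (at (c t)) (c' t) + ?D c'' (c t)) (at t)" by metis
  then show "((\<lambda>s. ?D (c' s) (c s)) has_vector_derivative
        frechet_derivative (?D (c' t)) (at (c t)) (c' t) + ?D c'' (c t)) (at t)"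
    by (rule has_vector_derivative_transform_within_open[OF _ I])
      (rule has_derivative_expand[OF smooth_on_has_derivative[OF g c], symmetric])
qed

lemma has_vector_derivative_Pair3:
  assumes "(x has_real_derivative x') (at t)" "(y has_real_derivative y') (at t)" "(z has_real_derivative z') (at t)"
  shows "((\<lambda>t. (x t, y t, z t)) has_vector_derivative (x', y', z')) (at t)"
  using assms unfolding has_real_derivative_iff_has_vector_derivative has_vector_derivative_def scaleR_Pair
  by (intro has_derivative_Pair)

text \<open>The chain rule for a point running along a graph with parameter \<open>u\<close>. The
  acceleration is tangent up to the squared speed of \<open>u\<close> times
  \<open>(0, v'', w'')\<close>; so where that speed is non-zero, the graph has vanishing second
  derivatives exactly when the acceleration is tangent.\<close>

lemma graph_second_order:
  fixes P :: "real \<Rightarrow> point"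
  assumes I: "open I" "t \<in> I"
    and J: "open J" "smooth_on J v" "smooth_on J w"
    and P: "\<And>s. s \<in> I \<Longrightarrow> u s \<in> J \<and> P s = (u s, v (u s), w (u s))"
    and P': "\<And>s. s \<in> I \<Longrightarrow> (P has_vector_derivative P' s) (at s)"
    and P'': "(P' has_vector_derivative P'') (at t)"
  shows "P' t = fst (P' t) *\<^sub>R (1, deriv v (u t), deriv w (u t))"
    and "P'' = fst P'' *\<^sub>R (1, deriv v (u t), deriv w (u t))
           + (fst (P' t))\<^sup>2 *\<^sub>R (0, deriv (deriv v) (u t), deriv (deriv w) (u t))"
proof -
  note v = smooth_on_real_deriv[OF J(1,2)] and w = smooth_on_real_deriv[OF J(1,3)]
  have u': "(u has_real_derivative fst (P' s)) (at s)" if "s \<in> I" for s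
  proof -
    have "((\<lambda>s. fst (P s)) has_vector_derivative fst (P' s)) (at s)"
      using bounded_linear.has_vector_derivative[OF bounded_linear_fst P'[OF that]] .
    then show ?thesis
      unfolding has_real_derivative_iff_has_vector_derivative
      by (rule has_vector_derivative_transform_within_open[OF _ I(1) that]) (use P in auto)
  qed
  have *: "P' s = fst (P' s) *\<^sub>R (1, deriv v (u s), deriv w (u s))" if "s \<in> I" for s
  proof -
    have "((\<lambda>s. (u s, v (u s), w (u s))) has_vector_derivative
       (fst (P' s), deriv v (u s) * fst (P' s), deriv w (u s) * fst (P' s))) (at s)"
      using P[OF that] v(1) w(1) u'[OF that] by (intro has_vector_derivative_Pair3 DERIV_chain2[OF _ u'[OF that]]) auto
    then have "(P has_vector_derivative
       (fst (P' s), deriv v (u s) * fst (P' s), deriv w (u s) * fst (P' s))) (at s)"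
      by (rule has_vector_derivative_transform_within_open[OF _ I(1) that]) (use P in auto)
    with P'[OF that] have "P' s = (fst (P' s), deriv v (u s) * fst (P' s), deriv w (u s) * fst (P' s))"
      by (rule vector_derivative_unique_at)
    then show ?thesis by (cases "P' s") (simp add: mult.commute)
  qed
  then have **: "P' s = (fst (P' s), fst (P' s) * deriv v (u s), fst (P' s) * deriv w (u s))" if "s \<in> I" for s
    using that by (cases "P' s") fastforce
  from *[OF I(2)] show "P' t = fst (P' t) *\<^sub>R (1, deriv v (u t), deriv w (u t))" .
  have a: "((\<lambda>s. fst (P' s)) has_real_derivative fst P'') (at t)"
    unfolding has_real_derivative_iff_has_vector_derivative
    using bounded_linear.has_vector_derivative[OF bounded_linear_fst P''] .
  have chain2: "((\<lambda>s. deriv f (u s)) has_real_derivative deriv (deriv f) (u t) * fst (P' t)) (at t)"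
    if "smooth_on J f" for f
    using P[OF I(2)] smooth_on_real_deriv(1)[OF J(1) smooth_on_real_deriv(2)[OF J(1) that]]
    by (intro DERIV_chain2[OF _ u'[OF I(2)]]) auto
  have "((\<lambda>s. (fst (P' s), fst (P' s) * deriv v (u s), fst (P' s) * deriv w (u s))) has_vector_derivative
    (fst P'', fst P'' * deriv v (u t) + deriv (deriv v) (u t) * fst (P' t) * fst (P' t),
      fst P'' * deriv w (u t) + deriv (deriv w) (u t) * fst (P' t) * fst (P' t))) (at t)"
    by (intro has_vector_derivative_Pair3 a DERIV_mult chain2 J)
  then have "(P' has_vector_derivative
    (fst P'', fst P'' * deriv v (u t) + deriv (deriv v) (u t) * fst (P' t) * fst (P' t),
      fst P'' * deriv w (u t) + deriv (deriv w) (u t) * fst (P' t) * fst (P' t))) (at t)"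
    by (rule has_vector_derivative_transform_within_open[OF _ I]) (rule **[symmetric])
  with P'' have "P'' = (fst P'', fst P'' * deriv v (u t) + deriv (deriv v) (u t) * fst (P' t) * fst (P' t),
      fst P'' * deriv w (u t) + deriv (deriv w) (u t) * fst (P' t) * fst (P' t))"
    by (rule vector_derivative_unique_at)
  then show "P'' = fst P'' *\<^sub>R (1, deriv v (u t), deriv w (u t))
           + (fst (P' t))\<^sup>2 *\<^sub>R (0, deriv (deriv v) (u t), deriv (deriv w) (u t))"
    by (cases P'') (simp add: power2_eq_square)
qed

text \<open>The system \<open>y'' + F = 0\<close>, \<open>z'' + G = 0\<close> of unparametrised geodesics of the spray \<open>Q\<close>.\<close>

definition geodesic_F :: "(point \<Rightarrow> point \<Rightarrow> point) \<Rightarrow> jet_fun" where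
  "geodesic_F Q = (\<lambda>q a b. fst (snd (Q q (1, a, b))) - a * fst (Q q (1, a, b)))"

definition geodesic_G :: "(point \<Rightarrow> point \<Rightarrow> point) \<Rightarrow> jet_fun" where
  "geodesic_G Q = (\<lambda>q a b. snd (snd (Q q (1, a, b))) - b * fst (Q q (1, a, b)))"

text \<open>The hypothesis on the second derivative says that \<open>\<phi>\<close> maps the spray \<open>Q\<close> to the flat one up
  to reparametrisation of geodesics.\<close>

lemma maps_geodesic_system:
  fixes \<phi> :: "point \<Rightarrow> point"
  assumes V: "open V" "smooth_on V \<phi>"
    and inj: "\<And>q h. q \<in> V \<Longrightarrow> frechet_derivative \<phi> (at q) h = 0 \<Longrightarrow> h = 0"
    and Q: "\<And>q h. q \<in> V \<Longrightarrow> frechet_derivative (\<lambda>q. frechet_derivative \<phi> (at q) h) (at q) h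
              = frechet_derivative \<phi> (at q) (Q q h + \<theta> q h *\<^sub>R h)"
  shows "maps_system V \<phi> (geodesic_F Q) (geodesic_G Q) (\<lambda>_ _ _. 0) (\<lambda>_ _ _. 0)"
  unfolding maps_system_def
proof (intro allI impI, elim conjE)
  fix I y z J v w
  assume cI: "smooth_curve I y z" and gV: "curve_graph I y z \<subseteq> V"
    and cJ: "smooth_curve J v w" and im: "\<phi> ` curve_graph I y z = curve_graph J v w"
  have I: "open I" "smooth_on I y" "smooth_on I z" and J: "open J" "smooth_on J v" "smooth_on J w"
    using cI cJ by (auto simp: smooth_curve_def)
  define c where "c = (\<lambda>t. (t, y t, z t))"
  define c' where "c' = (\<lambda>t. (1::real, deriv y t, deriv z t))"
  define c'' where "c'' = (\<lambda>t. (0::real, deriv (deriv y) t, deriv (deriv z) t))"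
  have cV: "c t \<in> V" if "t \<in> I" for t using gV that by (auto simp: curve_graph_def c_def)
  have c1: "(c has_vector_derivative c' t) (at t)" if "t \<in> I" for t
    unfolding c_def c'_def using smooth_on_real_deriv(1)[OF I(1)] I that
    by (intro has_vector_derivative_Pair3 DERIV_ident) auto
  have c2: "(c' has_vector_derivative c'' t) (at t)" if "t \<in> I" for t
    unfolding c''_def c'_def
    using smooth_on_real_deriv(1)[OF I(1) smooth_on_real_deriv(2)[OF I(1)]] I that
    by (intro has_vector_derivative_Pair3 DERIV_const) auto
  define P where "P = (\<lambda>t. \<phi> (c t))"
  define P' where "P' = (\<lambda>t. frechet_derivative \<phi> (at (c t)) (c' t))"
  define u where "u = (\<lambda>t. fst (P t))"
  have Pu: "u t \<in> J \<and> P t = (u t, v (u t), w (u t))" if "t \<in> I" for t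
  proof -
    have "P t \<in> curve_graph J v w" using im that by (auto simp: P_def c_def curve_graph_def)
    then show ?thesis by (auto simp: curve_graph_def u_def)
  qed
  have uJ: "J = u ` I"
  proof
    show "J \<subseteq> u ` I"
    proof
      fix s assume "s \<in> J"
      then have "(s, v s, w s) \<in> \<phi> ` curve_graph I y z" unfolding im by (auto simp: curve_graph_def)
      then obtain t where "t \<in> I" "P t = (s, v s, w s)" by (auto simp: curve_graph_def P_def c_def)
      then show "s \<in> u ` I" unfolding u_def by (metis fst_conv imageI)
    qed
  qed (use Pu in auto)
  \<comment> \<open>Both sides say that an acceleration is parallel to a velocity:
    \<open>Q c' + c''\<close> to \<open>c'\<close> in the source, \<open>P''\<close> to
    \<open>P'\<close> in the target. The derivative of \<open>\<phi>\<close> carries one statement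
    to the other, and the \<open>\<theta>\<close> term only shifts the factor. As \<open>c'\<close>
    and \<open>c''\<close> begin with 1 and 0, the factor in the source is the first
    component.\<close>
  have key: "deriv (deriv y) t + geodesic_F Q (t, y t, z t) (deriv y t) (deriv z t) = 0
         \<and> deriv (deriv z) t + geodesic_G Q (t, y t, z t) (deriv y t) (deriv z t) = 0
     \<longleftrightarrow> deriv (deriv v) (u t) = 0 \<and> deriv (deriv w) (u t) = 0" if t: "t \<in> I" for t
  proof -
    define L where "L = frechet_derivative \<phi> (at (c t))"
    have linL: "linear L"
      unfolding L_def using has_derivative_linear[OF smooth_on_has_derivative[OF V(2) cV[OF t]]] .
    have injL: "h = 0" if "L h = 0" for h using inj[OF cV[OF t]] that by (simp add: L_def)
    obtain q1 q2 q3 where q: "Q (c t) (c' t) = (q1, q2, q3)" by (cases "Q (c t) (c' t)") auto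
    define \<tau> where "\<tau> = \<theta> (c t) (c' t)"
    define P'' where "P'' = L (Q (c t) (c' t) + \<tau> *\<^sub>R c' t) + L (c'' t)"
    have dP: "(P has_vector_derivative P' s) (at s)" if "s \<in> I" for s
      unfolding P_def P'_def using derivative_along_curve(1)[where c = c and c' = c', OF V I(1) that cV c1[OF that]] .
    have dP': "(P' has_vector_derivative P'') (at t)"
      using derivative_along_curve(2)[where c = c and c' = c', OF V I(1) t cV c1[OF t] c2[OF t]] Q[OF cV[OF t], of "c' t"]
      by (simp add: P'_def P''_def L_def \<tau>_def)
    note g = graph_second_order[where P = P, OF I(1) t J Pu dP dP']
    define e where "e = (1::real, deriv v (u t), deriv w (u t))"
    have Lc: "L (c' t) = fst (P' t) *\<^sub>R e" using g(1) by (simp add: P'_def L_def e_def)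
    \<comment> \<open>A vanishing speed of \<open>u\<close> would make the whole image velocity
      vanish, which injectivity of the derivative excludes for a velocity with first component
      1.\<close>
    have "fst (P' t) \<noteq> 0"
      using injL[of "c' t"] Lc by (auto simp: c'_def zero_prod_def)
    define k where "k = fst (P' t)"
    have k: "k \<noteq> 0" using \<open>fst (P' t) \<noteq> 0\<close> by (simp add: k_def)
    have P''1: "L (Q (c t) (c' t) + \<tau> *\<^sub>R c' t + c'' t) = P''" by (simp add: P''_def linear_add[OF linL])
    have P''2: "P'' = fst P'' *\<^sub>R e + k\<^sup>2 *\<^sub>R (0, deriv (deriv v) (u t), deriv (deriv w) (u t))"
      using g(2) by (simp add: e_def k_def)
    have geo: "geodesic_F Q (t, y t, z t) (deriv y t) (deriv z t) = q2 - deriv y t * q1"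
      "geodesic_G Q (t, y t, z t) (deriv y t) (deriv z t) = q3 - deriv z t * q1"
      using q by (simp_all add: geodesic_F_def geodesic_G_def c_def c'_def)
    show ?thesis
    proof
      assume "deriv (deriv y) t + geodesic_F Q (t, y t, z t) (deriv y t) (deriv z t) = 0
         \<and> deriv (deriv z) t + geodesic_G Q (t, y t, z t) (deriv y t) (deriv z t) = 0"
      then have "Q (c t) (c' t) + \<tau> *\<^sub>R c' t + c'' t = (q1 + \<tau>) *\<^sub>R c' t"
        unfolding geo q by (auto simp: c'_def c''_def algebra_simps)
      then have "P'' = ((q1 + \<tau>) * k) *\<^sub>R e"
        using P''1 Lc linear_cmul[OF linL, of "q1 + \<tau>" "c' t"] by (simp add: k_def)
      with P''2 k show "deriv (deriv v) (u t) = 0 \<and> deriv (deriv w) (u t) = 0"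
        by (auto simp: e_def)
    next
      assume "deriv (deriv v) (u t) = 0 \<and> deriv (deriv w) (u t) = 0"
      then have P''3: "P'' = fst P'' *\<^sub>R e" using P''2 by (metis add.right_neutral scaleR_zero_right zero_prod_def)
      define m where "m = fst P'' / k"
      have "m *\<^sub>R L (c' t) = fst P'' *\<^sub>R e" using k Lc by (simp add: m_def k_def)
      then have "L (Q (c t) (c' t) + \<tau> *\<^sub>R c' t + c'' t - m *\<^sub>R c' t) = 0"
        using P''1 P''3 linear_cmul[OF linL, of m "c' t"] by (metis diff_self linear_diff[OF linL])
      from injL[OF this] have "Q (c t) (c' t) + \<tau> *\<^sub>R c' t + c'' t = m *\<^sub>R c' t" by simp
      then have m: "q1 + \<tau> = m" "q2 + \<tau> * deriv y t + deriv (deriv y) t = m * deriv y t"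
        "q3 + \<tau> * deriv z t + deriv (deriv z) t = m * deriv z t"
        unfolding q by (simp_all add: c'_def c''_def)
      have "deriv (deriv y) t + (q2 - deriv y t * q1) = 0" using m(2)[folded m(1)] by (simp add: algebra_simps)
      moreover have "deriv (deriv z) t + (q3 - deriv z t * q1) = 0" using m(3)[folded m(1)] by (simp add: algebra_simps)
      ultimately show "deriv (deriv y) t + geodesic_F Q (t, y t, z t) (deriv y t) (deriv z t) = 0
         \<and> deriv (deriv z) t + geodesic_G Q (t, y t, z t) (deriv y t) (deriv z t) = 0"
        unfolding geo by blast
    qed
  qed
  show "solves (geodesic_F Q) (geodesic_G Q) I y z \<longleftrightarrow> solves (\<lambda>_ _ _. 0) (\<lambda>_ _ _. 0) J v w"
    unfolding solves_def uJ using key by auto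
qed

text \<open>The curve is the pullback under the inverse \<open>\<psi>\<close> of the straight line
  through the image of \<open>p\<close> in the image of the direction \<open>(1, a, b)\<close>. The
  hypothesis on the direction says that \<open>u\<close> is not stationary along it, so that the
  line is a graph over \<open>u\<close>.\<close>

lemma transversal_line:
  fixes \<phi> :: "point \<Rightarrow> point"
  assumes pt: "point_transformation V \<phi>" and p: "p \<in> V"
    and d: "fst (frechet_derivative \<phi> (at p) (1, a, b)) \<noteq> 0"
  obtains I y z J v w where "smooth_curve I y z" "curve_graph I y z \<subseteq> V" "smooth_curve J v w"
    "\<phi> ` curve_graph I y z = curve_graph J v w" "solves (\<lambda>_ _ _. 0) (\<lambda>_ _ _. 0) J v w"
    "fst p \<in> I" "p = (fst p, y (fst p), z (fst p))" "deriv y (fst p) = a" "deriv z (fst p) = b"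
proof -
  obtain \<psi> where V: "open V" "open (\<phi> ` V)" "smooth_on V \<phi>"
    and \<psi>: "smooth_on (\<phi> ` V) \<psi>" "\<And>q. q \<in> V \<Longrightarrow> \<psi> (\<phi> q) = q"
    using pt by (auto simp: point_transformation_def)
  define d1 where "d1 = fst (frechet_derivative \<phi> (at p) (1, a, b))"
  have d1: "d1 \<noteq> 0" using d by (simp add: d1_def)
  obtain m n where e: "frechet_derivative \<phi> (at p) (1, a, b) = d1 *\<^sub>R (1, m, n)"
  proof -
    obtain x y z where "frechet_derivative \<phi> (at p) (1, a, b) = (x, y, z)" by (metis prod.collapse)
    then show thesis using d1 that[of "y / d1" "z / d1"] by (simp add: d1_def)
  qed
  obtain u0 v0 w0 where \<phi>p: "\<phi> p = (u0, v0, w0)" by (metis prod.collapse)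
  define v w where "v = (\<lambda>u. v0 + m * (u - u0))" and "w = (\<lambda>u. w0 + n * (u - u0))"
  define l where "l = (\<lambda>u. (u, v u, w u))"
  have smooth_vw: "smooth_on UNIV v" "smooth_on UNIV w"
    unfolding v_def w_def by (intro smooth_intros open_UNIV)+
  have smooth_l: "smooth_on UNIV l"
    unfolding l_def by (intro smooth_intros open_UNIV smooth_vw)
  define O1 where "O1 = l -` (\<phi> ` V)"
  have O1: "open O1"
    unfolding O1_def using V(2) smooth_on_imp_continuous_on[OF smooth_l] by (rule open_vimage)
  have lu0: "l u0 = \<phi> p" by (simp add: l_def v_def w_def \<phi>p)
  have u0: "u0 \<in> O1" using p by (simp add: O1_def lu0)
  define \<eta> where "\<eta> = (\<lambda>u. \<psi> (l u))"
  have \<eta>: "smooth_on O1 \<eta>"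
    unfolding \<eta>_def
    by (rule smooth_on_compose[OF O1 V(2) _ smooth_on_subset[OF smooth_l] \<psi>(1)]) (auto simp: O1_def)
  have \<eta>V: "\<eta> u \<in> V" "\<phi> (\<eta> u) = l u" if "u \<in> O1" for u
    using that \<psi>(2) by (auto simp: O1_def \<eta>_def)
  have \<eta>u0: "\<eta> u0 = p" using \<psi>(2) p by (simp add: \<eta>_def lu0)
  \<comment> \<open>The x-coordinate along the pulled-back line. Its derivative at \<open>u0\<close>
    is \<open>1 / d1\<close>, so it has a smooth inverse nearby, and parametrising by it makes the
    curve a graph over x.\<close>
  define \<xi> where "\<xi> = (\<lambda>u. fst (\<eta> u))"
  have \<xi>: "smooth_on O1 \<xi>" unfolding \<xi>_def by (intro smooth_on_fst O1 \<eta>)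
  note \<xi>' = smooth_on_real_deriv[OF O1 \<xi>]
  have D\<eta>: "(\<eta> has_vector_derivative (1 / d1) *\<^sub>R (1, a, b)) (at u0)"
  proof -
    have l': "(l has_vector_derivative (1, m, n)) (at u0)"
      unfolding l_def v_def w_def by (intro has_vector_derivative_Pair3) (auto intro!: derivative_eq_intros)
    have D\<psi>: "(\<psi> has_derivative frechet_derivative \<psi> (at (\<phi> p))) (at (\<phi> p))"
      using smooth_on_has_derivative[OF \<psi>(1)] p by blast
    note lin = has_derivative_linear[OF D\<psi>]
    have "((\<lambda>q. \<psi> (\<phi> q)) has_derivative (\<lambda>h. frechet_derivative \<psi> (at (\<phi> p)) (frechet_derivative \<phi> (at p) h))) (at p)"
      by (rule has_derivative_compose[OF smooth_on_has_derivative[OF V(3) p] D\<psi>])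
    then have "((\<lambda>q. q) has_derivative (\<lambda>h. frechet_derivative \<psi> (at (\<phi> p)) (frechet_derivative \<phi> (at p) h))) (at p)"
      by (rule has_derivative_transform_within_open[OF _ V(1) p]) (use \<psi> in auto)
    then have "(\<lambda>h. frechet_derivative \<psi> (at (\<phi> p)) (frechet_derivative \<phi> (at p) h)) = (\<lambda>h. h)"
      using has_derivative_ident has_derivative_unique by blast
    then have "frechet_derivative \<psi> (at (\<phi> p)) (d1 *\<^sub>R (1, m, n)) = (1, a, b)" using e by metis
    then have "d1 *\<^sub>R frechet_derivative \<psi> (at (\<phi> p)) (1, m, n) = (1, a, b)"
      using linear_cmul[OF lin, of d1 "(1, m, n)"] by argo
    then have "(1 / d1) *\<^sub>R d1 *\<^sub>R frechet_derivative \<psi> (at (\<phi> p)) (1, m, n) = (1 / d1) *\<^sub>R (1, a, b)" by argo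
    then have "frechet_derivative \<psi> (at (\<phi> p)) (1, m, n) = (1 / d1) *\<^sub>R (1, a, b)"
      using d1 unfolding scaleR_scaleR by simp
    moreover have "(\<eta> has_vector_derivative frechet_derivative \<psi> (at (l u0)) (1, m, n)) (at u0)"
      unfolding \<eta>_def
      by (rule derivative_along_curve(1)[OF V(2) \<psi>(1) O1 u0 _ l']) (auto simp: O1_def)
    ultimately show ?thesis by (simp add: lu0)
  qed
  have D\<xi>: "deriv \<xi> u0 = 1 / d1"
    using bounded_linear.has_vector_derivative[OF bounded_linear_fst D\<eta>]
    by (intro DERIV_imp_deriv) (simp add: \<xi>_def has_real_derivative_iff_has_vector_derivative)
  have "\<exists>\<epsilon>>0. ball u0 \<epsilon> \<subseteq> {u \<in> O1. deriv \<xi> u \<noteq> 0}"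
  proof -
    have "open {u \<in> O1. deriv \<xi> u \<noteq> 0}"
      using continuous_open_preimage[OF smooth_on_imp_continuous_on[OF \<xi>'(2)] O1, of "- {0}"]
      by (simp add: vimage_def Int_def open_Compl)
    moreover have "u0 \<in> {u \<in> O1. deriv \<xi> u \<noteq> 0}" using u0 D\<xi> d1 by simp
    ultimately show ?thesis using openE by blast
  qed
  then obtain \<epsilon> where \<epsilon>: "\<epsilon> > 0" "ball u0 \<epsilon> \<subseteq> O1" "\<And>u. u \<in> ball u0 \<epsilon> \<Longrightarrow> deriv \<xi> u \<noteq> 0" by blast
  define J where "J = ball u0 \<epsilon>"
  have J: "open J" "convex J" "u0 \<in> J" "J \<subseteq> O1" using \<epsilon> by (auto simp: J_def)
  have inj: "inj_on \<xi> J"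
  proof (rule inj_onI, rule ccontr)
    have no: False if "s \<in> J" "t \<in> J" "s < t" "\<xi> s = \<xi> t" for s t
    proof -
      have sub: "{s..t} \<subseteq> J" using J(2) that by (metis closed_segment_eq_real_ivl closed_segment_subset less_eq_real_def)
      then have "(\<xi> has_real_derivative deriv \<xi> x) (at x)" if "s \<le> x" "x \<le> t" for x
        using that J(4) by (intro \<xi>'(1)) auto
      from MVT2[OF that(3) this] obtain r where "s < r" "r < t" "\<xi> t - \<xi> s = (t - s) * deriv \<xi> r"
        by blast
      then show False using that sub \<epsilon>(3)[of r] by (auto simp: J_def[symmetric] subset_iff)
    qed
    fix s t assume "s \<in> J" "t \<in> J" "\<xi> s = \<xi> t" "s \<noteq> t"
    then show False using no[of s t] no[of t s] by linarith
  qed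
  have cont: "continuous_on J \<xi>" using smooth_on_imp_continuous_on[OF \<xi>] J(4) continuous_on_subset by blast
  define I where "I = \<xi> ` J"
  have I: "open I" "is_interval I"
    using invariance_of_domain[OF cont J(1) inj] connected_continuous_image[OF cont convex_connected[OF J(2)]]
    by (auto simp: I_def is_interval_connected_1)
  define g where "g = inv_into J \<xi>"
  have g\<xi>: "g (\<xi> u) = u" if "u \<in> J" for u using that inj by (simp add: g_def)
  have \<xi>g: "\<xi> (g t) = t" "g t \<in> J" if "t \<in> I" for t
    using that by (auto simp: I_def g\<xi>)
  have gJ: "g ` I \<subseteq> J" using \<xi>g(2) by auto
  have smooth_g: "smooth_on I g"
  proof (rule smooth_on_inverse_function[OF J(1) I(1) gJ, where f = \<xi> and f' = "\<lambda>u h. deriv \<xi> u * h" and A = "\<lambda>u h. h / deriv \<xi> u"])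
    show "continuous_on I g"
      unfolding I_def by (rule continuous_on_inverse_open[OF J(1) cont]) (auto simp: g\<xi>)
    show "(\<xi> has_derivative (\<lambda>h. deriv \<xi> u * h)) (at u)" if "u \<in> J" for u
      using \<xi>'(1) J that by (auto simp: has_field_derivative_def)
    show "bounded_linear (\<lambda>h. h / deriv \<xi> u)" if "u \<in> J" for u by (rule bounded_linear_divide)
    show "smooth_on J (\<lambda>u. h / deriv \<xi> u)" for h
      using J \<epsilon>(3) by (intro smooth_on_divide smooth_on_const smooth_on_subset[OF \<xi>'(2)]) (auto simp: J_def)
  qed (use \<xi>g \<epsilon>(3) in \<open>auto simp: J_def\<close>)
  have smooth_\<eta>g: "smooth_on I (\<lambda>t. \<eta> (g t))"
    using J gJ by (intro smooth_on_compose[OF I(1) O1 _ smooth_g \<eta>]) auto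
  define y z where "y = (\<lambda>t. fst (snd (\<eta> (g t))))" and "z = (\<lambda>t. snd (snd (\<eta> (g t))))"
  have \<eta>g: "\<eta> (g t) = (t, y t, z t)" if "t \<in> I" for t
    using \<xi>g(1)[OF that] by (simp add: y_def z_def \<xi>_def prod_eq_iff)
  have u0I: "\<xi> u0 \<in> I" using J by (auto simp: I_def)
  have \<xi>u0: "\<xi> u0 = fst p" by (simp add: \<xi>_def \<eta>u0)
  have "((\<lambda>t. \<eta> (g t)) has_vector_derivative (1, a, b)) (at (fst p))"
  proof -
    have "(g has_real_derivative inverse (1 / d1)) (at (fst p))"
    proof (rule has_field_derivative_inverse_basic[of \<xi>])
      show "DERIV \<xi> (g (fst p)) :> 1 / d1"
        using \<xi>'(1)[of u0] u0 D\<xi> by (simp add: \<xi>u0[symmetric] g\<xi>[OF J(3)])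
      show "continuous (at (fst p)) g"
        using smooth_on_imp_continuous_on[OF smooth_g] I(1) u0I continuous_on_eq_continuous_at by (metis \<xi>u0)
    qed (use I(1) u0I \<xi>g(1) d1 \<xi>u0 in auto)
    then have "(g has_vector_derivative d1) (at (fst p))"
      by (simp add: has_real_derivative_iff_has_vector_derivative)
    from vector_diff_chain_at[OF this, of \<eta> "(1 / d1) *\<^sub>R (1, a, b)"] show ?thesis
      using D\<eta> d1 by (simp add: g\<xi>[OF J(3)] \<xi>u0[symmetric] o_def)
  qed
  then have xyz: "((\<lambda>t. (t, y t, z t)) has_vector_derivative (1, a, b)) (at (fst p))"
    by (rule has_vector_derivative_transform_within_open[OF _ I(1)]) (use u0I \<xi>u0 \<eta>g in auto)
  have yz: "((\<lambda>t. (y t, z t)) has_vector_derivative (a, b)) (at (fst p))"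
    using bounded_linear.has_vector_derivative[OF bounded_linear_snd xyz] by simp
  have D: "deriv y (fst p) = a" "deriv z (fst p) = b"
    using bounded_linear.has_vector_derivative[OF bounded_linear_fst yz]
      bounded_linear.has_vector_derivative[OF bounded_linear_snd yz]
    by (auto intro!: DERIV_imp_deriv simp: has_real_derivative_iff_has_vector_derivative)
  have graph: "curve_graph I y z = \<eta> ` J"
    unfolding curve_graph_def I_def image_image by (rule image_cong[OF refl]) (metis I_def \<eta>g g\<xi> imageI)
  show thesis
  proof (rule that[of I y z J v w])
    show "smooth_curve I y z"
      unfolding smooth_curve_def y_def z_def
      by (intro conjI I smooth_on_fst smooth_on_snd smooth_\<eta>g)
    show "smooth_curve J v w"
      unfolding smooth_curve_def using J smooth_vw
      by (auto intro: smooth_on_subset simp: is_interval_convex_1)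
    show "curve_graph I y z \<subseteq> V" unfolding graph using \<eta>V(1) J(4) by auto
    show "\<phi> ` curve_graph I y z = curve_graph J v w"
      unfolding graph unfolding image_image curve_graph_def
      by (rule image_cong) (use \<eta>V(2) J(4) in \<open>auto simp: l_def\<close>)
    have "deriv v = (\<lambda>_. m)" "deriv w = (\<lambda>_. n)"
      unfolding v_def w_def by (rule ext, rule DERIV_imp_deriv, (auto intro!: derivative_eq_intros)[1])+
    then show "solves (\<lambda>_ _ _. 0) (\<lambda>_ _ _. 0) J v w" by (simp add: solves_def)
    show "fst p \<in> I" using u0I \<xi>u0 by simp
    show "p = (fst p, y (fst p), z (fst p))" using \<eta>g[OF u0I] \<eta>u0 g\<xi>[OF J(3)] \<xi>u0 by simp
  qed (rule D)+
qed

text \<open>Through \<open>p\<close> with slopes \<open>a\<close>, \<open>b\<close> runs a curve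
  whose image is a straight line. As \<open>maps_system\<close> is an equivalence, this curve solves
  both source systems, and its second derivatives determine the values of both.\<close>

lemma maps_system_unique:
  assumes pt: "point_transformation V \<phi>" and p: "p \<in> V"
    and m: "maps_system V \<phi> F G (\<lambda>_ _ _. 0) (\<lambda>_ _ _. 0)" "maps_system V \<phi> F' G' (\<lambda>_ _ _. 0) (\<lambda>_ _ _. 0)"
    and d: "fst (frechet_derivative \<phi> (at p) (1, a, b)) \<noteq> 0"
  shows "F p a b = F' p a b" "G p a b = G' p a b"
proof -
  obtain I y z J v w where c: "smooth_curve I y z" "curve_graph I y z \<subseteq> V" "smooth_curve J v w"
    "\<phi> ` curve_graph I y z = curve_graph J v w" "solves (\<lambda>_ _ _. 0) (\<lambda>_ _ _. 0) J v w"
    "fst p \<in> I" "p = (fst p, y (fst p), z (fst p))" "deriv y (fst p) = a" "deriv z (fst p) = b"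
    using transversal_line[OF pt p d] .
  have "solves F G I y z" "solves F' G' I y z"
    using m c(1-5) unfolding maps_system_def by blast+
  then have "deriv (deriv y) (fst p) + F p a b = 0 \<and> deriv (deriv z) (fst p) + G p a b = 0"
    "deriv (deriv y) (fst p) + F' p a b = 0 \<and> deriv (deriv z) (fst p) + G' p a b = 0"
    using c(6-9) unfolding solves_def by metis+
  then show "F p a b = F' p a b" "G p a b = G' p a b" by linarith+
qed

section \<open>The flat connection pulled back by a point transformation\<close>

lemma frechet_derivative_applied:
  fixes g :: "'a::euclidean_space \<Rightarrow> 'b::real_normed_vector"
  assumes S: "open S" "p \<in> S" and g: "smooth_on S g" and c: "(c has_derivative c') (at p)"
  shows "((\<lambda>q. frechet_derivative g (at q) (c q)) has_derivative
    (\<lambda>m. frechet_derivative (\<lambda>q. frechet_derivative g (at q) (c p)) (at p) m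
        + frechet_derivative g (at p) (c' m))) (at p)"
proof -
  let ?D = "\<lambda>b q. frechet_derivative g (at q) b"
  have "((\<lambda>q. \<Sum>b\<in>Basis. (c q \<bullet> b) *\<^sub>R ?D b q) has_derivative
      (\<lambda>m. \<Sum>b\<in>Basis. (c p \<bullet> b) *\<^sub>R frechet_derivative (?D b) (at p) m + (c' m \<bullet> b) *\<^sub>R ?D b p)) (at p)"
    by (intro has_derivative_sum bounded_bilinear.FDERIV[OF bounded_bilinear_scaleR]
        bounded_linear.has_derivative[OF bounded_linear_inner_left c]
        smooth_on_has_derivative[OF smooth_on_frechet_derivative[OF g] S(2)])
  moreover have "(\<Sum>b\<in>Basis. (c p \<bullet> b) *\<^sub>R frechet_derivative (?D b) (at p) m + (c' m \<bullet> b) *\<^sub>R ?D b p)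
      = frechet_derivative (?D (c p)) (at p) m + ?D (c' m) p" for m
    using second_derivative_expand[OF S g, of "c p" m]
      has_derivative_expand[OF smooth_on_has_derivative[OF g S(2)], of "c' m"]
    by (simp add: sum.distrib)
  ultimately have "((\<lambda>q. \<Sum>b\<in>Basis. (c q \<bullet> b) *\<^sub>R ?D b q) has_derivative
      (\<lambda>m. frechet_derivative (?D (c p)) (at p) m + ?D (c' m) p)) (at p)" by simp
  then show ?thesis
    by (rule has_derivative_transform_within_open[OF _ S])
      (rule has_derivative_expand[OF smooth_on_has_derivative[OF g], symmetric])
qed

lemma linear_frechet_derivative: "smooth_on S g \<Longrightarrow> p \<in> S \<Longrightarrow> linear (frechet_derivative g (at p))"
  using has_derivative_linear[OF smooth_on_has_derivative] .

text \<open>\<open>\<Gamma>\<close> is the second derivative of \<open>\<phi>\<close> followed by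
  the inverse of the first. The derivative of \<open>\<phi>\<close> sends each side of the flatness
  equation to a third derivative of \<open>\<phi>\<close> in the directions \<open>h\<close>,
  \<open>k\<close>, \<open>m\<close>, so flatness is the symmetry of third derivatives.\<close>

lemma pullback_flat_connection:
  assumes pt: "point_transformation V \<phi>"
  obtains \<Gamma> where
    "\<And>q h k. q \<in> V \<Longrightarrow> frechet_derivative (\<lambda>q. frechet_derivative \<phi> (at q) h) (at q) k = frechet_derivative \<phi> (at q) (\<Gamma> q h k)"
    "\<And>q h. q \<in> V \<Longrightarrow> linear (\<Gamma> q h)" "\<And>q h k. q \<in> V \<Longrightarrow> \<Gamma> q h k = \<Gamma> q k h"
    "\<And>h k. smooth_on V (\<lambda>q. \<Gamma> q h k)"
    "\<And>q h k m. q \<in> V \<Longrightarrow> frechet_derivative (\<lambda>q. \<Gamma> q h k) (at q) m + \<Gamma> q (\<Gamma> q h k) m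
        = frechet_derivative (\<lambda>q. \<Gamma> q h m) (at q) k + \<Gamma> q (\<Gamma> q h m) k"
    "\<And>q h. q \<in> V \<Longrightarrow> frechet_derivative \<phi> (at q) h = 0 \<Longrightarrow> h = 0"
    "\<And>q. q \<in> V \<Longrightarrow> surj (frechet_derivative \<phi> (at q))"
proof -
  obtain \<psi> where V: "open V" "open (\<phi> ` V)" "smooth_on V \<phi>"
    and \<psi>: "smooth_on (\<phi> ` V) \<psi>" "\<And>q. q \<in> V \<Longrightarrow> \<psi> (\<phi> q) = q"
    using pt by (auto simp: point_transformation_def)
  let ?D = "\<lambda>h q. frechet_derivative \<phi> (at q) h"
  define A where "A = (\<lambda>q. frechet_derivative \<psi> (at (\<phi> q)))"
  have A1: "A q (?D h q) = h" if "q \<in> V" for q h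
  proof -
    have "((\<lambda>q. \<psi> (\<phi> q)) has_derivative (\<lambda>h. A q (?D h q))) (at q)"
      unfolding A_def using V(3) \<psi>(1) that
      by (intro has_derivative_compose[of \<phi> _ _ _ \<psi>] smooth_on_has_derivative) auto
    then have "((\<lambda>q. q) has_derivative (\<lambda>h. A q (?D h q))) (at q)"
      by (rule has_derivative_transform_within_open[OF _ V(1) that]) (use \<psi> in auto)
    then have "(\<lambda>h. A q (?D h q)) = (\<lambda>h. h)"
      using has_derivative_ident has_derivative_unique by blast
    then show ?thesis by metis
  qed
  have A2: "?D (A q h) q = h" if "q \<in> V" for q h
  proof -
    have "((\<lambda>r. \<phi> (\<psi> r)) has_derivative (\<lambda>h. ?D (A q h) q)) (at (\<phi> q))"
      unfolding A_def using V(3) \<psi> that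
      by (intro has_derivative_compose[of \<psi> _ _ _ \<phi>] smooth_on_has_derivative) (auto simp: smooth_on_has_derivative)
    then have "((\<lambda>r. r) has_derivative (\<lambda>h. ?D (A q h) q)) (at (\<phi> q))"
      by (rule has_derivative_transform_within_open[OF _ V(2)]) (use \<psi> that in auto)
    then have "(\<lambda>h. ?D (A q h) q) = (\<lambda>h. h)"
      using has_derivative_ident has_derivative_unique by blast
    then show ?thesis by metis
  qed
  define \<Gamma> where "\<Gamma> = (\<lambda>q h k. A q (frechet_derivative (?D h) (at q) k))"
  have G: "frechet_derivative (?D h) (at q) k = ?D (\<Gamma> q h k) q" if "q \<in> V" for q h k
    by (simp add: \<Gamma>_def A2[OF that])
  have linA: "linear (A q)" if "q \<in> V" for q
    unfolding A_def using linear_frechet_derivative[OF \<psi>(1)] that by blast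
  have smA: "smooth_on V (\<lambda>q. A q h)" for h
    unfolding A_def
    by (rule smooth_on_compose[OF V(1,2) _ V(3) smooth_on_frechet_derivative[OF \<psi>(1)]]) auto
  have smG: "smooth_on V (\<lambda>q. \<Gamma> q h k)" for h k
  proof (rule smooth_on_cong[OF _ V(1)])
    show "smooth_on V (\<lambda>q. \<Sum>b\<in>Basis. (frechet_derivative (?D h) (at q) k \<bullet> b) *\<^sub>R A q b)"
      by (intro smooth_on_sum smooth_on_scaleR smooth_on_frechet_derivative V smA
          smooth_on_bounded_linear[OF bounded_linear_inner_left])
    show "(\<Sum>b\<in>Basis. (frechet_derivative (?D h) (at q) k \<bullet> b) *\<^sub>R A q b) = \<Gamma> q h k" if "q \<in> V" for q
      unfolding \<Gamma>_def using has_derivative_expand[OF bounded_linear_imp_has_derivative[OF linear_conv_bounded_linear[THEN iffD1, OF linA[OF that]]], symmetric] .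
  qed
  have sym: "\<Gamma> q h k = \<Gamma> q k h" if "q \<in> V" for q h k
    unfolding \<Gamma>_def using symmetric_second_derivative[OF V(1) that V(3)] by metis
  have flat: "?D (frechet_derivative (\<lambda>q. \<Gamma> q h k) (at q) m + \<Gamma> q (\<Gamma> q h k) m) q
      = frechet_derivative (\<lambda>q. frechet_derivative (?D h) (at q) k) (at q) m" if q: "q \<in> V" for q h k m
  proof -
    have "((\<lambda>q. ?D (\<Gamma> q h k) q) has_derivative (\<lambda>m. frechet_derivative (?D (\<Gamma> q h k)) (at q) m
        + ?D (frechet_derivative (\<lambda>q. \<Gamma> q h k) (at q) m) q)) (at q)"
      by (rule frechet_derivative_applied[OF V(1) q V(3) smooth_on_has_derivative[OF smG q]])
    then have "((\<lambda>q. frechet_derivative (?D h) (at q) k) has_derivative (\<lambda>m. frechet_derivative (?D (\<Gamma> q h k)) (at q) m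
        + ?D (frechet_derivative (\<lambda>q. \<Gamma> q h k) (at q) m) q)) (at q)"
      by (rule has_derivative_transform_within_open[OF _ V(1) q]) (simp add: G)
    from fun_cong[OF frechet_derivative_at[OF this], of m] show ?thesis
      by (simp add: G[OF q] linear_add[OF linear_frechet_derivative[OF V(3) q]] add.commute)
  qed
  show thesis
  proof (rule that[of \<Gamma>])
    show "linear (\<Gamma> q h)" if "q \<in> V" for q h
      unfolding \<Gamma>_def
      using linear_compose[OF linear_frechet_derivative[OF smooth_on_frechet_derivative[OF V(3)] that] linA[OF that]]
      by (simp add: o_def)
    show "frechet_derivative (\<lambda>q. \<Gamma> q h k) (at q) m + \<Gamma> q (\<Gamma> q h k) m
        = frechet_derivative (\<lambda>q. \<Gamma> q h m) (at q) k + \<Gamma> q (\<Gamma> q h m) k" if "q \<in> V" for q h k m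
    proof -
      have "?D (frechet_derivative (\<lambda>q. \<Gamma> q h k) (at q) m + \<Gamma> q (\<Gamma> q h k) m) q
          = ?D (frechet_derivative (\<lambda>q. \<Gamma> q h m) (at q) k + \<Gamma> q (\<Gamma> q h m) k) q"
        unfolding flat[OF that]
        by (rule symmetric_second_derivative[OF V(1) that smooth_on_frechet_derivative[OF V(3)]])
      then show ?thesis using A1[OF that] by metis
    qed
    show "h = 0" if "q \<in> V" "?D h q = 0" for q h
      using A1[OF that(1), of h] that(2) linear_0[OF linA[OF that(1)]] by simp
    show "surj (frechet_derivative \<phi> (at q))" if "q \<in> V" for q
      using A2[OF that] by (metis surjI)
  qed (use G sym smG in auto)
qed

text \<open>A cubic polynomial in one variable that vanishes at \<open>\<plusminus>1\<close> and \<open>\<plusminus>2\<close> vanishes at \<open>0\<close>; apply this on a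
  line through the given point.\<close>

lemma cubic_vanishing_off_line:
  assumes L: "l0 \<noteq> 0 \<or> l1 \<noteq> 0 \<or> l2 \<noteq> (0::real)"
    and P: "\<And>a b. l0 + a * l1 + b * l2 \<noteq> 0 \<Longrightarrow>
      c00 + c10 * a + c01 * b + c20 * a^2 + c11 * (a * b) + c02 * b^2
       + c30 * a^3 + c21 * (a^2 * b) + c12 * (a * b^2) + c03 * b^3 = 0"
  shows "c00 = 0" "c10 = 0" "c01 = 0" "c20 = 0" "c11 = 0" "c02 = 0" "c30 = 0" "c21 = 0" "c12 = 0" "c03 = 0"
proof -
  define f where "f = (\<lambda>a b. c00 + c10 * a + c01 * b + c20 * a^2 + c11 * (a * b) + c02 * b^2
       + c30 * a^3 + c21 * (a^2 * b) + c12 * (a * b^2) + c03 * b^3)"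
  \<comment> \<open>A point off the exceptional line. On the way from a point of that line to
    \<open>(d, e)\<close> the affine form is proportional to the parameter, hence non-zero except at
    the start.\<close>
  obtain d e where de: "d * l1 + e * l2 + l0 \<noteq> 0"
  proof (cases "l0 = 0")
    case True
    then have "0 * l1 + 1 * l2 + l0 \<noteq> 0 \<or> 1 * l1 + 0 * l2 + l0 \<noteq> 0" using L by auto
    then show ?thesis using that by blast
  qed (use that[of 0 0] in auto)
  have f0: "f a b = 0" for a b
  proof (cases "l0 + a * l1 + b * l2 = 0")
    case True
    have "f (a + t * (d - a)) (b + t * (e - b)) = 0" if "t \<noteq> 0" for t
    proof -
      have "l0 + (a + t * (d - a)) * l1 + (b + t * (e - b)) * l2
          = (1 - t) * (l0 + a * l1 + b * l2) + t * (d * l1 + e * l2 + l0)" by (simp add: algebra_simps)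
      then show ?thesis using P True de that unfolding f_def by simp
    qed
    note z = this
    \<comment> \<open>The fourth central difference of a cubic vanishes.\<close>
    have interpolate: "6 * f a b = 4 * (f (a + 1 * x) (b + 1 * y) + f (a + (-1) * x) (b + (-1) * y))
        - (f (a + 2 * x) (b + 2 * y) + f (a + (-2) * x) (b + (-2) * y))" for x y
      unfolding f_def by algebra
    show ?thesis using interpolate[of "d - a" "e - b"] z[of 1] z[of "-1"] z[of 2] z[of "-2"] by simp
  qed (use P in \<open>simp add: f_def\<close>)
  \<comment> \<open>A cubic in two variables is determined by its values at the ten lattice points
    with non-negative coordinates of sum at most 3.\<close>
  show "c00 = 0" "c10 = 0" "c01 = 0" "c20 = 0" "c11 = 0" "c02 = 0" "c30 = 0" "c21 = 0" "c12 = 0" "c03 = 0"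
    using f0[of 0 0] f0[of 1 0] f0[of 0 1] f0[of 2 0] f0[of 1 1] f0[of 0 2] f0[of 3 0] f0[of 2 1] f0[of 1 2] f0[of 0 3]
    unfolding f_def by simp_all
qed

section \<open>Curvature identities\<close>

text \<open>Indexing the coefficients by a type turns them into one vector, so that derivatives,
  linearity and comparison of systems are treated once for all fifteen.\<close>

datatype coeff = cA22 | cA23 | cA33 | cB2_22 | cB2_23 | cB2_33 | cB3_22 | cB3_23 | cB3_33
  | cC2_2 | cC2_3 | cC3_2 | cC3_3 | cD2 | cD3

text \<open>Here \<open>c\<close> stands for the values of the coefficients at a point, and \<open>d 0\<close>, \<open>d 1\<close>, \<open>d 2\<close> for those
  of their derivatives with respect to \<open>x\<close>, \<open>y\<close>, \<open>z\<close>.\<close>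

definition conditions ::
  "(coeff \<Rightarrow> real) \<Rightarrow> (nat \<Rightarrow> coeff \<Rightarrow> real) \<Rightarrow> real list" where
  "conditions c d =
     [1/2 * d 0 cC3_2 - d 1 cD3 + 1/4 * c cC3_3 * c cC3_2 + 1/4 * c cC2_2 * c cC3_2
        - c cD2 * c cB3_22 - c cD3 * c cB3_23,
      d 0 cB3_22 - 1/2 * d 1 cC3_2 - c cA22 * c cD3 + 1/2 * c cC3_2 * c cB2_22
        + 1/2 * c cC3_3 * c cB3_22 - 1/2 * c cC2_2 * c cB3_22 - 1/2 * c cB3_23 * c cC3_2,
      d 0 cB3_23 - 1/3 * d 0 cB2_22 + 1/6 * d 1 cC2_2 - 4/3 * c cD3 * c cA23
        - 2/3 * c cB3_22 * c cC2_3 + 2/3 * c cB2_23 * c cC3_2 - 1/2 * d 1 cC3_3,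
      1/2 * d 0 cC2_3 - d 2 cD2 + 1/4 * c cC2_3 * c cC3_3 + 1/4 * c cC2_3 * c cC2_2
        - c cB2_23 * c cD2 - c cB2_33 * c cD3,
      d 0 cB2_33 - 1/2 * d 2 cC2_3 - c cD2 * c cA33 + 1/2 * c cC2_3 * c cB3_33
        - 1/2 * c cB2_23 * c cC2_3 - 1/2 * c cB2_33 * c cC3_3 + 1/2 * c cB2_33 * c cC2_2,
      - d 1 cA23 + d 2 cA22 - c cA22 * c cB2_23 - c cA23 * c cB3_23 + c cA23 * c cB2_22
        + c cA33 * c cB3_22,
      - d 1 cA33 + d 2 cA23 - c cA22 * c cB2_33 - c cA23 * c cB3_33 + c cA23 * c cB2_23
        + c cA33 * c cB3_23,
      - d 0 cA23 + 5/6 * c cA23 * c cC2_2 + 1/3 * c cA33 * c cC3_2 - 1/3 * d 2 cB3_23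
        + c cB2_33 * c cB3_22 + 1/6 * c cC3_3 * c cA23 - c cB2_23 * c cB3_23 - 2/3 * d 1 cB2_23
        + 1/3 * d 1 cB3_33 + 2/3 * d 2 cB2_22 - 1/3 * c cC2_3 * c cA22,
      - d 0 cA33 + 1/2 * c cC2_2 * c cA33 + 1/2 * c cA33 * c cC3_3 - d 1 cB2_33 + d 2 cB2_23
        - c cB2_22 * c cB2_33 + c cB2_23 * c cB2_23 - c cB2_23 * c cB3_33 + c cB2_33 * c cB3_23,
      -2/3 * d 0 cB2_22 + 1/3 * d 1 cC2_2 - 1/2 * c cC3_2 * c cB3_33 + c cD2 * c cA22
        - 2/3 * c cD3 * c cA23 - 1/3 * c cC2_3 * c cB3_22 + 5/6 * c cB2_23 * c cC3_2 + d 0 cB3_23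
        - 1/2 * d 2 cC3_2 + 1/2 * c cC3_3 * c cB3_23 - 1/2 * c cC2_2 * c cB3_23,
      - d 0 cA22 + 1/2 * c cC2_2 * c cA22 - c cB3_22 * c cB3_33 + d 1 cB3_23 - d 2 cB3_22
        + c cB3_22 * c cB2_23 + c cB3_23 * c cB3_23 + 1/2 * c cC3_3 * c cA22
        - c cB3_23 * c cB2_22,
      d 1 cD2 + c cB2_22 * c cD2 + c cD3 * c cB2_23 - c cD3 * c cB3_33 + 1/2 * d 0 cC3_3
        - 1/2 * d 0 cC2_2 - d 2 cD3 + 1/4 * c cC3_3 * c cC3_3 - 1/4 * c cC2_2 * c cC2_2
        - c cB3_23 * c cD2,
      -2 * d 0 cA23 + 4/3 * d 1 cB3_33 + 1/3 * c cA23 * c cC2_2 + 5/3 * c cA23 * c cC3_3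
        + 2/3 * c cC2_3 * c cA22 - 4/3 * d 2 cB3_23 - 2/3 * c cC3_2 * c cA33
        + 2 * c cB3_22 * c cB2_33 - 2 * c cB3_23 * c cB2_23 - 2/3 * d 1 cB2_23
        + 2/3 * d 2 cB2_22,
      d 0 cB2_23 + 1/2 * d 1 cC2_3 - 2 * c cD2 * c cA23 + 1/2 * c cC2_3 * c cB3_23
        + 1/2 * c cC2_3 * c cB2_22 + 1/2 * c cC3_3 * c cB2_23 - 1/2 * c cB2_23 * c cC2_2
        - c cB2_33 * c cC3_2 - d 2 cC2_2 - c cD3 * c cA33,
      - d 0 cB2_23 + d 0 cB3_33 + d 1 cC2_3 - c cC2_3 * c cB3_23 + c cC2_3 * c cB2_22
        + c cB2_23 * c cC3_3 - c cB2_23 * c cC2_2 - 1/2 * d 2 cC3_3 - 1/2 * d 2 cC2_2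
        - 2 * c cD3 * c cA33]"

definition linearization_conditions ::
  "(coeff \<Rightarrow> real) \<Rightarrow> (nat \<Rightarrow> coeff \<Rightarrow> real) \<Rightarrow> bool" where
  "linearization_conditions c d \<longleftrightarrow> list_all (\<lambda>e. e = 0) (conditions c d)"

lemma linearization_conditions_nth:
  "linearization_conditions c d \<longleftrightarrow> (\<forall>n<15. conditions c d ! n = 0)"
proof -
  have "length (conditions c d) = 15" by (simp add: conditions_def)
  then show ?thesis by (simp add: linearization_conditions_def list_all_length)
qed

text \<open>The coefficients of the unparametrised geodesic system of a connection with Christoffel symbols
  \<open>G i j k\<close> (upper index first); \<open>0\<close>, \<open>1\<close>, \<open>2\<close> stand for \<open>x\<close>, \<open>y\<close>, \<open>z\<close>.\<close>

primrec coeff_of :: "(nat \<Rightarrow> nat \<Rightarrow> nat \<Rightarrow> real) \<Rightarrow> coeff \<Rightarrow> real" where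
  "coeff_of G cA22 = - G 0 1 1"
| "coeff_of G cA23 = - G 0 1 2"
| "coeff_of G cA33 = - G 0 2 2"
| "coeff_of G cB2_22 = G 1 1 1 - 2 * G 0 0 1"
| "coeff_of G cB2_23 = G 1 1 2 - G 0 0 2"
| "coeff_of G cB2_33 = G 1 2 2"
| "coeff_of G cB3_22 = G 2 1 1"
| "coeff_of G cB3_23 = G 2 1 2 - G 0 0 1"
| "coeff_of G cB3_33 = G 2 2 2 - 2 * G 0 0 2"
| "coeff_of G cC2_2 = 2 * G 1 0 1 - G 0 0 0"
| "coeff_of G cC2_3 = 2 * G 1 0 2"
| "coeff_of G cC3_2 = 2 * G 2 0 1"
| "coeff_of G cC3_3 = 2 * G 2 0 2 - G 0 0 0"
| "coeff_of G cD2 = G 1 0 0"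
| "coeff_of G cD3 = G 2 0 0"

text \<open>Thomas' representative: the trace-free connection with the given geodesic system.\<close>

definition thomas ::
  "(coeff \<Rightarrow> real) \<Rightarrow> nat \<Rightarrow> nat \<Rightarrow> nat \<Rightarrow> real" where
  "thomas c i j k =
    [[[- 1/4 * c cC2_2 - 1/4 * c cC3_3, - 1/4 * c cB2_22 - 1/4 * c cB3_23, - 1/4 * c cB2_23 - 1/4 * c cB3_33],
      [- 1/4 * c cB2_22 - 1/4 * c cB3_23, - c cA22, - c cA23],
      [- 1/4 * c cB2_23 - 1/4 * c cB3_33, - c cA23, - c cA33]],
     [[c cD2, 3/8 * c cC2_2 - 1/8 * c cC3_3, 1/2 * c cC2_3],
      [3/8 * c cC2_2 - 1/8 * c cC3_3, 1/2 * c cB2_22 - 1/2 * c cB3_23, 3/4 * c cB2_23 - 1/4 * c cB3_33],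
      [1/2 * c cC2_3, 3/4 * c cB2_23 - 1/4 * c cB3_33, c cB2_33]],
     [[c cD3, 1/2 * c cC3_2, - 1/8 * c cC2_2 + 3/8 * c cC3_3],
      [1/2 * c cC3_2, c cB3_22, - 1/4 * c cB2_22 + 3/4 * c cB3_23],
      [- 1/8 * c cC2_2 + 3/8 * c cC3_3, - 1/4 * c cB2_22 + 3/4 * c cB3_23, - 1/2 * c cB2_23 + 1/2 * c cB3_33]]] ! i ! j ! k"

text \<open>The component R^i_jkl, where the first index of \<open>dG\<close> is the direction of
  differentiation. Values and derivatives at a point are independent arguments, which makes the
  identities below polynomial algebra.\<close>

definition riem ::
  "(nat \<Rightarrow> nat \<Rightarrow> nat \<Rightarrow> real) \<Rightarrow> (nat \<Rightarrow> nat \<Rightarrow> nat \<Rightarrow> nat \<Rightarrow> real) \<Rightarrow> nat \<Rightarrow> nat \<Rightarrow> nat \<Rightarrow> nat \<Rightarrow> real" where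
  "riem G dG i j k l = dG k i l j - dG l i k j + (\<Sum>m<3. G i k m * G m l j - G i l m * G m k j)"

text \<open>The divisor is n - 1 for n = 3: contracting \<open>i\<close> with \<open>k\<close> in
  \<delta>^i_k P_jl - \<delta>^i_l P_jk gives 3 P_jl - P_jl.\<close>

definition schouten ::
  "(nat \<Rightarrow> nat \<Rightarrow> nat \<Rightarrow> real) \<Rightarrow> (nat \<Rightarrow> nat \<Rightarrow> nat \<Rightarrow> nat \<Rightarrow> real) \<Rightarrow> nat \<Rightarrow> nat \<Rightarrow> real" where
  "schouten G dG j l = (\<Sum>k<3. riem G dG k j k l) / 2"

lemma sum_lessThan_3: "(\<Sum>m<3. f m) = f 0 + f 1 + f (2::nat)" for f :: "nat \<Rightarrow> 'a::comm_monoid_add"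
  by (simp add: eval_nat_numeral)

lemma nat_less_3_cases: "i < 3 \<Longrightarrow> i = 0 \<or> i = 1 \<or> i = (2::nat)"
  by auto

lemma riem_antisym: "riem G dG i j l k = - riem G dG i j k l"
  by (simp add: riem_def sum_subtractf)

text \<open>The pulled-back connection is flat but in general not trace-free. Since
  \<open>coeff_of\<close> depends only on the projective class, each condition can be written
  through the full curvature of an arbitrary symmetric connection in that class.\<close>

lemma flat_imp_linearization_conditions:
  assumes G: "\<And>i j k. G i j k = G i k j" and dG: "\<And>l i j k. dG l i j k = dG l i k j"
    and flat: "\<And>i j k l. i < 3 \<Longrightarrow> j < 3 \<Longrightarrow> k < 3 \<Longrightarrow> l < 3 \<Longrightarrow> riem G dG i j k l = 0"
  shows "linearization_conditions (coeff_of G) (\<lambda>l. coeff_of (dG l))"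
proof -
  have sG: "G i 1 0 = G i 0 1" "G i 2 0 = G i 0 2" "G i 2 1 = G i 1 2"
    "dG l i 1 0 = dG l i 0 1" "dG l i 2 0 = dG l i 0 2" "dG l i 2 1 = dG l i 1 2" for i l
    by (rule G dG)+
  have nth_Cons_1: "(x # y # xs) ! 1 = y" for x y :: real and xs by simp
  let ?E = "\<lambda>n. conditions (coeff_of G) (\<lambda>l. coeff_of (dG l)) ! n"
  note defs = conditions_def riem_def sum_lessThan_3 nth_Cons_1 sG
  have "?E 0 = (1) * riem G dG 2 0 0 1"
    by (simp add: defs field_simps del: One_nat_def)
  then have E0: "?E 0 = 0" by (simp add: flat)
  have "?E 1 = (1) * riem G dG 2 1 0 1"
    by (simp add: defs field_simps del: One_nat_def)
  then have E1: "?E 1 = 0" by (simp add: flat)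
  have "?E 2 = (-1 / 3) * riem G dG 0 0 0 1 + (-1 / 3) * riem G dG 1 1 0 1 + (1) * riem G dG 2 1 0 2 + (-1) * riem G dG 2 0 1 2"
    by (simp add: defs field_simps del: One_nat_def)
  then have E2: "?E 2 = 0" by (simp add: flat)
  have "?E 3 = (1) * riem G dG 1 0 0 2"
    by (simp add: defs field_simps del: One_nat_def)
  then have E3: "?E 3 = 0" by (simp add: flat)
  have "?E 4 = (1) * riem G dG 1 2 0 2"
    by (simp add: defs field_simps del: One_nat_def)
  then have E4: "?E 4 = 0" by (simp add: flat)
  have "?E 5 = (1) * riem G dG 0 1 1 2"
    by (simp add: defs field_simps del: One_nat_def)
  then have E5: "?E 5 = 0" by (simp add: flat)
  have "?E 6 = (1) * riem G dG 0 2 1 2"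
    by (simp add: defs field_simps del: One_nat_def)
  then have E6: "?E 6 = 0" by (simp add: flat)
  have "?E 7 = (1) * riem G dG 0 1 0 2 + (-2 / 3) * riem G dG 1 1 1 2 + (1 / 3) * riem G dG 2 2 1 2"
    by (simp add: defs field_simps del: One_nat_def)
  then have E7: "?E 7 = 0" by (simp add: flat)
  have "?E 8 = (1) * riem G dG 0 2 0 2 + (-1) * riem G dG 1 2 1 2"
    by (simp add: defs field_simps del: One_nat_def)
  then have E8: "?E 8 = 0" by (simp add: flat)
  have "?E 9 = (1 / 3) * riem G dG 0 0 0 1 + (-2 / 3) * riem G dG 1 1 0 1 + (1) * riem G dG 2 1 0 2"
    by (simp add: defs field_simps del: One_nat_def)
  then have E9: "?E 9 = 0" by (simp add: flat)
  have "?E 10 = (1) * riem G dG 0 1 0 1 + (1) * riem G dG 2 1 1 2"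
    by (simp add: defs field_simps del: One_nat_def)
  then have E10: "?E 10 = 0" by (simp add: flat)
  have "?E 11 = (-1) * riem G dG 1 0 0 1 + (1) * riem G dG 2 0 0 2"
    by (simp add: defs field_simps del: One_nat_def)
  then have E11: "?E 11 = 0" by (simp add: flat)
  have "?E 12 = (2) * riem G dG 0 1 0 2 + (-2) * riem G dG 0 0 1 2 + (-2 / 3) * riem G dG 1 1 1 2 + (4 / 3) * riem G dG 2 2 1 2"
    by (simp add: defs field_simps del: One_nat_def)
  then have E12: "?E 12 = 0" by (simp add: flat)
  have "?E 13 = (-1) * riem G dG 0 0 0 2 + (1) * riem G dG 1 0 1 2 + (1) * riem G dG 1 1 0 2"
    by (simp add: defs field_simps del: One_nat_def)
  then have E13: "?E 13 = 0" by (simp add: flat)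
  have "?E 14 = (-1) * riem G dG 0 0 0 2 + (2) * riem G dG 1 0 1 2 + (-1) * riem G dG 1 1 0 2 + (1) * riem G dG 2 2 0 2"
    by (simp add: defs field_simps del: One_nat_def)
  then have E14: "?E 14 = 0" by (simp add: flat)
  show ?thesis
    unfolding linearization_conditions_nth
    using E0 E1 E2 E3 E4 E5 E6 E7 E8 E9 E10 E11 E12 E13 E14
    by (simp add: eval_nat_numeral All_less_Suc)
qed

lemma thomas_sym: "i < 3 \<Longrightarrow> j < 3 \<Longrightarrow> k < 3 \<Longrightarrow> thomas c i j k = thomas c i k j"
  by (auto dest!: nat_less_3_cases simp: thomas_def)

lemma coeff_of_thomas: "coeff_of (thomas c) x = c x"
  by (cases x) (simp_all add: thomas_def field_simps)

text \<open>For a trace-free symmetric connection the Ricci tensor is symmetric, so \<open>W\<close>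
  below is the projective Weyl tensor. Antisymmetry in \<open>k\<close>, \<open>l\<close> leaves 27
  components to check, each an explicit combination of the fifteen conditions.\<close>

lemma linearization_conditions_imp_weyl:
  assumes "linearization_conditions c d" "i < 3" "j < 3" "k < 3" "l < 3"
  defines "G \<equiv> thomas c" and "dG \<equiv> \<lambda>l. thomas (d l)"
  shows "riem G dG i j k l = (if i = k then schouten G dG j l else 0) - (if i = l then schouten G dG j k else 0)"
proof -
  have C: "conditions c d ! n = 0" if "n < 15" for n
    using assms(1) that by (simp add: linearization_conditions_nth)
  define W where "W = (\<lambda>i j k l. riem G dG i j k l - ((if i = k then schouten G dG j l else 0) - (if i = l then schouten G dG j k else 0)))"
  note defs = conditions_def W_def schouten_def riem_def sum_lessThan_3 G_def dG_def thomas_def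

  have "W 0 0 0 1 = (-5 / 8) * conditions c d ! 2 + (1 / 2) * conditions c d ! 9"
    by (simp add: defs field_simps)
  then have W0001: "W 0 0 0 1 = 0" by (simp add: C)
  have "W 0 0 0 2 = (-1 / 4) * conditions c d ! 13 + (-1 / 8) * conditions c d ! 14"
    by (simp add: defs field_simps)
  then have W0002: "W 0 0 0 2 = 0" by (simp add: C)
  have "W 0 0 1 2 = (3 / 4) * conditions c d ! 7 + (-3 / 8) * conditions c d ! 12"
    by (simp add: defs field_simps)
  then have W0012: "W 0 0 1 2 = 0" by (simp add: C)
  have "W 0 1 0 1 = (1 / 2) * conditions c d ! 10"
    by (simp add: defs field_simps)
  then have W0101: "W 0 1 0 1 = 0" by (simp add: C)
  have "W 0 1 0 2 = (5 / 8) * conditions c d ! 7 + (-1 / 16) * conditions c d ! 12"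
    by (simp add: defs field_simps)
  then have W0102: "W 0 1 0 2 = 0" by (simp add: C)
  have "W 0 1 1 2 = (1) * conditions c d ! 5"
    by (simp add: defs field_simps)
  then have W0112: "W 0 1 1 2 = 0" by (simp add: C)
  have "W 0 2 0 1 = (-1 / 8) * conditions c d ! 7 + (5 / 16) * conditions c d ! 12"
    by (simp add: defs field_simps)
  then have W0201: "W 0 2 0 1 = 0" by (simp add: C)
  have "W 0 2 0 2 = (1 / 2) * conditions c d ! 8"
    by (simp add: defs field_simps)
  then have W0202: "W 0 2 0 2 = 0" by (simp add: C)
  have "W 0 2 1 2 = (1) * conditions c d ! 6"
    by (simp add: defs field_simps)
  then have W0212: "W 0 2 1 2 = 0" by (simp add: C)
  have "W 1 0 0 1 = (-1 / 2) * conditions c d ! 11"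
    by (simp add: defs field_simps)
  then have W1001: "W 1 0 0 1 = 0" by (simp add: C)
  have "W 1 0 0 2 = (1) * conditions c d ! 3"
    by (simp add: defs field_simps)
  then have W1002: "W 1 0 0 2 = 0" by (simp add: C)
  have "W 1 0 1 2 = (1 / 4) * conditions c d ! 13 + (1 / 8) * conditions c d ! 14"
    by (simp add: defs field_simps)
  then have W1012: "W 1 0 1 2 = 0" by (simp add: C)
  have "W 1 1 0 1 = (-1 / 8) * conditions c d ! 2 + (-1 / 2) * conditions c d ! 9"
    by (simp add: defs field_simps)
  then have W1101: "W 1 1 0 1 = 0" by (simp add: C)
  have "W 1 1 0 2 = (1 / 2) * conditions c d ! 13 + (-1 / 4) * conditions c d ! 14"
    by (simp add: defs field_simps)
  then have W1102: "W 1 1 0 2 = 0" by (simp add: C)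
  have "W 1 1 1 2 = (-5 / 8) * conditions c d ! 7 + (1 / 16) * conditions c d ! 12"
    by (simp add: defs field_simps)
  then have W1112: "W 1 1 1 2 = 0" by (simp add: C)
  have "W 1 2 0 1 = (1 / 4) * conditions c d ! 13 + (-3 / 8) * conditions c d ! 14"
    by (simp add: defs field_simps)
  then have W1201: "W 1 2 0 1 = 0" by (simp add: C)
  have "W 1 2 0 2 = (1) * conditions c d ! 4"
    by (simp add: defs field_simps)
  then have W1202: "W 1 2 0 2 = 0" by (simp add: C)
  have "W 1 2 1 2 = (-1 / 2) * conditions c d ! 8"
    by (simp add: defs field_simps)
  then have W1212: "W 1 2 1 2 = 0" by (simp add: C)
  have "W 2 0 0 1 = (1) * conditions c d ! 0"
    by (simp add: defs field_simps)
  then have W2001: "W 2 0 0 1 = 0" by (simp add: C)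
  have "W 2 0 0 2 = (1 / 2) * conditions c d ! 11"
    by (simp add: defs field_simps)
  then have W2002: "W 2 0 0 2 = 0" by (simp add: C)
  have "W 2 0 1 2 = (-5 / 8) * conditions c d ! 2 + (1 / 2) * conditions c d ! 9"
    by (simp add: defs field_simps)
  then have W2012: "W 2 0 1 2 = 0" by (simp add: C)
  have "W 2 1 0 1 = (1) * conditions c d ! 1"
    by (simp add: defs field_simps)
  then have W2101: "W 2 1 0 1 = 0" by (simp add: C)
  have "W 2 1 0 2 = (1 / 8) * conditions c d ! 2 + (1 / 2) * conditions c d ! 9"
    by (simp add: defs field_simps)
  then have W2102: "W 2 1 0 2 = 0" by (simp add: C)
  have "W 2 1 1 2 = (1 / 2) * conditions c d ! 10"
    by (simp add: defs field_simps)
  then have W2112: "W 2 1 1 2 = 0" by (simp add: C)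
  have "W 2 2 0 1 = (3 / 4) * conditions c d ! 2"
    by (simp add: defs field_simps)
  then have W2201: "W 2 2 0 1 = 0" by (simp add: C)
  have "W 2 2 0 2 = (-1 / 4) * conditions c d ! 13 + (3 / 8) * conditions c d ! 14"
    by (simp add: defs field_simps)
  then have W2202: "W 2 2 0 2 = 0" by (simp add: C)
  have "W 2 2 1 2 = (-1 / 8) * conditions c d ! 7 + (5 / 16) * conditions c d ! 12"
    by (simp add: defs field_simps)
  then have W2212: "W 2 2 1 2 = 0" by (simp add: C)
  have "W i j k l = - W i j l k" for i j k l
    unfolding W_def by (subst riem_antisym) simp
  then have diag: "W i j k k = 0" and swap: "W i j k l = 0 \<Longrightarrow> W i j l k = 0" for i j k l
    by (metis add.inverse_neutral equal_neg_zero)+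
  have "W i j k l = 0"
    using nat_less_3_cases[OF assms(2)] nat_less_3_cases[OF assms(3)] nat_less_3_cases[OF assms(4)] nat_less_3_cases[OF assms(5)]
    by (elim disjE; simp only:) (rule diag W0001 swap[OF W0001] W0002 swap[OF W0002] W0012
      swap[OF W0012] W0101 swap[OF W0101] W0102 swap[OF W0102] W0112 swap[OF W0112] W0201
      swap[OF W0201] W0202 swap[OF W0202] W0212 swap[OF W0212] W1001 swap[OF W1001] W1002
      swap[OF W1002] W1012 swap[OF W1012] W1101 swap[OF W1101] W1102 swap[OF W1102] W1112
      swap[OF W1112] W1201 swap[OF W1201] W1202 swap[OF W1202] W1212 swap[OF W1212] W2001
      swap[OF W2001] W2002 swap[OF W2002] W2012 swap[OF W2012] W2101 swap[OF W2101] W2102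
      swap[OF W2102] W2112 swap[OF W2112] W2201 swap[OF W2201] W2202 swap[OF W2202] W2212
      swap[OF W2212])+
  then show ?thesis by (simp add: W_def)
qed

text \<open>The skew part of the Ricci tensor of a symmetric connection is, up to a factor, the curl
  of the trace of the connection, which vanishes for Thomas' representative.\<close>

lemma schouten_thomas_sym:
  assumes "j < 3" "l < 3"
  shows "schouten (thomas c) (\<lambda>l. thomas (d l)) j l = schouten (thomas c) (\<lambda>l. thomas (d l)) l j"
proof -
  have "schouten (thomas c) (\<lambda>l. thomas (d l)) 0 1 = schouten (thomas c) (\<lambda>l. thomas (d l)) 1 0"
    "schouten (thomas c) (\<lambda>l. thomas (d l)) 0 2 = schouten (thomas c) (\<lambda>l. thomas (d l)) 2 0"
    "schouten (thomas c) (\<lambda>l. thomas (d l)) 1 2 = schouten (thomas c) (\<lambda>l. thomas (d l)) 2 1"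
    by (simp_all add: schouten_def riem_def sum_lessThan_3 thomas_def field_simps)
  then show ?thesis using nat_less_3_cases[OF assms(1)] nat_less_3_cases[OF assms(2)] by (elim disjE) simp_all
qed

section \<open>The second Bianchi identity and the Cotton tensor\<close>

definition driem where
  "driem G dG ddG n i j k l = ddG n k i l j - ddG n l i k j
    + (\<Sum>m<3. dG n i k m * G m l j + G i k m * dG n m l j - (dG n i l m * G m k j + G i l m * dG n m k j :: real))"

text \<open>With the connection read as matrices A_n, \<open>B n k l\<close> is the derivative of
  R_kl in direction \<open>n\<close> plus the commutator of A_n with R_kl: the covariant derivative
  of an endomorphism-valued two-form, without connection terms for \<open>k\<close> and
  \<open>l\<close>. Its cyclic sum vanishes because second derivatives commute and by the Jacobi
  identity.\<close>

lemma second_bianchi: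
  fixes G :: "nat \<Rightarrow> nat \<Rightarrow> nat \<Rightarrow> real" and dG ddG i j
  assumes "\<And>m l i j k. ddG m l i j k = ddG l m i j k"
  defines "B \<equiv> \<lambda>n k l. driem G dG ddG n i j k l + (\<Sum>m<3. G i n m * riem G dG m j k l - G m n j * riem G dG i m k l)"
  shows "B n k l + B k l n + B l n k = 0"
proof -
  have "ddG k n = ddG n k" "ddG l n = ddG n l" "ddG l k = ddG k l" using assms(1) by (auto simp: fun_eq_iff)
  then show ?thesis
    unfolding B_def driem_def riem_def sum_lessThan_3 by (simp add: algebra_simps)
qed

text \<open>The conclusion is the Bianchi identity whose upper index \<open>n\<close> is distinct from \<open>k\<close> and \<open>l\<close>; only in
  dimension three does it isolate a single Cotton component.\<close>

lemma cotton_vanishes: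
  fixes G :: "nat \<Rightarrow> nat \<Rightarrow> nat \<Rightarrow> real" and P :: "nat \<Rightarrow> nat \<Rightarrow> real"
  assumes G: "\<And>i j k. i < 3 \<Longrightarrow> j < 3 \<Longrightarrow> k < 3 \<Longrightarrow> G i j k = G i k j"
    and ddG: "\<And>m l i j k. ddG m l i j k = ddG l m i j k"
    and W: "\<And>i j k l. i < 3 \<Longrightarrow> j < 3 \<Longrightarrow> k < 3 \<Longrightarrow> l < 3 \<Longrightarrow>
      riem G dG i j k l = (if i = k then P j l else 0) - (if i = l then P j k else 0)"
    and dW: "\<And>n i j k l. n < 3 \<Longrightarrow> i < 3 \<Longrightarrow> j < 3 \<Longrightarrow> k < 3 \<Longrightarrow> l < 3 \<Longrightarrow>
      driem G dG ddG n i j k l = (if i = k then dP n j l else 0) - (if i = l then dP n j k else 0)"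
    and "j < 3" "k < 3" "l < 3"
  shows "dP k j l - dP l j k + (\<Sum>m<3. G m l j * P m k - G m k j * P m l) = 0"
proof -
  define E where "E = (\<lambda>k l. dP k j l - dP l j k + (\<Sum>m<3. G m l j * P m k - G m k j * P m l))"
  have E: "E k l = 0" if "n < 3" "k < 3" "l < 3" "n \<noteq> k" "n \<noteq> l" "k \<noteq> l" for n k l
  proof -
    have sumW: "(\<Sum>m<3. f m * riem G dG m j k l) = f k * P j l - f l * P j k"
      if "k < 3" "l < 3" for f k l
    proof -
      have "(\<Sum>m<3. f m * riem G dG m j k l) = (\<Sum>m<3. (if m = k then f m * P j l else 0) - (if m = l then f m * P j k else 0))"
        by (rule sum.cong) (use W \<open>j < 3\<close> that in auto)
      then show ?thesis using that by (simp add: sum_subtractf)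
    qed
    have sumW': "(\<Sum>m<3. f m * riem G dG n m a b) = (\<Sum>m<3. f m * ((if n = a then P m b else 0) - (if n = b then P m a else 0)))"
      if "a < 3" "b < 3" for f a b
      by (rule sum.cong) (use W \<open>n < 3\<close> that in auto)
    have s: "G n n k = G n k n" "G n n l = G n l n" "G n l k = G n k l" using G that by auto
    show ?thesis
      using second_bianchi[where ddG = ddG and G = G and dG = dG and i = n and j = j and n = n and k = k and l = l, OF ddG] that \<open>j < 3\<close>
      by (simp add: sum_subtractf sum_negf sumW sumW' dW E_def s algebra_simps)
  qed
  have "E k l = - E l k" for k l by (simp add: E_def sum_subtractf)
  then have "E k k = 0" for k by (metis equal_neg_zero)
  moreover have "\<exists>n<3. n \<noteq> k \<and> n \<noteq> l" using \<open>k < 3\<close> \<open>l < 3\<close> by presburger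
  ultimately have "E k l = 0" using E \<open>k < 3\<close> \<open>l < 3\<close> by blast
  then show ?thesis by (simp add: E_def)
qed

section \<open>Necessity\<close>

definition frame :: "nat \<Rightarrow> point" where
  "frame i = (of_bool (i = 0), of_bool (i = 1), of_bool (i = 2))"

lemma frame_simps [simp]: "frame 0 = (1, 0, 0)" "frame (Suc 0) = (0, 1, 0)" "frame 1 = (0, 1, 0)" "frame 2 = (0, 0, 1)"
  by (simp_all add: frame_def)

lemma frame_expand: "v = (\<Sum>m<3. (v \<bullet> frame m) *\<^sub>R frame m)"
  by (cases v) (simp add: sum_lessThan_3)

lemma partial_derivatives:
  assumes "(f has_derivative f') (at p)"
  shows "pdx f p = f' (frame 0)" "pdy f p = f' (frame 1)" "pdz f p = f' (frame 2)"
proof -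
  obtain x y z where p: "p = (x, y, z)" by (metis prod.collapse)
  have *: "((\<lambda>t. f (g t)) has_real_derivative f' v) (at s)"
    if "(g has_derivative (\<lambda>t. t *\<^sub>R v)) (at s)" "g s = p" for g s v
  proof -
    have "((\<lambda>t. f (g t)) has_derivative (\<lambda>t. f' (t *\<^sub>R v))) (at s)"
      using has_derivative_compose[OF that(1)] assms that(2) by simp
    moreover have "f' (t *\<^sub>R v) = f' v * t" for t
      using linear_cmul[OF has_derivative_linear[OF assms]] by simp
    ultimately show ?thesis by (simp add: has_field_derivative_def)
  qed
  have "((\<lambda>t. (t, y, z)) has_derivative (\<lambda>t. t *\<^sub>R frame 0)) (at x)"
    "((\<lambda>t. (x, t, z)) has_derivative (\<lambda>t. t *\<^sub>R frame 1)) (at y)"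
    "((\<lambda>t. (x, y, t)) has_derivative (\<lambda>t. t *\<^sub>R frame 2)) (at z)"
    by (auto intro!: derivative_eq_intros simp: zero_prod_def)
  from this[THEN *] show "pdx f p = f' (frame 0)" "pdy f p = f' (frame 1)" "pdz f p = f' (frame 2)"
    by (auto simp: pdx_def pdy_def pdz_def p intro!: DERIV_imp_deriv simp del: frame_simps)
qed

definition cubic_F ::
  "(coeff \<Rightarrow> real) \<Rightarrow> real \<Rightarrow> real \<Rightarrow> real" where
  "cubic_F c a b = c cA22 * a ^ 3 + 2 * c cA23 * a ^ 2 * b + c cA33 * a * b ^ 2
     + c cB2_22 * a ^ 2 + 2 * c cB2_23 * a * b + c cB2_33 * b ^ 2 + c cC2_2 * a + c cC2_3 * b + c cD2"

definition cubic_G ::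
  "(coeff \<Rightarrow> real) \<Rightarrow> real \<Rightarrow> real \<Rightarrow> real" where
  "cubic_G c a b = c cA22 * a ^ 2 * b + 2 * c cA23 * a * b ^ 2 + c cA33 * b ^ 3
     + c cB3_22 * a ^ 2 + 2 * c cB3_23 * a * b + c cB3_33 * b ^ 2 + c cC3_2 * a + c cC3_3 * b + c cD3"

lemma geodesic_system_cubic:
  assumes "\<And>i. i < 3 \<Longrightarrow> Q q (1, a, b) \<bullet> frame i
    = G i 0 0 + 2 * a * G i 0 1 + 2 * b * G i 0 2 + a^2 * G i 1 1 + 2 * a * b * G i 1 2 + b^2 * G i 2 2"
  shows "geodesic_F Q q a b = cubic_F (coeff_of G) a b" "geodesic_G Q q a b = cubic_G (coeff_of G) a b"
proof -
  obtain x y z where Q: "Q q (1, a, b) = (x, y, z)" by (metis prod.collapse)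
  have x: "x = G 0 0 0 + 2 * a * G 0 0 1 + 2 * b * G 0 0 2 + a^2 * G 0 1 1 + 2 * a * b * G 0 1 2 + b^2 * G 0 2 2"
    using assms[of 0] by (simp add: Q)
  have y: "y = G 1 0 0 + 2 * a * G 1 0 1 + 2 * b * G 1 0 2 + a^2 * G 1 1 1 + 2 * a * b * G 1 1 2 + b^2 * G 1 2 2"
    using assms[of 1] by (simp add: Q)
  have z: "z = G 2 0 0 + 2 * a * G 2 0 1 + 2 * b * G 2 0 2 + a^2 * G 2 1 1 + 2 * a * b * G 2 1 2 + b^2 * G 2 2 2"
    using assms[of 2] by (simp add: Q)
  show "geodesic_F Q q a b = cubic_F (coeff_of G) a b" "geodesic_G Q q a b = cubic_G (coeff_of G) a b"
    unfolding geodesic_F_def geodesic_G_def cubic_F_def cubic_G_def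
    by (simp_all add: Q x y z algebra_simps power2_eq_square power3_eq_cube)
qed

lemma cubic_system_unique:
  assumes L: "l0 \<noteq> 0 \<or> l1 \<noteq> 0 \<or> l2 \<noteq> (0::real)"
    and eq: "\<And>a b. l0 + a * l1 + b * l2 \<noteq> 0 \<Longrightarrow> cubic_F c a b = cubic_F c' a b \<and> cubic_G c a b = cubic_G c' a b"
  shows "c = c'"
proof -
  have "(c cD2 - c' cD2) + (c cC2_2 - c' cC2_2) * a + (c cC2_3 - c' cC2_3) * b
     + (c cB2_22 - c' cB2_22) * a^2 + (2 * (c cB2_23 - c' cB2_23)) * (a * b) + (c cB2_33 - c' cB2_33) * b^2
     + (c cA22 - c' cA22) * a^3 + (2 * (c cA23 - c' cA23)) * (a^2 * b) + (c cA33 - c' cA33) * (a * b^2) + 0 * b^3 = 0"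
    if "l0 + a * l1 + b * l2 \<noteq> 0" for a b
    using eq[OF that] by (simp add: cubic_F_def algebra_simps)
  note F = cubic_vanishing_off_line[OF L this]
  have "(c cD3 - c' cD3) + (c cC3_2 - c' cC3_2) * a + (c cC3_3 - c' cC3_3) * b
     + (c cB3_22 - c' cB3_22) * a^2 + (2 * (c cB3_23 - c' cB3_23)) * (a * b) + (c cB3_33 - c' cB3_33) * b^2
     + 0 * a^3 + (c cA22 - c' cA22) * (a^2 * b) + (2 * (c cA23 - c' cA23)) * (a * b^2) + (c cA33 - c' cA33) * b^3 = 0"
    if "l0 + a * l1 + b * l2 \<noteq> 0" for a b
    using eq[OF that] by (simp add: cubic_G_def algebra_simps)
  note G = cubic_vanishing_off_line[OF L this]
  show ?thesis
  proof
    show "c x = c' x" for x using F G by (cases x) simp_all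
  qed
qed

lemma coeff_of_has_derivative:
  assumes "\<And>i j k. ((\<lambda>q. G q i j k) has_derivative (\<lambda>h. G' h i j k)) (at p)"
  shows "((\<lambda>q. coeff_of (G q) x) has_derivative (\<lambda>h. coeff_of (G' h) x)) (at p)"
  by (cases x) (auto intro!: derivative_eq_intros assms)

text \<open>\<open>\<phi>\<close> takes both the given system and the geodesic system of the
  pulled-back connection to free particles, so they agree at all transversal slopes and, being
  cubic, in all coefficients. The conditions then follow from flatness at \<open>p\<close>.\<close>

theorem linearizable_imp_linearization_conditions:
  assumes lin: "linearizable U (\<lambda>p. cubic_F (\<lambda>x. K x p)) (\<lambda>p. cubic_G (\<lambda>x. K x p))" and p: "p \<in> U"
  shows "linearization_conditions (\<lambda>x. K x p) (\<lambda>l x. frechet_derivative (K x) (at p) (frame l))"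
proof -
  obtain V \<phi> where pV: "p \<in> V" and pt: "point_transformation V \<phi>"
    and ms: "maps_system V \<phi> (\<lambda>p. cubic_F (\<lambda>x. K x p)) (\<lambda>p. cubic_G (\<lambda>x. K x p)) (\<lambda>_ _ _. 0) (\<lambda>_ _ _. 0)"
    using lin p unfolding linearizable_def by blast
  have V: "open V" "smooth_on V \<phi>" using pt by (auto simp: point_transformation_def)
  obtain \<Gamma> where \<Gamma>:
    "\<And>q h k. q \<in> V \<Longrightarrow> frechet_derivative (\<lambda>q. frechet_derivative \<phi> (at q) h) (at q) k = frechet_derivative \<phi> (at q) (\<Gamma> q h k)"
    "\<And>q h. q \<in> V \<Longrightarrow> linear (\<Gamma> q h)" "\<And>q h k. q \<in> V \<Longrightarrow> \<Gamma> q h k = \<Gamma> q k h"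
    "\<And>h k. smooth_on V (\<lambda>q. \<Gamma> q h k)"
    "\<And>q h k m. q \<in> V \<Longrightarrow> frechet_derivative (\<lambda>q. \<Gamma> q h k) (at q) m + \<Gamma> q (\<Gamma> q h k) m
        = frechet_derivative (\<lambda>q. \<Gamma> q h m) (at q) k + \<Gamma> q (\<Gamma> q h m) k"
    "\<And>q h. q \<in> V \<Longrightarrow> frechet_derivative \<phi> (at q) h = 0 \<Longrightarrow> h = 0"
    "\<And>q. q \<in> V \<Longrightarrow> surj (frechet_derivative \<phi> (at q))"
    using pullback_flat_connection[OF pt] by blast
  define G where "G = (\<lambda>q i j k. \<Gamma> q (frame j) (frame k) \<bullet> frame i)"
  define dG where "dG = (\<lambda>h i j k. frechet_derivative (\<lambda>q. \<Gamma> q (frame j) (frame k)) (at p) h \<bullet> frame i)"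
  have expand: "\<Gamma> q v h = (\<Sum>m<3. (v \<bullet> frame m) *\<^sub>R \<Gamma> q (frame m) h)" if "q \<in> V" for q v h
  proof -
    have "\<Gamma> q v h = \<Gamma> q h (\<Sum>m<3. (v \<bullet> frame m) *\<^sub>R frame m)"
      using \<Gamma>(3)[OF that] frame_expand[of v] by metis
    also have "\<dots> = (\<Sum>m<3. (v \<bullet> frame m) *\<^sub>R \<Gamma> q h (frame m))"
      by (simp add: linear_sum[OF \<Gamma>(2)[OF that]] linear_cmul[OF \<Gamma>(2)[OF that]])
    finally show ?thesis using \<Gamma>(3)[OF that] by simp
  qed
  have K: "(\<lambda>x. K x q) = coeff_of (G q)" if q: "q \<in> V" for q
  proof (rule cubic_system_unique)
    let ?L = "frechet_derivative \<phi> (at q)"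
    have L: "?L (1, a, b) = ?L (frame 0) + a *\<^sub>R ?L (frame 1) + b *\<^sub>R ?L (frame 2)"
      "?L v = (\<Sum>m<3. (v \<bullet> frame m) *\<^sub>R ?L (frame m))" for a b v
    proof -
      show "?L v = (\<Sum>m<3. (v \<bullet> frame m) *\<^sub>R ?L (frame m))" for v
        by (rule trans[OF arg_cong[OF frame_expand, of ?L]])
          (simp only: linear_sum[OF linear_frechet_derivative[OF V(2) q]] linear_cmul[OF linear_frechet_derivative[OF V(2) q]])
      from this[of "(1, a, b)"] show "?L (1, a, b) = ?L (frame 0) + a *\<^sub>R ?L (frame 1) + b *\<^sub>R ?L (frame 2)"
        by (simp add: sum_lessThan_3)
    qed
    \<comment> \<open>By surjectivity the differential of \<open>u\<close> is non-zero, so the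
      slopes that are not transversal lie on at most one line.\<close>
    obtain v where "?L v = (1, 0, 0)" using \<Gamma>(7)[OF q] by (metis surjD)
    then have "fst (\<Sum>m<3. (v \<bullet> frame m) *\<^sub>R ?L (frame m)) = 1" using L(2)[of v] by simp
    then show "fst (?L (frame 0)) \<noteq> 0 \<or> fst (?L (frame 1)) \<noteq> 0 \<or> fst (?L (frame 2)) \<noteq> 0"
      unfolding sum_lessThan_3 by (auto simp del: frame_simps)
    fix a b assume ne: "fst (?L (frame 0)) + a * fst (?L (frame 1)) + b * fst (?L (frame 2)) \<noteq> 0"
    define Q where "Q = (\<lambda>q h. \<Gamma> q h h)"
    \<comment> \<open>Here \<open>\<theta>\<close> is 0: \<open>\<Gamma>\<close> is the exact
      pullback, so affine parameters are preserved as well.\<close>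
    have ms': "maps_system V \<phi> (geodesic_F Q) (geodesic_G Q) (\<lambda>_ _ _. 0) (\<lambda>_ _ _. 0)"
      by (rule maps_geodesic_system[OF V, where \<theta> = "\<lambda>_ _. 0"]) (use \<Gamma>(1,6) in \<open>simp_all add: Q_def\<close>)
    have Qc: "Q q (1, a, b) \<bullet> frame i = G q i 0 0 + 2 * a * G q i 0 1 + 2 * b * G q i 0 2
        + a^2 * G q i 1 1 + 2 * a * b * G q i 1 2 + b^2 * G q i 2 2" for i
    proof -
      let ?v = "(1, a, b) :: point"
      have "Q q ?v = (\<Sum>m<3. (?v \<bullet> frame m) *\<^sub>R \<Gamma> q ?v (frame m))"
        unfolding Q_def by (subst expand[OF q]) (simp only: \<Gamma>(3)[OF q, of ?v])
      also have "\<dots> = (\<Sum>m<3. (?v \<bullet> frame m) *\<^sub>R (\<Sum>n<3. (?v \<bullet> frame n) *\<^sub>R \<Gamma> q (frame n) (frame m)))"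
        by (intro sum.cong refl arg_cong[where f = "scaleR _"] expand[OF q])
      finally have "Q q ?v = (\<Sum>m<3. (?v \<bullet> frame m) *\<^sub>R (\<Sum>n<3. (?v \<bullet> frame n) *\<^sub>R \<Gamma> q (frame n) (frame m)))" .
      then have "Q q ?v \<bullet> frame i = (\<Sum>m<3. (?v \<bullet> frame m) * (\<Sum>n<3. (?v \<bullet> frame n) * G q i n m))"
        by (simp add: inner_sum_left G_def)
      moreover have "G q i j k = G q i k j" for j k unfolding G_def using \<Gamma>(3)[OF q] by metis
      note s = this[of 1 0] this[of 2 0] this[of 2 1]
      ultimately show ?thesis
        unfolding sum_lessThan_3 s by (simp add: s power2_eq_square algebra_simps)
    qed
    have d: "fst (?L (1, a, b)) \<noteq> 0" using ne unfolding L(1) by simp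
    show "cubic_F (\<lambda>x. K x q) a b = cubic_F (coeff_of (G q)) a b \<and> cubic_G (\<lambda>x. K x q) a b = cubic_G (coeff_of (G q)) a b"
      using maps_system_unique[OF pt q ms ms' d] geodesic_system_cubic[where Q = Q and G = "G q", OF Qc] by simp
  qed
  \<comment> \<open>The coefficients agree on all of \<open>V\<close> and not merely at
    \<open>p\<close>, hence so do their first derivatives.\<close>
  have dK: "(\<lambda>x. frechet_derivative (K x) (at p) h) = coeff_of (dG h)" for h
  proof
    fix x
    have "((\<lambda>q. coeff_of (G q) x) has_derivative (\<lambda>h. coeff_of (dG h) x)) (at p)"
      unfolding G_def dG_def
      by (intro coeff_of_has_derivative bounded_linear.has_derivative[OF bounded_linear_inner_left]
          smooth_on_has_derivative[OF \<Gamma>(4) pV])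
    then have "(K x has_derivative (\<lambda>h. coeff_of (dG h) x)) (at p)"
      by (rule has_derivative_transform_within_open[OF _ V(1) pV]) (metis K)
    from fun_cong[OF frechet_derivative_at[OF this], of h]
    show "frechet_derivative (K x) (at p) h = coeff_of (dG h) x" by simp
  qed
  have "linearization_conditions (coeff_of (G p)) (\<lambda>l. coeff_of (dG (frame l)))"
  proof (rule flat_imp_linearization_conditions)
    show symG: "G p i j k = G p i k j" for i j k unfolding G_def using \<Gamma>(3)[OF pV] by metis
    have "frechet_derivative (\<lambda>q. \<Gamma> q (frame j) (frame k)) (at p) = frechet_derivative (\<lambda>q. \<Gamma> q (frame k) (frame j)) (at p)" for j k
    proof (rule frechet_derivative_at, rule has_derivative_transform_within_open[OF _ V(1) pV])
      show "((\<lambda>q. \<Gamma> q (frame j) (frame k)) has_derivative frechet_derivative (\<lambda>q. \<Gamma> q (frame j) (frame k)) (at p)) (at p)"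
        by (rule smooth_on_has_derivative[OF \<Gamma>(4) pV])
    qed (rule \<Gamma>(3))
    then show symd: "dG (frame l) i j k = dG (frame l) i k j" for l i j k unfolding dG_def by metis
    show "riem (G p) (\<lambda>l. dG (frame l)) i j k l = 0" for i j k l
    proof -
      have "(frechet_derivative (\<lambda>q. \<Gamma> q (frame j) (frame l)) (at p) (frame k) + \<Gamma> p (\<Gamma> p (frame j) (frame l)) (frame k)) \<bullet> frame i
        = (frechet_derivative (\<lambda>q. \<Gamma> q (frame j) (frame k)) (at p) (frame l) + \<Gamma> p (\<Gamma> p (frame j) (frame k)) (frame l)) \<bullet> frame i"
        using \<Gamma>(5)[OF pV] by metis
      then have "dG (frame k) i j l + (\<Sum>m<3. G p m j l * G p i m k) = dG (frame l) i j k + (\<Sum>m<3. G p m j k * G p i m l)"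
        unfolding expand[OF pV, of "\<Gamma> p u v" for u v] by (simp only: inner_add_left inner_sum_left inner_scaleR_left G_def dG_def)
      moreover have "G p i m k * G p m l j - G p i l m * G p m k j = G p m j l * G p i m k - G p m j k * G p i m l"
        for m using symG[of i m k] symG[of m l j] symG[of i l m] symG[of m k j] symG[of i k m] by (simp add: mult.commute)
      moreover have "G p i k m = G p i m k" for m by (rule symG)
      ultimately show ?thesis
        unfolding riem_def by (simp add: sum_subtractf symd[of _ i l j] symd[of _ i k j])
    qed
  qed
  then show ?thesis by (simp add: K[OF pV] dK)
qed

section \<open>Sufficiency\<close>

lemma UNIV_coeff:
  "UNIV = {cA22, cA23, cA33, cB2_22, cB2_23, cB2_33, cB3_22, cB3_23, cB3_33, cC2_2, cC2_3, cC3_2, cC3_3, cD2, cD3}"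
  (is "_ = ?S")
proof (rule UNIV_eq_I)
  show "x \<in> ?S" for x by (cases x) simp_all
qed

text \<open>Linearity with constant coefficients makes \<open>thomas\<close> commute with
  differentiation: applied to derivatives of the coefficients, it yields derivatives of the
  connection.\<close>

lemma thomas_linear:
  assumes "i < 3" "j < 3" "k < 3"
  shows "thomas c i j k = (\<Sum>x\<in>UNIV. thomas (\<lambda>y. of_bool (y = x)) i j k * c x)"
  using nat_less_3_cases[OF assms(1)] nat_less_3_cases[OF assms(2)] nat_less_3_cases[OF assms(3)]
  unfolding UNIV_coeff by (elim disjE) (simp_all add: thomas_def)

lemma thomas_has_derivative:
  assumes "\<And>x. ((\<lambda>q. c q x) has_derivative (\<lambda>h. c' h x)) F" "i < 3" "j < 3" "k < 3"
  shows "((\<lambda>q. thomas (c q) i j k) has_derivative (\<lambda>h. thomas (c' h) i j k)) F"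
  unfolding thomas_linear[OF assms(2-4), of "c _"] thomas_linear[OF assms(2-4), of "c' _"]
  by (intro has_derivative_sum has_derivative_mult_right assms(1))

lemma smooth_on_thomas:
  assumes "open U" "\<And>x. smooth_on U (\<lambda>q. c q x)" "i < 3" "j < 3" "k < 3"
  shows "smooth_on U (\<lambda>q. thomas (c q) i j k)"
  unfolding thomas_linear[OF assms(3-5), of "c _"]
  by (intro smooth_on_sum smooth_on_mult smooth_on_const assms(1,2))

lemma riem_has_derivative:
  assumes G: "\<And>i j k. i < 3 \<Longrightarrow> j < 3 \<Longrightarrow> k < 3 \<Longrightarrow> ((\<lambda>q. G q i j k) has_derivative (\<lambda>h. G' h i j k)) (at a)"
    and dG: "\<And>l i j k. l < 3 \<Longrightarrow> i < 3 \<Longrightarrow> j < 3 \<Longrightarrow> k < 3 \<Longrightarrow> ((\<lambda>q. dG q l i j k) has_derivative (\<lambda>h. dG' h l i j k)) (at a)"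
    and ijkl: "i < 3" "j < 3" "k < 3" "l < 3"
  shows "((\<lambda>q. riem (G q) (dG q) i j k l) has_derivative
    (\<lambda>h. dG' h k i l j - dG' h l i k j + (\<Sum>m<3. (G a i k m * G' h m l j + G' h i k m * G a m l j)
        - (G a i l m * G' h m k j + G' h i l m * G a m k j)))) (at a)"
  unfolding riem_def
  by (intro has_derivative_add has_derivative_diff has_derivative_sum has_derivative_mult G dG ijkl) auto

lemma smooth_on_riem:
  assumes U: "open U" and G: "\<And>i j k. i < 3 \<Longrightarrow> j < 3 \<Longrightarrow> k < 3 \<Longrightarrow> smooth_on U (\<lambda>q. G q i j k)"
    and dG: "\<And>l i j k. l < 3 \<Longrightarrow> i < 3 \<Longrightarrow> j < 3 \<Longrightarrow> k < 3 \<Longrightarrow> smooth_on U (\<lambda>q. dG q l i j k)"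
    and ijkl: "i < 3" "j < 3" "k < 3" "l < 3"
  shows "smooth_on U (\<lambda>q. riem (G q) (dG q) i j k l)"
  unfolding riem_def
  by (intro smooth_on_add smooth_on_diff smooth_on_sum smooth_on_mult U G dG ijkl) auto

lemma smooth_on_schouten:
  assumes U: "open U" and G: "\<And>i j k. i < 3 \<Longrightarrow> j < 3 \<Longrightarrow> k < 3 \<Longrightarrow> smooth_on U (\<lambda>q. G q i j k)"
    and dG: "\<And>l i j k. l < 3 \<Longrightarrow> i < 3 \<Longrightarrow> j < 3 \<Longrightarrow> k < 3 \<Longrightarrow> smooth_on U (\<lambda>q. dG q l i j k)"
    and "j < 3" "l < 3"
  shows "smooth_on U (\<lambda>q. schouten (G q) (dG q) j l)"
  unfolding schouten_def divide_inverse
  by (intro smooth_on_mult smooth_on_const smooth_on_sum smooth_on_riem[OF U G dG] U assms) auto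

text \<open>A bootstrap: the equation expresses the derivative of \<open>X\<close> through
  \<open>W\<close> and \<open>X\<close>, so each order of regularity of \<open>X\<close> yields the
  next.\<close>

lemma smooth_on_integral_section:
  fixes W :: "'a::euclidean_space \<Rightarrow> 'a \<Rightarrow>\<^sub>L 'b::banach \<Rightarrow>\<^sub>L 'b"
  assumes S: "open S" and W: "smooth_on S W" and X: "\<And>q. q \<in> S \<Longrightarrow> (X has_derivative (\<lambda>h. W q h (X q))) (at q)"
  shows "smooth_on S X"
  unfolding smooth_on_def
proof
  fix k show "Ck_on k S X"
  proof (induction k)
    case 0
    show ?case using has_derivative_continuous[OF X] by (simp add: continuous_at_imp_continuous_on)
  next
    case (Suc k)
    show ?case
    proof (rule Ck_on_SucI[OF S X])
      show "Ck_on k S (\<lambda>q. W q h (X q))" for h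
        by (rule Ck_on_bilinear[OF bounded_bilinear_blinfun_apply S Ck_on_bounded_linear[OF blinfun.bounded_linear_left S] Suc])
          (use W in \<open>simp add: smooth_on_def\<close>)
    qed
  qed
qed

text \<open>A rank-one building block. Writing the connection form as a finite sum of constant
  tensors with scalar coefficients reduces its smoothness and its derivative to those of the
  scalars.\<close>

definition tensor ::
  "'a::real_inner \<Rightarrow> 'b::real_inner \<Rightarrow> 'b \<Rightarrow> ('a \<Rightarrow>\<^sub>L 'b \<Rightarrow>\<^sub>L 'b)" where
  "tensor a b c = blinfun_scaleR_left (blinfun_scaleR_left c o\<^sub>L blinfun_inner_left b) o\<^sub>L blinfun_inner_left a"

lemma tensor_apply [simp]: "tensor a b c h x = ((h \<bullet> a) * (x \<bullet> b)) *\<^sub>R c"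
  by (simp add: tensor_def blinfun.bilinear_simps inner_commute)

text \<open>The connection whose parallel sections are \<open>(\<sigma>, \<partial>\<sigma>)\<close> with
  \<open>\<partial>\<^sub>k \<partial>\<^sub>j \<sigma> = G m k j \<partial>\<^sub>m \<sigma> - P j k \<sigma>\<close>.\<close>

definition tractor ::
  "(nat \<Rightarrow> nat \<Rightarrow> nat \<Rightarrow> real) \<Rightarrow> (nat \<Rightarrow> nat \<Rightarrow> real) \<Rightarrow> point \<Rightarrow>\<^sub>L (real \<times> point) \<Rightarrow>\<^sub>L (real \<times> point)" where
  "tractor G P = (\<Sum>k<3. tensor (frame k) (0, frame k) (1, 0))
     + (\<Sum>j<3. \<Sum>k<3. \<Sum>m<3. G m k j *\<^sub>R tensor (frame k) (0, frame m) (0, frame j))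
     + (\<Sum>j<3. \<Sum>k<3. P j k *\<^sub>R tensor (frame k) (1, 0) (0, - frame j))"

lemma tractor_apply:
  "tractor G P h (s, v) = (v \<bullet> h, \<Sum>j<3. (\<Sum>k<3. (h \<bullet> frame k) * ((\<Sum>m<3. G m k j * (v \<bullet> frame m)) - P j k * s)) *\<^sub>R frame j)"
proof (rule prod_eqI)
  have "v \<bullet> h = (\<Sum>k<3. (h \<bullet> frame k) * (v \<bullet> frame k))"
    by (cases v, cases h) (simp add: sum_lessThan_3)
  then show "fst (tractor G P h (s, v)) = fst (v \<bullet> h, \<Sum>j<3. (\<Sum>k<3. (h \<bullet> frame k) * ((\<Sum>m<3. G m k j * (v \<bullet> frame m)) - P j k * s)) *\<^sub>R frame j)"
    by (simp add: tractor_def blinfun.bilinear_simps blinfun.sum_left fst_sum)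
  show "snd (tractor G P h (s, v)) = snd (v \<bullet> h, \<Sum>j<3. (\<Sum>k<3. (h \<bullet> frame k) * ((\<Sum>m<3. G m k j * (v \<bullet> frame m)) - P j k * s)) *\<^sub>R frame j)"
    by (simp add: tractor_def blinfun.bilinear_simps blinfun.sum_left snd_sum scaleR_sum_left sum_distrib_left
        right_diff_distrib scaleR_diff_left sum_subtractf sum_negf sum.distrib mult_ac del: frame_simps)
qed

lemma tractor_frame:
  assumes "k < 3"
  shows "tractor G P (frame k) (s, v) = (v \<bullet> frame k, \<Sum>j<3. ((\<Sum>m<3. G m k j * (v \<bullet> frame m)) - P j k * s) *\<^sub>R frame j)"
  using nat_less_3_cases[OF assms] unfolding tractor_apply
  by (elim disjE) (simp_all add: sum_lessThan_3)

text \<open>\<open>tractor\<close> is affine rather than linear in \<open>G\<close> and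
  \<open>P\<close>. Its constant part, which encodes that the second component is the gradient of
  the first, drops out of the derivative and is subtracted.\<close>

lemma tractor_has_derivative:
  assumes "\<And>i j k. i < 3 \<Longrightarrow> j < 3 \<Longrightarrow> k < 3 \<Longrightarrow> ((\<lambda>q. G q i j k) has_derivative (\<lambda>h. G' h i j k)) F"
    and "\<And>j k. j < 3 \<Longrightarrow> k < 3 \<Longrightarrow> ((\<lambda>q. P q j k) has_derivative (\<lambda>h. P' h j k)) F"
  shows "((\<lambda>q. tractor (G q) (P q)) has_derivative
    (\<lambda>h. tractor (G' h) (P' h) - tractor (\<lambda>_ _ _. 0) (\<lambda>_ _. 0))) F"
proof -
  have "((\<lambda>q. tractor (G q) (P q)) has_derivative
    (\<lambda>h. 0 + (\<Sum>j<3. \<Sum>k<3. \<Sum>m<3. G' h m k j *\<^sub>R tensor (frame k) (0, frame m) (0, frame j))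
     + (\<Sum>j<3. \<Sum>k<3. P' h j k *\<^sub>R tensor (frame k) (1, 0) (0, - frame j)))) F"
    unfolding tractor_def
    by (intro has_derivative_add has_derivative_sum has_derivative_const has_derivative_scaleR_left assms) auto
  then show ?thesis by (simp add: tractor_def)
qed

lemma smooth_on_tractor:
  assumes U: "open U" and "\<And>i j k. i < 3 \<Longrightarrow> j < 3 \<Longrightarrow> k < 3 \<Longrightarrow> smooth_on U (\<lambda>q. G q i j k)"
    and "\<And>j k. j < 3 \<Longrightarrow> k < 3 \<Longrightarrow> smooth_on U (\<lambda>q. P q j k)"
  shows "smooth_on U (\<lambda>q. tractor (G q) (P q))"
  unfolding tractor_def
  by (intro smooth_on_add smooth_on_sum smooth_on_scaleR smooth_on_const assms) auto

text \<open>On frame vectors the curvature splits. Its first component vanishes by the symmetry of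
  \<open>G\<close> and \<open>P\<close>. In its second component the gradient is multiplied by the
  Weyl tensor and the function by the Cotton tensor. Bilinearity extends this to all
  \<open>h\<close> and \<open>k\<close>.\<close>

lemma tractor_flat:
  assumes G: "\<And>i j k. i < 3 \<Longrightarrow> j < 3 \<Longrightarrow> k < 3 \<Longrightarrow> G i j k = G i k j"
    and P: "\<And>j k. j < 3 \<Longrightarrow> k < 3 \<Longrightarrow> P j k = P k j"
    and weyl: "\<And>i j k l. i < 3 \<Longrightarrow> j < 3 \<Longrightarrow> k < 3 \<Longrightarrow> l < 3 \<Longrightarrow>
      riem G dG i j k l = (if i = k then P j l else 0) - (if i = l then P j k else 0)"
    and cotton: "\<And>j k l. j < 3 \<Longrightarrow> k < 3 \<Longrightarrow> l < 3 \<Longrightarrow>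
      dP k j l - dP l j k + (\<Sum>m<3. G m l j * P m k - G m k j * P m l) = 0"
    and D: "linear D" "\<And>k. k < 3 \<Longrightarrow> D (frame k) = tractor (dG k) (dP k) - tractor (\<lambda>_ _ _. 0) (\<lambda>_ _. 0)"
  shows "D h k x + tractor G P k (tractor G P h x) = D k h x + tractor G P h (tractor G P k x)"
proof -
  define T where "T = (\<lambda>h k. D h k x + tractor G P k (tractor G P h x))"
  have frames: "T (frame a) (frame b) = T (frame b) (frame a)" if ab: "a < 3" "b < 3" for a b
  proof -
    obtain s v where x: "x = (s, v)" by (cases x)
    define w where "w = (\<lambda>m. v \<bullet> frame m)"
    define t where "t = (\<lambda>k j. (\<Sum>m<3. G m k j * w m) - P j k * s)"
    have comp: "(\<Sum>j<3. f j *\<^sub>R frame j) \<bullet> frame m = f m" if "m < 3" for f m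
      using nat_less_3_cases[OF that] by (auto simp: sum_lessThan_3)
    have W: "tractor G P (frame k) (s, v) = (w k, \<Sum>j<3. t k j *\<^sub>R frame j)" if "k < 3" for k
      using tractor_frame[OF that] by (simp add: w_def t_def)
    have DW: "D (frame a) (frame b) x = (0, \<Sum>j<3. ((\<Sum>m<3. dG a m b j * w m) - dP a j b * s) *\<^sub>R frame j)"
      if "a < 3" "b < 3" for a b
      using D(2)[OF that(1)] by (simp add: x blinfun.bilinear_simps tractor_frame[OF that(2)] w_def)
    have TT: "T (frame a) (frame b) = (t a b, \<Sum>j<3. ((\<Sum>m<3. dG a m b j * w m) - dP a j b * s
        + ((\<Sum>m<3. G m b j * t a m) - P j b * w a)) *\<^sub>R frame j)" if "a < 3" "b < 3" for a b
    proof -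
      have "tractor G P (frame b) (tractor G P (frame a) x) = (t a b, \<Sum>j<3. ((\<Sum>m<3. G m b j * t a m) - P j b * w a) *\<^sub>R frame j)"
        unfolding x W[OF that(1)] tractor_frame[OF that(2)] using that by (simp add: comp)
      then show ?thesis unfolding T_def by (simp add: DW[OF that] scaleR_add_left sum.distrib)
    qed
    have "t a b = t b a" using G P ab by (simp add: t_def)
    moreover have "(\<Sum>m<3. dG a m b j * w m) - dP a j b * s + ((\<Sum>m<3. G m b j * t a m) - P j b * w a)
      = (\<Sum>m<3. dG b m a j * w m) - dP b j a * s + ((\<Sum>m<3. G m a j * t b m) - P j a * w b)" if j: "j < 3" for j
    proof -
      have 1: "(\<Sum>m<3. riem G dG m j a b * w m) = P j b * w a - P j a * w b"
      proof -
        have "(\<Sum>m<3. riem G dG m j a b * w m) = (\<Sum>m<3. (if m = a then P j b * w m else 0) - (if m = b then P j a * w m else 0))"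
          by (rule sum.cong) (use weyl j ab in auto)
        then show ?thesis using ab by (simp add: sum_subtractf)
      qed
      have 2: "s * (dP a j b - dP b j a + (\<Sum>m<3. G m b j * P m a - G m a j * P m b)) = 0"
        using cotton[OF j ab] by simp
      show ?thesis
        using 1 2 unfolding riem_def t_def sum_lessThan_3 by (simp add: algebra_simps)
    qed
    ultimately show ?thesis
      unfolding TT[OF ab] TT[OF ab(2) ab(1)]
      by (intro arg_cong2[where f = Pair] sum.cong refl) (simp_all only: lessThan_iff)
  qed
  have T: "T h k = (\<Sum>a<3. \<Sum>b<3. ((h \<bullet> frame a) * (k \<bullet> frame b)) *\<^sub>R T (frame a) (frame b))" for h k
  proof -
    have 1: "linear (\<lambda>h. T h k)" for k
      unfolding T_def using D(1)
      by (intro linearI) (simp_all add: linear_add linear_cmul blinfun.bilinear_simps scaleR_add_right)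
    have 2: "linear (T h)" for h
      unfolding T_def by (intro linearI) (simp_all add: blinfun.bilinear_simps scaleR_add_right)
    have A: "T h k = (\<Sum>a<3. (h \<bullet> frame a) *\<^sub>R T (frame a) k)" for h k
      by (rule trans[OF arg_cong[OF frame_expand, of "\<lambda>h. T h k"]]) (simp only: linear_sum[OF 1] linear_cmul[OF 1])
    have B: "T h k = (\<Sum>b<3. (k \<bullet> frame b) *\<^sub>R T h (frame b))" for h k
      by (rule trans[OF arg_cong[OF frame_expand, of "\<lambda>k. T h k"]]) (simp only: linear_sum[OF 2] linear_cmul[OF 2])
    have "T h k = (\<Sum>a<3. (h \<bullet> frame a) *\<^sub>R T (frame a) k)" by (rule A)
    also have "(\<Sum>a<3. (h \<bullet> frame a) *\<^sub>R T (frame a) k)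
        = (\<Sum>a<3. (h \<bullet> frame a) *\<^sub>R (\<Sum>b<3. (k \<bullet> frame b) *\<^sub>R T (frame a) (frame b)))"
      by (intro sum.cong refl arg_cong[where f = "scaleR _"] B)
    finally have "T h k = (\<Sum>a<3. (h \<bullet> frame a) *\<^sub>R (\<Sum>b<3. (k \<bullet> frame b) *\<^sub>R T (frame a) (frame b)))"
      .
    then show ?thesis by (simp add: scaleR_sum_right)
  qed
  have "T h k = T k h"
    unfolding T[of h k] T[of k h]
    by (subst (2) sum.swap) (intro sum.cong refl, simp add: frames mult.commute del: frame_simps)
  then show ?thesis by (simp add: T_def)
qed

section \<open>Second derivatives of quotients of solutions\<close>

definition quad :: "(nat \<Rightarrow> nat \<Rightarrow> real) \<Rightarrow> point \<Rightarrow> real" where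
  "quad f h = (\<Sum>k<3. \<Sum>j<3. (h \<bullet> frame k) * (h \<bullet> frame j) * f j k)"

definition spray ::
  "(nat \<Rightarrow> nat \<Rightarrow> nat \<Rightarrow> real) \<Rightarrow> point \<Rightarrow> point" where
  "spray G h = (\<Sum>m<3. quad (G m) h *\<^sub>R frame m)"

text \<open>For a parallel section this is the Hessian of the solution in the direction
  \<open>h\<close>. The factor \<open>quad P h\<close> is common to all solutions, and this is what
  lets it cancel in quotients.\<close>

lemma tractor_diagonal:
  assumes "\<And>i j k. i < 3 \<Longrightarrow> j < 3 \<Longrightarrow> k < 3 \<Longrightarrow> G i j k = G i k j"
  shows "snd (tractor G P h (s, v)) \<bullet> h = v \<bullet> spray G h - quad P h * s"
proof -
  have "G i 1 0 = G i 0 1" "G i 2 0 = G i 0 2" "G i 2 1 = G i 1 2" if "i < 3" for i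
    using assms that by auto
  note s = this[of 0, simplified] this[of 1, simplified] this[of 2, simplified]
  show ?thesis
    by (cases h; cases v)
      (simp add: tractor_apply spray_def quad_def sum_lessThan_3 s algebra_simps)
qed

text \<open>The left side is the quotient rule applied twice to s/t. Here \<open>a\<close> and
  \<open>b\<close> are the first derivatives along \<open>h\<close>, \<open>X\<close> and
  \<open>Y\<close> those along the spray vector, and \<open>X - P * s\<close> and
  \<open>Y - P * t\<close> the second derivatives along \<open>h\<close>.\<close>

lemma quotient_identity:
  fixes t :: real
  assumes "t \<noteq> 0"
  shows "(((X - P * s) * t + a * b - (a * b + s * (Y - P * t))) * (t * t) - (a * t - s * b) * (b * t + t * b)) / (t * t * (t * t))
    = ((X + - 2 * b / t * a) * t - s * (Y + - 2 * b / t * b)) / (t * t)"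
  using assms by (simp add: field_simps)

text \<open>Because \<open>P\<close> cancels, the second derivative of the quotient is its first
  derivative along \<open>Q\<close> plus the cross term of the quotient rule. That term points along
  \<open>h\<close>, so it changes only the parametrisation of geodesics, as
  \<open>maps_geodesic_system\<close> permits.\<close>

lemma projective_coordinate:
  fixes \<sigma> \<tau> :: "point \<Rightarrow> real" and v w :: "point \<Rightarrow> point"
  assumes S: "open S" "q \<in> S"
    and \<sigma>: "\<And>q. q \<in> S \<Longrightarrow> (\<sigma> has_derivative (\<lambda>h. v q \<bullet> h)) (at q)"
    and \<tau>: "\<And>q. q \<in> S \<Longrightarrow> (\<tau> has_derivative (\<lambda>h. w q \<bullet> h)) (at q)"
    and v: "(v has_derivative v') (at q)" "v' h \<bullet> h = v q \<bullet> Q - P * \<sigma> q"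
    and w: "(w has_derivative w') (at q)" "w' h \<bullet> h = w q \<bullet> Q - P * \<tau> q"
    and nz: "\<And>q. q \<in> S \<Longrightarrow> \<tau> q \<noteq> 0"
  defines "f \<equiv> \<lambda>q. \<sigma> q / \<tau> q"
  shows "\<And>q. q \<in> S \<Longrightarrow> (f has_derivative (\<lambda>h. (v q \<bullet> h * \<tau> q - \<sigma> q * (w q \<bullet> h)) / (\<tau> q * \<tau> q))) (at q)"
    and "frechet_derivative (\<lambda>q. frechet_derivative f (at q) h) (at q) h
      = frechet_derivative f (at q) (Q + (- 2 * (w q \<bullet> h) / \<tau> q) *\<^sub>R h)"
proof -
  let ?f' = "\<lambda>q h. (v q \<bullet> h * \<tau> q - \<sigma> q * (w q \<bullet> h)) / (\<tau> q * \<tau> q)"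
  show D: "(f has_derivative ?f' q) (at q)" if "q \<in> S" for q
    unfolding f_def using has_derivative_divide'[OF \<sigma>[OF that] \<tau>[OF that] nz[OF that]]
    by (simp add: algebra_simps)
  note F = frechet_derivative_at[OF D, symmetric]
  have "((\<lambda>q. ?f' q h) has_derivative (\<lambda>k.
      (((v' k \<bullet> h) * \<tau> q + (v q \<bullet> h) * (w q \<bullet> k) - ((v q \<bullet> k) * (w q \<bullet> h) + \<sigma> q * (w' k \<bullet> h))) * (\<tau> q * \<tau> q)
        - (v q \<bullet> h * \<tau> q - \<sigma> q * (w q \<bullet> h)) * ((w q \<bullet> k) * \<tau> q + \<tau> q * (w q \<bullet> k))) / ((\<tau> q * \<tau> q) * (\<tau> q * \<tau> q)))) (at q)"
    by (rule has_derivative_eq_rhs[OF has_derivative_divide'[OF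
        has_derivative_diff[OF
          has_derivative_mult[OF bounded_linear.has_derivative[OF bounded_linear_inner_left v(1)] \<tau>[OF S(2)]]
          has_derivative_mult[OF \<sigma>[OF S(2)] bounded_linear.has_derivative[OF bounded_linear_inner_left w(1)]]]
        has_derivative_mult[OF \<tau>[OF S(2)] \<tau>[OF S(2)]]]])
      (use nz[OF S(2)] in \<open>auto simp: algebra_simps\<close>)
  then have "((\<lambda>q. frechet_derivative f (at q) h) has_derivative (\<lambda>k.
      (((v' k \<bullet> h) * \<tau> q + (v q \<bullet> h) * (w q \<bullet> k) - ((v q \<bullet> k) * (w q \<bullet> h) + \<sigma> q * (w' k \<bullet> h))) * (\<tau> q * \<tau> q)
        - (v q \<bullet> h * \<tau> q - \<sigma> q * (w q \<bullet> h)) * ((w q \<bullet> k) * \<tau> q + \<tau> q * (w q \<bullet> k))) / ((\<tau> q * \<tau> q) * (\<tau> q * \<tau> q)))) (at q)"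
    by (rule has_derivative_transform_within_open[OF _ S]) (simp add: F)
  from fun_cong[OF frechet_derivative_at[OF this], of h, symmetric]
  show "frechet_derivative (\<lambda>q. frechet_derivative f (at q) h) (at q) h
      = frechet_derivative f (at q) (Q + (- 2 * (w q \<bullet> h) / \<tau> q) *\<^sub>R h)"
    unfolding F[OF S(2)] v(2) w(2) inner_add_right inner_scaleR_right
    by (simp only: quotient_identity[OF nz[OF S(2)]])
qed

section \<open>Local diffeomorphisms with an explicit inverse derivative\<close>

definition cross :: "point \<Rightarrow> point \<Rightarrow> point" where
  "cross a b = (fst (snd a) * snd (snd b) - snd (snd a) * fst (snd b),
    snd (snd a) * fst b - fst a * snd (snd b), fst a * fst (snd b) - fst (snd a) * fst b)"

text \<open>Provides the inverse of the Jacobian as a rational expression in its entries, whose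
  smoothness follows from the closure properties.\<close>

lemma Cramer_rule:
  fixes a b c :: point
  assumes "a \<bullet> cross b c \<noteq> 0" and h: "h = x *\<^sub>R a + y *\<^sub>R b + z *\<^sub>R c"
  shows "(inverse (a \<bullet> cross b c)) *\<^sub>R (h \<bullet> cross b c, h \<bullet> cross c a, h \<bullet> cross a b) = (x, y, z)"
proof -
  have "h \<bullet> cross b c = (a \<bullet> cross b c) * x" "h \<bullet> cross c a = (a \<bullet> cross b c) * y" "h \<bullet> cross a b = (a \<bullet> cross b c) * z"
    unfolding h cross_def by (cases a; cases b; cases c; simp add: algebra_simps)+
  then show ?thesis using assms(1) by simp
qed

lemma smooth_on_inner:
  fixes f g :: "'a::euclidean_space \<Rightarrow> 'b::real_inner"
  shows "open S \<Longrightarrow> smooth_on S f \<Longrightarrow> smooth_on S g \<Longrightarrow> smooth_on S (\<lambda>x. f x \<bullet> g x)"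
  using smooth_on_bilinear[OF bounded_bilinear_inner] .

lemma smooth_on_cross:
  "open S \<Longrightarrow> smooth_on S f \<Longrightarrow> smooth_on S g \<Longrightarrow> smooth_on S (\<lambda>x. cross (f x) (g x))"
  unfolding cross_def by (intro smooth_intros)

text \<open>The inverse function theorem supplies a local homeomorphism. Smoothness of the inverse
  then comes from \<open>smooth_on_inverse_function\<close>, with the inverse derivative
  \<open>A\<close> given by Cramer's rule wherever the Jacobian determinant \<open>J\<close> is
  non-zero; at \<open>p\<close> it equals 1.\<close>

lemma local_diffeomorphism:
  fixes \<phi> :: "point \<Rightarrow> point"
  assumes S: "open S" "p \<in> S" and \<phi>: "smooth_on S \<phi>" and p: "\<And>h. frechet_derivative \<phi> (at p) h = h"
  obtains V where "p \<in> V" "V \<subseteq> S" "point_transformation V \<phi>"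
    "\<forall>q\<in>V. \<forall>h. frechet_derivative \<phi> (at q) h = 0 \<longrightarrow> h = 0"
proof -
  define d where "d = (\<lambda>i q. frechet_derivative \<phi> (at q) (frame i))"
  define J where "J = (\<lambda>q. d 0 q \<bullet> cross (d 1 q) (d 2 q))"
  define A where "A = (\<lambda>q h. (inverse (J q)) *\<^sub>R (h \<bullet> cross (d 1 q) (d 2 q), h \<bullet> cross (d 2 q) (d 0 q), h \<bullet> cross (d 0 q) (d 1 q)))"
  have smd: "smooth_on S (d i)" for i unfolding d_def by (rule smooth_on_frechet_derivative[OF \<phi>])
  have smJ: "smooth_on S J" unfolding J_def by (intro smooth_on_inner smooth_on_cross smd S)
  define S' where "S' = {q \<in> S. J q \<noteq> 0}"
  have S': "open S'" "S' \<subseteq> S"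
    using continuous_open_preimage[OF smooth_on_imp_continuous_on[OF smJ] S(1), of "- {0}"]
    by (auto simp: S'_def vimage_def Int_def open_Compl)
  have pS': "p \<in> S'" using S(2) by (simp add: S'_def J_def d_def p cross_def)
  note \<phi>' = smooth_on_subset[OF \<phi> S'(2)]
  have D: "(\<phi> has_derivative frechet_derivative \<phi> (at q)) (at q)" if "q \<in> S'" for q
    using smooth_on_has_derivative[OF \<phi>' that] .
  have AD: "A q (frechet_derivative \<phi> (at q) h) = h" if "q \<in> S'" for q h
  proof -
    obtain x y z where h: "h = (x, y, z)" by (metis prod.collapse)
    note lin = linear_frechet_derivative[OF \<phi>' that]
    have hf: "h = x *\<^sub>R frame 0 + y *\<^sub>R frame 1 + z *\<^sub>R frame 2" by (simp add: h)
    have "frechet_derivative \<phi> (at q) h = x *\<^sub>R d 0 q + y *\<^sub>R d 1 q + z *\<^sub>R d 2 q"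
      unfolding hf d_def by (simp only: linear_add[OF lin] linear_cmul[OF lin])
    from Cramer_rule[OF _ this] show ?thesis using that by (simp add: A_def J_def S'_def h)
  qed
  have smA: "smooth_on S' (\<lambda>q. A q h)" for h
    unfolding A_def inverse_eq_divide
    by (intro smooth_on_scaleR smooth_on_Pair smooth_on_divide smooth_on_inner smooth_on_cross smooth_on_const S'(1)
        smooth_on_subset[OF smd S'(2)] smooth_on_subset[OF smJ S'(2)]) (simp add: S'_def)
  define f' where "f' = (\<lambda>q. Blinfun (frechet_derivative \<phi> (at q)))"
  have f': "blinfun_apply (f' q) = frechet_derivative \<phi> (at q)" if "q \<in> S'" for q
    unfolding f'_def using has_derivative_bounded_linear[OF D[OF that]] by (rule bounded_linear_Blinfun_apply)
  have contf': "continuous_on S' f'"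
  proof (rule continuous_on_blinfun_componentwise)
    show "continuous_on S' (\<lambda>q. f' q i)" for i
      using smooth_on_imp_continuous_on[OF smooth_on_frechet_derivative[OF \<phi>', of i]]
      by (simp add: f' cong: continuous_on_cong)
  qed
  have "id_blinfun o\<^sub>L f' p = id_blinfun"
    by (rule blinfun_eqI) (simp add: f'[OF pS'] p)
  then obtain V T g g' where V: "open V" "V \<subseteq> S'" "p \<in> V" "open T" "homeomorphism V T \<phi> g"
    using inverse_function_theorem[OF S'(1) _ contf' pS', of \<phi> id_blinfun] D f' by metis
  have T: "\<phi> ` V = T" "g ` T = V" "continuous_on T g" "\<And>q. q \<in> V \<Longrightarrow> g (\<phi> q) = q" "\<And>r. r \<in> T \<Longrightarrow> \<phi> (g r) = r"
    using V(5) by (auto simp: homeomorphism_def)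
  have "smooth_on T g"
  proof (rule smooth_on_inverse_function[OF V(1,4) _ T(3,5)])
    show "(\<phi> has_derivative frechet_derivative \<phi> (at q)) (at q)" if "q \<in> V" for q using D V(2) that by blast
    show "A q (frechet_derivative \<phi> (at q) h) = h" if "q \<in> V" for q h using AD V(2) that by blast
    show "bounded_linear (A q)" if "q \<in> V" for q
      unfolding A_def by (intro bounded_linear_scaleR_right[THEN bounded_linear_compose] bounded_linear_Pair bounded_linear_inner_left)
    show "smooth_on V (\<lambda>q. A q h)" for h using smooth_on_subset[OF smA V(2)] .
  qed (use T in auto)
  then have "point_transformation V \<phi>"
    unfolding point_transformation_def T(1) using V T smooth_on_subset[OF \<phi>' V(2)] by auto
  moreover have "h = 0" if "q \<in> V" "frechet_derivative \<phi> (at q) h = 0" for q h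
  proof -
    have "A q 0 = 0" unfolding A_def inner_zero_left by (simp add: zero_prod_def)
    then show ?thesis using AD[of q h] V(2) that by auto
  qed
  ultimately show thesis using that V S' by blast
qed

theorem linearization_conditions_imp_linearizable:
  assumes U: "open U" and K: "\<And>x. smooth_on U (K x)"
    and cond: "\<And>p. p \<in> U \<Longrightarrow>
      linearization_conditions (\<lambda>x. K x p) (\<lambda>l x. frechet_derivative (K x) (at p) (frame l))"
  shows "linearizable U (\<lambda>p. cubic_F (\<lambda>x. K x p)) (\<lambda>p. cubic_G (\<lambda>x. K x p))"
  unfolding linearizable_def
proof
  fix p assume p: "p \<in> U"
  define dK where "dK = (\<lambda>l q x. frechet_derivative (K x) (at q) (frame l))"
  define ddK where "ddK = (\<lambda>h l q x. frechet_derivative (\<lambda>q. dK l q x) (at q) h)"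
  define G where "G = (\<lambda>q. thomas (\<lambda>x. K x q))"
  define dG where "dG = (\<lambda>q l. thomas (dK l q))"
  define P where "P = (\<lambda>q. schouten (G q) (dG q))"
  define dP where "dP = (\<lambda>q l j k. frechet_derivative (\<lambda>q. P q j k) (at q) (frame l))"
  have smdK: "smooth_on U (\<lambda>q. dK l q x)" for l x unfolding dK_def by (rule smooth_on_frechet_derivative[OF K])
  have smG: "smooth_on U (\<lambda>q. G q i j k)" if "i < 3" "j < 3" "k < 3" for i j k
    unfolding G_def by (intro smooth_on_thomas U K that)
  have smdG: "smooth_on U (\<lambda>q. dG q l i j k)" if "i < 3" "j < 3" "k < 3" for l i j k
    unfolding dG_def by (intro smooth_on_thomas U smdK that)
  have smP: "smooth_on U (\<lambda>q. P q j k)" if "j < 3" "k < 3" for j k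
    unfolding P_def by (intro smooth_on_schouten U smG smdG that)
  have DG: "((\<lambda>q. G q i j k) has_derivative (\<lambda>h. thomas (\<lambda>x. frechet_derivative (K x) (at q) h) i j k)) (at q)"
    if "q \<in> U" "i < 3" "j < 3" "k < 3" for q i j k
    unfolding G_def by (intro thomas_has_derivative smooth_on_has_derivative[OF K] that)
  have DdG: "((\<lambda>q. dG q l i j k) has_derivative (\<lambda>h. thomas (ddK h l q) i j k)) (at q)"
    if "q \<in> U" "i < 3" "j < 3" "k < 3" for q l i j k
    unfolding dG_def ddK_def by (intro thomas_has_derivative smooth_on_has_derivative[OF smdK] that)
  have DP: "((\<lambda>q. P q j k) has_derivative frechet_derivative (\<lambda>q. P q j k) (at q)) (at q)"
    if "q \<in> U" "j < 3" "k < 3" for q j k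
    by (intro smooth_on_has_derivative[OF smP] that)
  have weyl: "riem (G q) (dG q) i j k l = (if i = k then P q j l else 0) - (if i = l then P q j k else 0)"
    if "q \<in> U" "i < 3" "j < 3" "k < 3" "l < 3" for q i j k l
    using linearization_conditions_imp_weyl[OF cond[OF that(1)] that(2-5)]
    by (simp add: G_def dG_def P_def dK_def del: frame_simps)
  have symG: "G q i j k = G q i k j" if "i < 3" "j < 3" "k < 3" for q i j k
    unfolding G_def by (rule thomas_sym[OF that])
  have symP: "P q j k = P q k j" if "j < 3" "k < 3" for q j k
    unfolding P_def G_def dG_def by (rule schouten_thomas_sym[OF that])
  \<comment> \<open>The vanishing of the Weyl tensor holds on the open set \<open>U\<close> and can
    therefore be differentiated; this supplies the derivative of the curvature to the Bianchi
    identity.\<close>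
  have dweyl: "driem (G q) (dG q) (\<lambda>n l. thomas (ddK (frame n) l q)) n i j k l
      = (if i = k then dP q n j l else 0) - (if i = l then dP q n j k else 0)"
    if q: "q \<in> U" and "n < 3" and ijkl: "i < 3" "j < 3" "k < 3" "l < 3" for q n i j k l
  proof -
    let ?R' = "\<lambda>h. thomas (ddK h k q) i l j - thomas (ddK h l q) i k j
      + (\<Sum>m<3. (G q i k m * thomas (\<lambda>x. frechet_derivative (K x) (at q) h) m l j
          + thomas (\<lambda>x. frechet_derivative (K x) (at q) h) i k m * G q m l j)
        - (G q i l m * thomas (\<lambda>x. frechet_derivative (K x) (at q) h) m k j
          + thomas (\<lambda>x. frechet_derivative (K x) (at q) h) i l m * G q m k j))"
    have "((\<lambda>q. riem (G q) (dG q) i j k l) has_derivative ?R') (at q)"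
      by (intro riem_has_derivative DG DdG q ijkl)
    then have "((\<lambda>q. (if i = k then P q j l else 0) - (if i = l then P q j k else 0)) has_derivative ?R') (at q)"
      by (rule has_derivative_transform_within_open[OF _ U q]) (use weyl ijkl in auto)
    moreover have "((\<lambda>q. (if i = k then P q j l else 0) - (if i = l then P q j k else 0)) has_derivative
      (\<lambda>h. (if i = k then frechet_derivative (\<lambda>q. P q j l) (at q) h else 0)
        - (if i = l then frechet_derivative (\<lambda>q. P q j k) (at q) h else 0))) (at q)"
      by (cases "i = k"; cases "i = l"; simp only: simp_thms if_True if_False;
          intro has_derivative_diff has_derivative_const DP q ijkl)
    ultimately have "?R' = (\<lambda>h. (if i = k then frechet_derivative (\<lambda>q. P q j l) (at q) h else 0)
        - (if i = l then frechet_derivative (\<lambda>q. P q j k) (at q) h else 0))"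
      by (rule has_derivative_unique)
    from fun_cong[OF this, of "frame n"] show ?thesis
      unfolding driem_def dG_def dP_def dK_def by (simp add: algebra_simps del: frame_simps)
  qed
  have symdd: "thomas (ddK (frame m) l q) i j k = thomas (ddK (frame l) m q) i j k" if "q \<in> U" for q m l i j k
  proof -
    have "ddK (frame m) l q = ddK (frame l) m q"
      unfolding ddK_def dK_def using symmetric_second_derivative[OF U that K] by blast
    then show ?thesis by simp
  qed
  have cotton: "dP q k j l - dP q l j k + (\<Sum>m<3. G q m l j * P q m k - G q m k j * P q m l) = 0"
    if q: "q \<in> U" and "j < 3" "k < 3" "l < 3" for q j k l
    by (rule cotton_vanishes[where dG = "dG q" and ddG = "\<lambda>n l. thomas (ddK (frame n) l q)"])
      (use that symG weyl[OF q] dweyl[OF q] symdd[OF q] in auto)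
  define W where "W = (\<lambda>q. tractor (G q) (P q))"
  have smW: "smooth_on U W" unfolding W_def by (intro smooth_on_tractor U smG smP)
  have flat: "frechet_derivative W (at q) h k x + W q k (W q h x) = frechet_derivative W (at q) k h x + W q h (W q k x)"
    if q: "q \<in> U" for q h k x
  proof -
    have "(W has_derivative (\<lambda>h. tractor (thomas (\<lambda>x. frechet_derivative (K x) (at q) h))
        (\<lambda>j k. frechet_derivative (\<lambda>q. P q j k) (at q) h) - tractor (\<lambda>_ _ _. 0) (\<lambda>_ _. 0))) (at q)"
      unfolding W_def by (intro tractor_has_derivative DG DP q)
    from frechet_derivative_at[OF this]
    have DW: "frechet_derivative W (at q) h = tractor (thomas (\<lambda>x. frechet_derivative (K x) (at q) h))
        (\<lambda>j k. frechet_derivative (\<lambda>q. P q j k) (at q) h) - tractor (\<lambda>_ _ _. 0) (\<lambda>_ _. 0)" for h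
      by (rule fun_cong[symmetric])
    show ?thesis
      unfolding W_def[THEN fun_cong, of q]
    proof (rule tractor_flat[where dG = "dG q" and dP = "dP q"])
      show "linear (frechet_derivative W (at q))" by (rule linear_frechet_derivative[OF smW q])
      show "frechet_derivative W (at q) (frame k) = tractor (dG q k) (dP q k) - tractor (\<lambda>_ _ _. 0) (\<lambda>_ _. 0)" for k
        unfolding DW dG_def dP_def dK_def ..
    qed (use symG symP weyl[OF q] cotton[OF q] in auto)
  qed
  obtain r where r: "r > 0" "ball p r \<subseteq> U"
    "\<And>x0. \<exists>X. X p = x0 \<and> (\<forall>q\<in>ball p r. (X has_derivative (\<lambda>h. W q h (X q))) (at q))"
    using linear_frobenius[OF U p smW flat] by blast
  then obtain X where X: "\<And>x0. X x0 p = x0"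
    "\<And>x0 q. q \<in> ball p r \<Longrightarrow> (X x0 has_derivative (\<lambda>h. W q h (X x0 q))) (at q)" by metis
  \<comment> \<open>The initial values at \<open>p\<close> are those of the functions 1, x, y, z
    centred at \<open>p\<close>, to first order. The denominator is therefore 1 at \<open>p\<close>,
    and the quotients have the identity as their Jacobian there.\<close>
  define X0 where "X0 = X (1, 0)"
  define Y where "Y = (\<lambda>i. X (0, frame i))"
  have smX: "smooth_on (ball p r) (X x0)" for x0
    using X(2) by (intro smooth_on_integral_section[OF open_ball smooth_on_subset[OF smW r(2)]])
  define S where "S = {q \<in> ball p r. fst (X0 q) \<noteq> 0}"
  have S: "open S" "p \<in> S" "S \<subseteq> ball p r"
  proof -
    have "smooth_on (ball p r) (\<lambda>q. fst (X0 q))" unfolding X0_def by (intro smooth_on_fst open_ball smX)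
    from continuous_open_preimage[OF smooth_on_imp_continuous_on[OF this] open_ball, of "- {0}"]
    show "open S" by (simp add: S_def vimage_def Int_def open_Compl)
  qed (use r X in \<open>auto simp: S_def X0_def\<close>)
  have comps: "((\<lambda>q. fst (X x0 q)) has_derivative (\<lambda>h. snd (X x0 q) \<bullet> h)) (at q)"
    "((\<lambda>q. snd (X x0 q)) has_derivative (\<lambda>h. snd (W q h (X x0 q)))) (at q)"
    "snd (W q h (X x0 q)) \<bullet> h = snd (X x0 q) \<bullet> spray (G q) h - quad (P q) h * fst (X x0 q)"
    if "q \<in> S" for q x0 h
  proof -
    have qb: "q \<in> ball p r" using that S(3) by blast
    obtain s v where sv: "X x0 q = (s, v)" by (cases "X x0 q")
    show "((\<lambda>q. fst (X x0 q)) has_derivative (\<lambda>h. snd (X x0 q) \<bullet> h)) (at q)"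
      using bounded_linear.has_derivative[OF bounded_linear_fst X(2)[OF qb, of x0]]
      by (simp add: W_def sv tractor_apply)
    show "((\<lambda>q. snd (X x0 q)) has_derivative (\<lambda>h. snd (W q h (X x0 q)))) (at q)"
      using bounded_linear.has_derivative[OF bounded_linear_snd X(2)[OF qb]] .
    show "snd (W q h (X x0 q)) \<bullet> h = snd (X x0 q) \<bullet> spray (G q) h - quad (P q) h * fst (X x0 q)"
      unfolding W_def sv using tractor_diagonal[of "G q", OF symG] by simp
  qed
  define f where "f = (\<lambda>i q. fst (Y i q) / fst (X0 q))"
  \<comment> \<open>The three quotients share their denominator, hence also this term; only for that
    reason do the three scalar identities combine into one for \<open>\<phi>\<close>.\<close>
  define \<theta> where "\<theta> = (\<lambda>q h. - 2 * (snd (X0 q) \<bullet> h) / fst (X0 q))"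
  have nz: "fst (X (1, 0) q) \<noteq> 0" if "q \<in> S" for q using that by (simp add: S_def X0_def)
  note coord = projective_coordinate[OF S(1) _ comps(1) comps(1) comps(2) comps(3) comps(2) comps(3) nz]
  have f: "(f i has_derivative (\<lambda>h. (snd (Y i q) \<bullet> h * fst (X0 q) - fst (Y i q) * (snd (X0 q) \<bullet> h)) / (fst (X0 q) * fst (X0 q)))) (at q)"
    "frechet_derivative (\<lambda>q. frechet_derivative (f i) (at q) h) (at q) h
      = frechet_derivative (f i) (at q) (spray (G q) h + \<theta> q h *\<^sub>R h)" if "q \<in> S" for i q h
    using coord[OF that] that unfolding f_def Y_def X0_def \<theta>_def by auto
  have smf: "smooth_on S (f i)" for i
    unfolding f_def Y_def X0_def
    by (intro smooth_on_divide smooth_on_fst S smooth_on_subset[OF smX S(3)] nz)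
  define \<phi> where "\<phi> = (\<lambda>q. (f 0 q, f 1 q, f 2 q))"
  have sm\<phi>: "smooth_on S \<phi>" unfolding \<phi>_def by (intro smooth_on_Pair S smf)
  have D\<phi>: "frechet_derivative \<phi> (at q) h = (frechet_derivative (f 0) (at q) h, frechet_derivative (f 1) (at q) h, frechet_derivative (f 2) (at q) h)"
    if "q \<in> S" for q h
  proof -
    have "(\<phi> has_derivative (\<lambda>h. (frechet_derivative (f 0) (at q) h, frechet_derivative (f 1) (at q) h, frechet_derivative (f 2) (at q) h))) (at q)"
      unfolding \<phi>_def by (intro has_derivative_Pair smooth_on_has_derivative[OF smf that])
    from fun_cong[OF frechet_derivative_at[OF this], of h] show ?thesis by simp
  qed
  have D2\<phi>: "frechet_derivative (\<lambda>q. frechet_derivative \<phi> (at q) h) (at q) h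
      = frechet_derivative \<phi> (at q) (spray (G q) h + \<theta> q h *\<^sub>R h)" if q: "q \<in> S" for q h
  proof -
    have "((\<lambda>q. (frechet_derivative (f 0) (at q) h, frechet_derivative (f 1) (at q) h, frechet_derivative (f 2) (at q) h)) has_derivative
      (\<lambda>k. (frechet_derivative (\<lambda>q. frechet_derivative (f 0) (at q) h) (at q) k, frechet_derivative (\<lambda>q. frechet_derivative (f 1) (at q) h) (at q) k,
        frechet_derivative (\<lambda>q. frechet_derivative (f 2) (at q) h) (at q) k))) (at q)"
      by (intro has_derivative_Pair smooth_on_has_derivative[OF smooth_on_frechet_derivative[OF smf] q])
    then have "((\<lambda>q. frechet_derivative \<phi> (at q) h) has_derivative
      (\<lambda>k. (frechet_derivative (\<lambda>q. frechet_derivative (f 0) (at q) h) (at q) k, frechet_derivative (\<lambda>q. frechet_derivative (f 1) (at q) h) (at q) k,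
        frechet_derivative (\<lambda>q. frechet_derivative (f 2) (at q) h) (at q) k))) (at q)"
      by (rule has_derivative_transform_within_open[OF _ S(1) q]) (simp add: D\<phi>)
    from fun_cong[OF frechet_derivative_at[OF this], of h, symmetric] show ?thesis
      by (simp add: D\<phi>[OF q] f(2)[OF q])
  qed
  have D\<phi>p: "frechet_derivative \<phi> (at p) h = h" for h
  proof -
    have "frechet_derivative (f i) (at p) h = frame i \<bullet> h" for i
      using fun_cong[OF frechet_derivative_at[OF f(1)[OF S(2), of i]], of h] X(1) by (simp add: Y_def X0_def del: frame_simps)
    then show ?thesis by (cases h) (simp add: D\<phi>[OF S(2)])
  qed
  obtain V where V: "p \<in> V" "V \<subseteq> S" "point_transformation V \<phi>"
    "\<forall>q\<in>V. \<forall>h. frechet_derivative \<phi> (at q) h = 0 \<longrightarrow> h = 0"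
    using local_diffeomorphism[OF S(1,2) sm\<phi> D\<phi>p] .
  define Q where "Q = (\<lambda>q. spray (G q))"
  have "maps_system V \<phi> (geodesic_F Q) (geodesic_G Q) (\<lambda>_ _ _. 0) (\<lambda>_ _ _. 0)"
    by (rule maps_geodesic_system[where \<theta> = \<theta>])
      (use V(3) point_transformation_def V(4) D2\<phi>[OF subsetD[OF V(2)]] Q_def in blast)+
  moreover have "geodesic_F Q q a b = cubic_F (\<lambda>x. K x q) a b" "geodesic_G Q q a b = cubic_G (\<lambda>x. K x q) a b" for q a b
  proof -
    have "Q q (1, a, b) \<bullet> frame i = G q i 0 0 + 2 * a * G q i 0 1 + 2 * b * G q i 0 2
        + a^2 * G q i 1 1 + 2 * a * b * G q i 1 2 + b^2 * G q i 2 2" if i: "i < 3" for i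
    proof -
      have "Q q (1, a, b) \<bullet> frame i = quad (G q i) (1, a, b)"
        using nat_less_3_cases[OF i] by (auto simp: Q_def spray_def sum_lessThan_3)
      moreover have "G q i 1 0 = G q i 0 1" "G q i 2 0 = G q i 0 2" "G q i 2 1 = G q i 1 2" using symG i by auto
      ultimately show ?thesis by (simp add: quad_def sum_lessThan_3 power2_eq_square algebra_simps)
    qed
    note * = geodesic_system_cubic[where Q = Q and G = "G q", OF this]
    have "coeff_of (G q) = (\<lambda>x. K x q)" unfolding G_def by (rule ext) (rule coeff_of_thomas)
    with * show "geodesic_F Q q a b = cubic_F (\<lambda>x. K x q) a b" "geodesic_G Q q a b = cubic_G (\<lambda>x. K x q) a b" by simp_all
  qed
  then have "geodesic_F Q = (\<lambda>p. cubic_F (\<lambda>x. K x p))" "geodesic_G Q = (\<lambda>p. cubic_G (\<lambda>x. K x p))"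
    by (simp_all add: fun_eq_iff)
  ultimately show "\<exists>V \<phi>. p \<in> V \<and> V \<subseteq> U \<and> point_transformation V \<phi> \<and>
      maps_system V \<phi> (\<lambda>p. cubic_F (\<lambda>x. K x p)) (\<lambda>p. cubic_G (\<lambda>x. K x p)) (\<lambda>_ _ _. 0) (\<lambda>_ _ _. 0)"
    using V S(3) r(2) by (intro exI[of _ V] exI[of _ \<phi>]) auto
qed

theorem theorem2:
  fixes U :: "point set"
    and A22 A23 A33 B2_22 B2_23 B2_33 B3_22 B3_23 B3_33 C2_2 C2_3 C3_2 C3_3 D2 D3 :: "point \<Rightarrow> real"
  assumes "open U"
    and "smooth_on U A22"
    and "smooth_on U A23"
    and "smooth_on U A33"
    and "smooth_on U B2_22"
    and "smooth_on U B2_23"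
    and "smooth_on U B2_33"
    and "smooth_on U B3_22"
    and "smooth_on U B3_23"
    and "smooth_on U B3_33"
    and "smooth_on U C2_2"
    and "smooth_on U C2_3"
    and "smooth_on U C3_2"
    and "smooth_on U C3_3"
    and "smooth_on U D2"
    and "smooth_on U D3"
  shows "linearizable U
     (\<lambda>p y' z'. A22 p * y' ^ 3 + 2 * A23 p * y' ^ 2 * z' + A33 p * y' * z' ^ 2
       + B2_22 p * y' ^ 2 + 2 * B2_23 p * y' * z' + B2_33 p * z' ^ 2
       + C2_2 p * y' + C2_3 p * z' + D2 p)
     (\<lambda>p y' z'. A22 p * y' ^ 2 * z' + 2 * A23 p * y' * z' ^ 2 + A33 p * z' ^ 3
       + B3_22 p * y' ^ 2 + 2 * B3_23 p * y' * z' + B3_33 p * z' ^ 2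
       + C3_2 p * y' + C3_3 p * z' + D3 p)
   \<longleftrightarrow> (\<forall>p\<in>U.
      1/2 * pdx C3_2 p - pdy D3 p + 1/4 * C3_3 p * C3_2 p + 1/4 * C2_2 p * C3_2 p
        - D2 p * B3_22 p - D3 p * B3_23 p = 0 \<and>
      pdx B3_22 p - 1/2 * pdy C3_2 p - A22 p * D3 p + 1/2 * C3_2 p * B2_22 p
        + 1/2 * C3_3 p * B3_22 p - 1/2 * C2_2 p * B3_22 p - 1/2 * B3_23 p * C3_2 p = 0 \<and>
      pdx B3_23 p - 1/3 * pdx B2_22 p + 1/6 * pdy C2_2 p - 4/3 * D3 p * A23 p
        - 2/3 * B3_22 p * C2_3 p + 2/3 * B2_23 p * C3_2 p - 1/2 * pdy C3_3 p = 0 \<and>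
      1/2 * pdx C2_3 p - pdz D2 p + 1/4 * C2_3 p * C3_3 p + 1/4 * C2_3 p * C2_2 p
        - B2_23 p * D2 p - B2_33 p * D3 p = 0 \<and>
      pdx B2_33 p - 1/2 * pdz C2_3 p - D2 p * A33 p + 1/2 * C2_3 p * B3_33 p
        - 1/2 * B2_23 p * C2_3 p - 1/2 * B2_33 p * C3_3 p + 1/2 * B2_33 p * C2_2 p = 0 \<and>
      - pdy A23 p + pdz A22 p - A22 p * B2_23 p - A23 p * B3_23 p + A23 p * B2_22 p
        + A33 p * B3_22 p = 0 \<and>
      - pdy A33 p + pdz A23 p - A22 p * B2_33 p - A23 p * B3_33 p + A23 p * B2_23 p
        + A33 p * B3_23 p = 0 \<and>
      - pdx A23 p + 5/6 * A23 p * C2_2 p + 1/3 * A33 p * C3_2 p - 1/3 * pdz B3_23 p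
        + B2_33 p * B3_22 p + 1/6 * C3_3 p * A23 p - B2_23 p * B3_23 p - 2/3 * pdy B2_23 p
        + 1/3 * pdy B3_33 p + 2/3 * pdz B2_22 p - 1/3 * C2_3 p * A22 p = 0 \<and>
      - pdx A33 p + 1/2 * C2_2 p * A33 p + 1/2 * A33 p * C3_3 p - pdy B2_33 p + pdz B2_23 p
        - B2_22 p * B2_33 p + B2_23 p * B2_23 p - B2_23 p * B3_33 p + B2_33 p * B3_23 p = 0 \<and>
      -2/3 * pdx B2_22 p + 1/3 * pdy C2_2 p - 1/2 * C3_2 p * B3_33 p + D2 p * A22 p
        - 2/3 * D3 p * A23 p - 1/3 * C2_3 p * B3_22 p + 5/6 * B2_23 p * C3_2 p + pdx B3_23 p
        - 1/2 * pdz C3_2 p + 1/2 * C3_3 p * B3_23 p - 1/2 * C2_2 p * B3_23 p = 0 \<and>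
      - pdx A22 p + 1/2 * C2_2 p * A22 p - B3_22 p * B3_33 p + pdy B3_23 p - pdz B3_22 p
        + B3_22 p * B2_23 p + B3_23 p * B3_23 p + 1/2 * C3_3 p * A22 p
        - B3_23 p * B2_22 p = 0 \<and>
      pdy D2 p + B2_22 p * D2 p + D3 p * B2_23 p - D3 p * B3_33 p + 1/2 * pdx C3_3 p
        - 1/2 * pdx C2_2 p - pdz D3 p + 1/4 * C3_3 p * C3_3 p - 1/4 * C2_2 p * C2_2 p
        - B3_23 p * D2 p = 0 \<and>
      -2 * pdx A23 p + 4/3 * pdy B3_33 p + 1/3 * A23 p * C2_2 p + 5/3 * A23 p * C3_3 p
        + 2/3 * C2_3 p * A22 p - 4/3 * pdz B3_23 p - 2/3 * C3_2 p * A33 p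
        + 2 * B3_22 p * B2_33 p - 2 * B3_23 p * B2_23 p - 2/3 * pdy B2_23 p
        + 2/3 * pdz B2_22 p = 0 \<and>
      pdx B2_23 p + 1/2 * pdy C2_3 p - 2 * D2 p * A23 p + 1/2 * C2_3 p * B3_23 p
        + 1/2 * C2_3 p * B2_22 p + 1/2 * C3_3 p * B2_23 p - 1/2 * B2_23 p * C2_2 p
        - B2_33 p * C3_2 p - pdz C2_2 p - D3 p * A33 p = 0 \<and>
      - pdx B2_23 p + pdx B3_33 p + pdy C2_3 p - C2_3 p * B3_23 p + C2_3 p * B2_22 p
        + B2_23 p * C3_3 p - B2_23 p * C2_2 p - 1/2 * pdz C3_3 p - 1/2 * pdz C2_2 p
        - 2 * D3 p * A33 p = 0)"
proof -
  define K where "K = case_coeff A22 A23 A33 B2_22 B2_23 B2_33 B3_22 B3_23 B3_33 C2_2 C2_3 C3_2 C3_3 D2 D3"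
  have K: "K cA22 = A22" "K cA23 = A23" "K cA33 = A33" "K cB2_22 = B2_22" "K cB2_23 = B2_23" "K cB2_33 = B2_33" "K cB3_22 = B3_22" "K cB3_23 = B3_23"
    "K cB3_33 = B3_33" "K cC2_2 = C2_2" "K cC2_3 = C2_3" "K cC3_2 = C3_2" "K cC3_3 = C3_3" "K cD2 = D2" "K cD3 = D3"
    by (simp_all add: K_def)
  have smK: "smooth_on U (K x)" for x
    using assms by (cases x) (simp_all add: K)
  have partials: "frechet_derivative (K x) (at p) (frame 0) = pdx (K x) p"
    "frechet_derivative (K x) (at p) (frame 1) = pdy (K x) p"
    "frechet_derivative (K x) (at p) (frame 2) = pdz (K x) p" if "p \<in> U" for x p
    using partial_derivatives[OF smooth_on_has_derivative[OF smK that]] by simp_all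
  have "linearizable U (\<lambda>p. cubic_F (\<lambda>x. K x p)) (\<lambda>p. cubic_G (\<lambda>x. K x p)) \<longleftrightarrow>
    (\<forall>p\<in>U. linearization_conditions (\<lambda>x. K x p) (\<lambda>l x. frechet_derivative (K x) (at p) (frame l)))"
    (is "?lin \<longleftrightarrow> ?cond")
  proof
    assume ?lin
    then show ?cond using linearizable_imp_linearization_conditions by (intro ballI)
  next
    assume ?cond
    then show ?lin by (intro linearization_conditions_imp_linearizable assms(1) smK) (rule bspec)
  qed
  then show ?thesis
    unfolding cubic_F_def cubic_G_def linearization_conditions_def conditions_def
    by (simp only: partials list.pred_inject simp_thms cong: ball_cong) (simp only: K)
qed

end
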